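(* Let $K/F$ be a Galois field extension of degree $n$ with abelian Galois group, with a fixed enumeration ${\rm Gal}(K/F)=\{\tau_0,\dots,\tau_{n-1}\}$, $\tau_0=\mathrm{id}$, and let $k_0,\dots,k_{n-1}\in K^\times$. Let $A={\rm Men}(K/F,k_0,\dots,k_{n-1})$ be the associated Menichetti algebra. Then: (i) The field $K$ is contained in the left, middle and right nucleus of $A$. (ii) $A$ is a semiassociative algebra over $F$, and $K$ is a maximal commutative subalgebra of $A$. (iii) If $A$ is a proper nonassociative algebra (i.e. not associative), then $A$ is not homogeneous.
   Context: Menichetti algebra: Let $K/F$ be a Galois field extension of degree $n$ with abelian Galois group and fix an enumeration ${\rm Gal}(K/F)=\{\tau_0,\dots,\tau_{n-1}\}$ with $\tau_0=\mathrm{id}$. For $k_0,\dots,k_{n-1}\in K^\times$ put $c_{i,0}=c_{0,j}=1$ and, for nonzero $i,j\in\mathbb{Z}_n$ (with representatives in $\{1,\dots,n-1\}$), $c_{i,j}=k_0^{-1}k_1^{-1}\cdots k_{j-1}^{-1}\,k_ik_{i+1}\cdots k_{i+j-1}$, indices read modulo $n$. (One has $c_{i,j}=c_{j,i}$.) Then ${\rm Men}(K/F,k_0,\dots,k_{n-1})$ is the $K$-vector space $\bigoplus_{i=0}^{n-1}Kz_i$ with the biadditive multiplication determined by $(az_i)\cdot(bz_j)=\tau_j(a)\,b\,c_{j,i}\,z_{i+j}$ for $a,b\in K$, $i,j\in\mathbb{Z}_n$, indices modulo $n$. It is a unital nonassociative $F$-algebra of dimension $n^2$ with unit $z_0$;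 $K$ is identified with the subfield $Kz_0$. Nuclei: With $[x,y,z]=(xy)z-x(yz)$, the left, middle and right nuclei of a nonassociative algebra $A$ are ${\rm Nuc}_l(A)=\{x:[x,A,A]=0\}$, ${\rm Nuc}_m(A)=\{x:[A,x,A]=0\}$, ${\rm Nuc}_r(A)=\{x:[A,A,x]=0\}$, and ${\rm Nuc}(A)$ is their intersection. The center of $A$ consists of the elements of ${\rm Nuc}(A)$ commuting with all elements of $A$; $A$ is $F$-central if its center is $F$. Semiassociative: A finite-dimensional $F$-central nonassociative algebra $A$ is semiassociative if ${\rm Nuc}(A)$ has an étale $F$-subalgebra $E$ (finite product of finite separable field extensions of $F$) such that $A$ is a cyclic and faithful module over $E\otimes_F E$ via $(e\otimes e')a=eae'$. A semiassociative algebra $A$ is semicentral if all simple components of the semisimple quotient ${\rm Nuc}(A)/J({\rm Nuc}(A))$ ($J$ the Jacobson radical) are $F$-central. The atoms of $A$ are these simple components. A semiassociative algebra is homogeneous if it is semicentral and its atoms are all Brauer equivalent to each other.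
   Formalization: The enumeration is additionally assumed to satisfy τ_{i+j}=τ_iτ_j (indices mod n), so Gal(K/F) is cyclic; otherwise (i) fails, since K then does not lie in the left nucleus (e.g. any enumeration for Q(√2,√3)/Q). *)

theory Defs
  imports "HOL-Algebra.Algebra" "HOL-Algebra.UnivPoly"
begin

section \<open>Galois extensions\<close>

definition Gal :: "('k, 'm) ring_scheme \<Rightarrow> 'k set \<Rightarrow> ('k \<Rightarrow> 'k) monoid" where
  "Gal K F = BijGroup (carrier K)
     \<lparr>carrier := {\<sigma> \<in> ring_hom K K \<inter> Bij (carrier K). \<forall>x\<in>F. \<sigma> x = x}\<rparr>"

definition galois_extension :: "('k, 'm) ring_scheme \<Rightarrow> 'k set \<Rightarrow> bool" where
  "galois_extension K F \<longleftrightarrow> field K \<and> subfield F K \<and> ring.finite_dimension K F (carrier K) \<and>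
     {x \<in> carrier K. \<forall>\<sigma> \<in> carrier (Gal K F). \<sigma> x = x} = F"


section \<open>Nonassociative algebras over a field\<close>

locale nonassoc_algebra = field R + module R A for R (structure) and A (structure) +
  assumes mult_closed: "\<lbrakk>x \<in> carrier A; y \<in> carrier A\<rbrakk> \<Longrightarrow> x \<otimes>\<^bsub>A\<^esub> y \<in> carrier A"
    and l_add_mult: "\<lbrakk>x \<in> carrier A; y \<in> carrier A; z \<in> carrier A\<rbrakk> \<Longrightarrow>
      (x \<oplus>\<^bsub>A\<^esub> y) \<otimes>\<^bsub>A\<^esub> z = x \<otimes>\<^bsub>A\<^esub> z \<oplus>\<^bsub>A\<^esub> y \<otimes>\<^bsub>A\<^esub> z"
    and r_add_mult: "\<lbrakk>x \<in> carrier A; y \<in> carrier A; z \<in> carrier A\<rbrakk> \<Longrightarrow>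
      z \<otimes>\<^bsub>A\<^esub> (x \<oplus>\<^bsub>A\<^esub> y) = z \<otimes>\<^bsub>A\<^esub> x \<oplus>\<^bsub>A\<^esub> z \<otimes>\<^bsub>A\<^esub> y"
    and l_smult_mult: "\<lbrakk>a \<in> carrier R; x \<in> carrier A; y \<in> carrier A\<rbrakk> \<Longrightarrow>
      (a \<odot>\<^bsub>A\<^esub> x) \<otimes>\<^bsub>A\<^esub> y = a \<odot>\<^bsub>A\<^esub> (x \<otimes>\<^bsub>A\<^esub> y)"
    and r_smult_mult: "\<lbrakk>a \<in> carrier R; x \<in> carrier A; y \<in> carrier A\<rbrakk> \<Longrightarrow>
      x \<otimes>\<^bsub>A\<^esub> (a \<odot>\<^bsub>A\<^esub> y) = a \<odot>\<^bsub>A\<^esub> (x \<otimes>\<^bsub>A\<^esub> y)"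
    and unit_closed: "\<one>\<^bsub>A\<^esub> \<in> carrier A"
    and l_unit: "x \<in> carrier A \<Longrightarrow> \<one>\<^bsub>A\<^esub> \<otimes>\<^bsub>A\<^esub> x = x"
    and r_unit: "x \<in> carrier A \<Longrightarrow> x \<otimes>\<^bsub>A\<^esub> \<one>\<^bsub>A\<^esub> = x"

definition associator :: "('a, 'm) ring_scheme \<Rightarrow> 'a \<Rightarrow> 'a \<Rightarrow> 'a \<Rightarrow> 'a" where
  "associator A x y z = (x \<otimes>\<^bsub>A\<^esub> y) \<otimes>\<^bsub>A\<^esub> z \<ominus>\<^bsub>A\<^esub> x \<otimes>\<^bsub>A\<^esub> (y \<otimes>\<^bsub>A\<^esub> z)"

definition associative_mult :: "('a, 'm) ring_scheme \<Rightarrow> bool" where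
  "associative_mult A \<longleftrightarrow>
     (\<forall>x\<in>carrier A. \<forall>y\<in>carrier A. \<forall>z\<in>carrier A. (x \<otimes>\<^bsub>A\<^esub> y) \<otimes>\<^bsub>A\<^esub> z = x \<otimes>\<^bsub>A\<^esub> (y \<otimes>\<^bsub>A\<^esub> z))"

definition left_nucleus :: "('a, 'm) ring_scheme \<Rightarrow> 'a set" where
  "left_nucleus A =
     {x \<in> carrier A. \<forall>y\<in>carrier A. \<forall>z\<in>carrier A. associator A x y z = \<zero>\<^bsub>A\<^esub>}"

definition middle_nucleus :: "('a, 'm) ring_scheme \<Rightarrow> 'a set" where
  "middle_nucleus A =
     {x \<in> carrier A. \<forall>y\<in>carrier A. \<forall>z\<in>carrier A. associator A y x z = \<zero>\<^bsub>A\<^esub>}"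

definition right_nucleus :: "('a, 'm) ring_scheme \<Rightarrow> 'a set" where
  "right_nucleus A =
     {x \<in> carrier A. \<forall>y\<in>carrier A. \<forall>z\<in>carrier A. associator A y z x = \<zero>\<^bsub>A\<^esub>}"

definition nucleus :: "('a, 'm) ring_scheme \<Rightarrow> 'a set" where
  "nucleus A = left_nucleus A \<inter> middle_nucleus A \<inter> right_nucleus A"

definition alg_center :: "('a, 'm) ring_scheme \<Rightarrow> 'a set" where
  "alg_center A = {x \<in> nucleus A. \<forall>y\<in>carrier A. x \<otimes>\<^bsub>A\<^esub> y = y \<otimes>\<^bsub>A\<^esub> x}"

text \<open>The base field \<open>R\<close> is identified with the multiples of the unit; the condition
  \<open>\<one> \<noteq> \<zero>\<close> excludes the zero algebra, in which this identification fails.\<close>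

definition central_algebra ::
  "('f, 'r) ring_scheme \<Rightarrow> ('f, 'a, 'm) module_scheme \<Rightarrow> bool" where
  "central_algebra R A \<longleftrightarrow>
     \<one>\<^bsub>A\<^esub> \<noteq> \<zero>\<^bsub>A\<^esub> \<and> alg_center A = (\<lambda>c. c \<odot>\<^bsub>A\<^esub> \<one>\<^bsub>A\<^esub>) ` carrier R"

definition finite_dim ::
  "('f, 'r) ring_scheme \<Rightarrow> ('f, 'a, 'm) module_scheme \<Rightarrow> bool" where
  "finite_dim R A \<longleftrightarrow> (\<exists>S. finite S \<and> S \<subseteq> carrier A \<and>
     (\<forall>x\<in>carrier A. \<exists>f \<in> S \<rightarrow> carrier R. x = (\<Oplus>\<^bsub>A\<^esub>s\<in>S. f s \<odot>\<^bsub>A\<^esub> s)))"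

text \<open>Closure under negation and \<open>\<zero> \<in> B\<close> follow from closure under scalars.\<close>

definition unital_subalgebra ::
  "('f, 'r) ring_scheme \<Rightarrow> ('f, 'a, 'm) module_scheme \<Rightarrow> 'a set \<Rightarrow> bool" where
  "unital_subalgebra R A B \<longleftrightarrow> B \<subseteq> carrier A \<and> \<one>\<^bsub>A\<^esub> \<in> B \<and>
     (\<forall>x\<in>B. \<forall>y\<in>B. x \<oplus>\<^bsub>A\<^esub> y \<in> B \<and> x \<otimes>\<^bsub>A\<^esub> y \<in> B) \<and>
     (\<forall>a\<in>carrier R. \<forall>x\<in>B. a \<odot>\<^bsub>A\<^esub> x \<in> B)"

definition commutative_subalgebra ::
  "('f, 'r) ring_scheme \<Rightarrow> ('f, 'a, 'm) module_scheme \<Rightarrow> 'a set \<Rightarrow> bool" where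
  "commutative_subalgebra R A B \<longleftrightarrow>
     unital_subalgebra R A B \<and> (\<forall>x\<in>B. \<forall>y\<in>B. x \<otimes>\<^bsub>A\<^esub> y = y \<otimes>\<^bsub>A\<^esub> x)"

definition maximal_commutative_subalgebra ::
  "('f, 'r) ring_scheme \<Rightarrow> ('f, 'a, 'm) module_scheme \<Rightarrow> 'a set \<Rightarrow> bool" where
  "maximal_commutative_subalgebra R A B \<longleftrightarrow> commutative_subalgebra R A B \<and>
     (\<forall>C. commutative_subalgebra R A C \<and> B \<subseteq> C \<longrightarrow> C = B)"

definition alg_iso ::
  "('f, 'r) ring_scheme \<Rightarrow> ('f, 'a, 'm) module_scheme \<Rightarrow> ('f, 'b, 'n) module_scheme
    \<Rightarrow> ('a \<Rightarrow> 'b) set" where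
  "alg_iso R A B = {h \<in> ring_iso A B.
     \<forall>a\<in>carrier R. \<forall>x\<in>carrier A. h (a \<odot>\<^bsub>A\<^esub> x) = a \<odot>\<^bsub>B\<^esub> h x}"


section \<open>Etale algebras\<close>

definition formal_deriv :: "('f, 'r) ring_scheme \<Rightarrow> (nat \<Rightarrow> 'f) \<Rightarrow> nat \<Rightarrow> 'f" where
  "formal_deriv R p = (\<lambda>i. [Suc i] \<cdot>\<^bsub>R\<^esub> coeff (UP R) p (Suc i))"

definition separable_poly :: "('f, 'r) ring_scheme \<Rightarrow> (nat \<Rightarrow> 'f) \<Rightarrow> bool" where
  "separable_poly R p \<longleftrightarrow> (\<forall>d \<in> carrier (UP R).
     d divides\<^bsub>UP R\<^esub> p \<and> d divides\<^bsub>UP R\<^esub> formal_deriv R p \<longrightarrow> d \<in> Units (UP R))"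

text \<open>The polynomial \<open>p\<close> below is the minimal polynomial of \<open>x\<close> over \<open>R\<close>, up to a unit factor.\<close>

definition separable_element ::
  "('f, 'r) ring_scheme \<Rightarrow> ('f, 'a, 'm) module_scheme \<Rightarrow> 'a \<Rightarrow> bool" where
  "separable_element R L x \<longleftrightarrow> (\<exists>p \<in> carrier (UP R).
     ring_irreducible\<^bsub>UP R\<^esub> p \<and> eval R L (\<lambda>c. c \<odot>\<^bsub>L\<^esub> \<one>\<^bsub>L\<^esub>) x p = \<zero>\<^bsub>L\<^esub> \<and> separable_poly R p)"

definition finite_separable_extension ::
  "('f, 'r) ring_scheme \<Rightarrow> ('f, 'a, 'm) module_scheme \<Rightarrow> bool" where
  "finite_separable_extension R L \<longleftrightarrow>
     field L \<and> algebra R L \<and> finite_dim R L \<and> (\<forall>x\<in>carrier L. separable_element R L x)"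

definition product_algebra ::
  "nat \<Rightarrow> (nat \<Rightarrow> ('f, 'a) module) \<Rightarrow> ('f, nat \<Rightarrow> 'a) module" where
  "product_algebra m L =
     \<lparr>carrier = (\<Pi>\<^sub>E i\<in>{..<m}. carrier (L i)),
      monoid.mult = (\<lambda>x y. \<lambda>i\<in>{..<m}. x i \<otimes>\<^bsub>L i\<^esub> y i),
      one = (\<lambda>i\<in>{..<m}. \<one>\<^bsub>L i\<^esub>),
      ring.zero = (\<lambda>i\<in>{..<m}. \<zero>\<^bsub>L i\<^esub>),
      ring.add = (\<lambda>x y. \<lambda>i\<in>{..<m}. x i \<oplus>\<^bsub>L i\<^esub> y i),
      smult = (\<lambda>a x. \<lambda>i\<in>{..<m}. a \<odot>\<^bsub>L i\<^esub> x i)\<rparr>"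

text \<open>Taking the factors on the type of \<open>E\<close> itself loses no generality: the factors of
  \<open>E\<close> can be realised as the ideals generated by its primitive idempotents.\<close>

definition etale_algebra ::
  "('f, 'r) ring_scheme \<Rightarrow> ('f, 'a, 'm) module_scheme \<Rightarrow> bool" where
  "etale_algebra R E \<longleftrightarrow> (\<exists>m (L :: nat \<Rightarrow> ('f, 'a) module).
     (\<forall>i<m. finite_separable_extension R (L i)) \<and> alg_iso R E (product_algebra m L) \<noteq> {})"


section \<open>The action of a tensor square and semiassociative algebras\<close>

text \<open>The additive group of \<open>E \<otimes>\<^sub>R E\<close> is the free abelian group on \<open>E \<times> E\<close> modulo the
  relations of biadditivity and \<open>R\<close>-balancedness.\<close>

definition tensor_relations ::
  "('f, 'r) ring_scheme \<Rightarrow> ('f, 'a, 'm) module_scheme \<Rightarrow> 'a set \<Rightarrow> (('a \<times> 'a) \<Rightarrow>\<^sub>0 int) set" where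
  "tensor_relations R A E =
     {frag_of (x \<oplus>\<^bsub>A\<^esub> y, z) - frag_of (x, z) - frag_of (y, z) | x y z. x \<in> E \<and> y \<in> E \<and> z \<in> E} \<union>
     {frag_of (z, x \<oplus>\<^bsub>A\<^esub> y) - frag_of (z, x) - frag_of (z, y) | x y z. x \<in> E \<and> y \<in> E \<and> z \<in> E} \<union>
     {frag_of (a \<odot>\<^bsub>A\<^esub> x, y) - frag_of (x, a \<odot>\<^bsub>A\<^esub> y) | a x y. a \<in> carrier R \<and> x \<in> E \<and> y \<in> E}"

definition tensor_square ::
  "('f, 'r) ring_scheme \<Rightarrow> ('f, 'a, 'm) module_scheme \<Rightarrow> 'a set
    \<Rightarrow> (('a \<times> 'a) \<Rightarrow>\<^sub>0 int) set monoid" where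
  "tensor_square R A E = free_Abelian_group (E \<times> E) Mod
     generate (free_Abelian_group (E \<times> E)) (tensor_relations R A E)"

text \<open>The action of \<open>\<Sum> n\<^sub>i (e\<^sub>i, e'\<^sub>i)\<close> on \<open>x\<close> is \<open>\<Sum> n\<^sub>i e\<^sub>i x e'\<^sub>i\<close>. It respects the relations
  when \<open>E\<close> is contained in the nucleus, so that all representatives \<open>t\<close> of a class \<open>T\<close> act alike.\<close>

definition frag_action ::
  "('a, 'm) ring_scheme \<Rightarrow> (('a \<times> 'a) \<Rightarrow>\<^sub>0 int) \<Rightarrow> 'a \<Rightarrow> 'a" where
  "frag_action A t x = (\<Oplus>\<^bsub>A\<^esub>p\<in>Poly_Mapping.keys t.
     [Poly_Mapping.lookup t p] \<cdot>\<^bsub>A\<^esub> ((fst p \<otimes>\<^bsub>A\<^esub> x) \<otimes>\<^bsub>A\<^esub> snd p))"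

definition tensor_action ::
  "('a, 'm) ring_scheme \<Rightarrow> (('a \<times> 'a) \<Rightarrow>\<^sub>0 int) set \<Rightarrow> 'a \<Rightarrow> 'a" where
  "tensor_action A T x = the_elem ((\<lambda>t. frag_action A t x) ` T)"

definition cyclic_tensor_module ::
  "('f, 'r) ring_scheme \<Rightarrow> ('f, 'a, 'm) module_scheme \<Rightarrow> 'a set \<Rightarrow> bool" where
  "cyclic_tensor_module R A E \<longleftrightarrow> (\<exists>x\<in>carrier A.
     carrier A = (\<lambda>T. tensor_action A T x) ` carrier (tensor_square R A E))"

definition faithful_tensor_module ::
  "('f, 'r) ring_scheme \<Rightarrow> ('f, 'a, 'm) module_scheme \<Rightarrow> 'a set \<Rightarrow> bool" where
  "faithful_tensor_module R A E \<longleftrightarrow> (\<forall>T\<in>carrier (tensor_square R A E).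
     (\<forall>x\<in>carrier A. tensor_action A T x = \<zero>\<^bsub>A\<^esub>) \<longrightarrow> T = \<one>\<^bsub>tensor_square R A E\<^esub>)"

definition semiassociative ::
  "('f, 'r) ring_scheme \<Rightarrow> ('f, 'a, 'm) module_scheme \<Rightarrow> bool" where
  "semiassociative R A \<longleftrightarrow>
     nonassoc_algebra R A \<and> finite_dim R A \<and> central_algebra R A \<and>
     (\<exists>E. unital_subalgebra R A E \<and> E \<subseteq> nucleus A \<and> etale_algebra R (A\<lparr>carrier := E\<rparr>) \<and>
        cyclic_tensor_module R A E \<and> faithful_tensor_module R A E)"


section \<open>Atoms, semicentral and homogeneous algebras\<close>

definition left_ideal :: "'a set \<Rightarrow> ('a, 'm) ring_scheme \<Rightarrow> bool" where
  "left_ideal I R \<longleftrightarrow> additive_subgroup I R \<and> (\<forall>x\<in>carrier R. \<forall>y\<in>I. x \<otimes>\<^bsub>R\<^esub> y \<in> I)"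

definition maximal_left_ideal :: "'a set \<Rightarrow> ('a, 'm) ring_scheme \<Rightarrow> bool" where
  "maximal_left_ideal M R \<longleftrightarrow> left_ideal M R \<and> M \<noteq> carrier R \<and>
     (\<forall>I. left_ideal I R \<and> M \<subseteq> I \<longrightarrow> I = M \<or> I = carrier R)"

definition jacobson_radical :: "('a, 'm) ring_scheme \<Rightarrow> 'a set" where
  "jacobson_radical R = carrier R \<inter> \<Inter> {M. maximal_left_ideal M R}"

definition quotient_algebra :: "('f, 'a, 'm) module_scheme \<Rightarrow> 'a set \<Rightarrow> ('f, 'a set) module" where
  "quotient_algebra A I =
     \<lparr>carrier = carrier (A Quot I), monoid.mult = monoid.mult (A Quot I), one = one (A Quot I),
      ring.zero = ring.zero (A Quot I), ring.add = ring.add (A Quot I),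
      smult = (\<lambda>a C. \<Union>x\<in>C. I +>\<^bsub>A\<^esub> (a \<odot>\<^bsub>A\<^esub> x))\<rparr>"

definition minimal_ideal :: "'a set \<Rightarrow> ('a, 'm) ring_scheme \<Rightarrow> bool" where
  "minimal_ideal I R \<longleftrightarrow> ideal I R \<and> I \<noteq> {\<zero>\<^bsub>R\<^esub>} \<and>
     (\<forall>J. ideal J R \<and> J \<subseteq> I \<longrightarrow> J = {\<zero>\<^bsub>R\<^esub>} \<or> J = I)"

text \<open>The simple components of a semisimple algebra are its minimal two-sided ideals;
  the unit of a component is not that of the ambient algebra.\<close>

definition simple_components ::
  "('f, 'a, 'm) module_scheme \<Rightarrow> ('f, 'a, 'm) module_scheme set" where
  "simple_components Q =
     {Q\<lparr>carrier := I, one := (THE e. e \<in> I \<and> (\<forall>x\<in>I. e \<otimes>\<^bsub>Q\<^esub> x = x \<and> x \<otimes>\<^bsub>Q\<^esub> e = x))\<rparr> | I.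
       minimal_ideal I Q}"

definition atoms :: "('f, 'a, 'm) module_scheme \<Rightarrow> ('f, 'a set) module set" where
  "atoms A = (let N = A\<lparr>carrier := nucleus A\<rparr>
              in simple_components (quotient_algebra N (jacobson_radical N)))"

definition semicentral ::
  "('f, 'r) ring_scheme \<Rightarrow> ('f, 'a, 'm) module_scheme \<Rightarrow> bool" where
  "semicentral R A \<longleftrightarrow> semiassociative R A \<and> (\<forall>B\<in>atoms A. central_algebra R B)"

definition matrix_algebra ::
  "nat \<Rightarrow> ('f, 'a, 'm) module_scheme \<Rightarrow> ('f, nat \<times> nat \<Rightarrow> 'a) module" where
  "matrix_algebra r B =
     \<lparr>carrier = ({..<r} \<times> {..<r} \<rightarrow>\<^sub>E carrier B),
      monoid.mult = (\<lambda>M N. \<lambda>(i, j)\<in>{..<r} \<times> {..<r}. \<Oplus>\<^bsub>B\<^esub>l\<in>{..<r}. M (i, l) \<otimes>\<^bsub>B\<^esub> N (l, j)),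
      one = (\<lambda>(i, j)\<in>{..<r} \<times> {..<r}. if i = j then \<one>\<^bsub>B\<^esub> else \<zero>\<^bsub>B\<^esub>),
      ring.zero = (\<lambda>_\<in>{..<r} \<times> {..<r}. \<zero>\<^bsub>B\<^esub>),
      ring.add = (\<lambda>M N. \<lambda>p\<in>{..<r} \<times> {..<r}. M p \<oplus>\<^bsub>B\<^esub> N p),
      smult = (\<lambda>a M. \<lambda>p\<in>{..<r} \<times> {..<r}. a \<odot>\<^bsub>B\<^esub> M p)\<rparr>"

definition brauer_equivalent ::
  "('f, 'r) ring_scheme \<Rightarrow> ('f, 'a, 'm) module_scheme \<Rightarrow> ('f, 'b, 'n) module_scheme \<Rightarrow> bool" where
  "brauer_equivalent R B C \<longleftrightarrow>
     (\<exists>r s. r > 0 \<and> s > 0 \<and> alg_iso R (matrix_algebra r B) (matrix_algebra s C) \<noteq> {})"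

definition homogeneous ::
  "('f, 'r) ring_scheme \<Rightarrow> ('f, 'a, 'm) module_scheme \<Rightarrow> bool" where
  "homogeneous R A \<longleftrightarrow>
     semicentral R A \<and> (\<forall>B\<in>atoms A. \<forall>C\<in>atoms A. brauer_equivalent R B C)"


section \<open>Menichetti algebras\<close>

definition men_c :: "('k, 'm) ring_scheme \<Rightarrow> nat \<Rightarrow> (nat \<Rightarrow> 'k) \<Rightarrow> nat \<Rightarrow> nat \<Rightarrow> 'k" where
  "men_c K n k i j = (if i = 0 \<or> j = 0 then \<one>\<^bsub>K\<^esub>
     else (\<Otimes>\<^bsub>K\<^esub>l\<in>{..<j}. inv\<^bsub>K\<^esub> (k l)) \<otimes>\<^bsub>K\<^esub> (\<Otimes>\<^bsub>K\<^esub>l\<in>{..<j}. k ((i + l) mod n)))"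

text \<open>An element \<open>\<Sum> x\<^sub>i z\<^sub>i\<close> is represented by the family of its coordinates \<open>x\<^sub>i\<close>;
  \<open>men_elt K n a i\<close> is \<open>a z\<^sub>i\<close>.\<close>

definition men_elt :: "('k, 'm) ring_scheme \<Rightarrow> nat \<Rightarrow> 'k \<Rightarrow> nat \<Rightarrow> nat \<Rightarrow> 'k" where
  "men_elt K n a i = (\<lambda>l\<in>{..<n}. if l = i then a else \<zero>\<^bsub>K\<^esub>)"

definition Men ::
  "('k, 'm) ring_scheme \<Rightarrow> nat \<Rightarrow> (nat \<Rightarrow> 'k \<Rightarrow> 'k) \<Rightarrow> (nat \<Rightarrow> 'k) \<Rightarrow> ('k, nat \<Rightarrow> 'k) module" where
  "Men K n \<tau> k =
     \<lparr>carrier = ({..<n} \<rightarrow>\<^sub>E carrier K),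
      monoid.mult = (\<lambda>x y. \<lambda>l\<in>{..<n}.
        finsum K (\<lambda>(i, j). \<tau> j (x i) \<otimes>\<^bsub>K\<^esub> y j \<otimes>\<^bsub>K\<^esub> men_c K n k j i)
          {(i, j). i < n \<and> j < n \<and> (i + j) mod n = l}),
      one = men_elt K n \<one>\<^bsub>K\<^esub> 0,
      ring.zero = (\<lambda>_\<in>{..<n}. \<zero>\<^bsub>K\<^esub>),
      ring.add = (\<lambda>x y. \<lambda>l\<in>{..<n}. x l \<oplus>\<^bsub>K\<^esub> y l),
      smult = (\<lambda>a x. \<lambda>l\<in>{..<n}. a \<otimes>\<^bsub>K\<^esub> x l)\<rparr>"

definition Men_K :: "('k, 'm) ring_scheme \<Rightarrow> nat \<Rightarrow> (nat \<Rightarrow> 'k) set" where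
  "Men_K K n = (\<lambda>a. men_elt K n a 0) ` carrier K \<comment> \<open>the subfield \<open>K z\<^sub>0\<close>\<close>"

text \<open>Indexing the Galois group by \<open>\<int>\<^sub>n\<close> is meant to be compatible with its group law.\<close>

definition cyclic_enumeration ::
  "('k, 'm) ring_scheme \<Rightarrow> 'k set \<Rightarrow> nat \<Rightarrow> (nat \<Rightarrow> 'k \<Rightarrow> 'k) \<Rightarrow> bool" where
  "cyclic_enumeration K F n \<tau> \<longleftrightarrow>
     (\<forall>i<n. \<forall>j<n. \<tau> ((i + j) mod n) = \<tau> i \<otimes>\<^bsub>Gal K F\<^esub> \<tau> j)"

lemma (in field) men_c_nonzero:
  assumes "k \<in> {..<n} \<rightarrow> carrier R - {\<zero>}" "i < n" "j < n"
  shows "men_c R n k i j \<in> carrier R - {\<zero>}"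
proof -
  have prod: "finprod R f S \<in> carrier R - {\<zero>}"
    if "finite S" "f \<in> S \<rightarrow> carrier R - {\<zero>}" for f and S :: "nat set"
    using that
  proof (induction S rule: finite_induct)
    case empty
    then show ?case by simp
  next
    case (insert x S)
    then have "f \<in> S \<rightarrow> carrier R" by blast
    with insert show ?case by (auto simp: integral_iff)
  qed
  have "(\<lambda>l. inv k l) \<in> {..<j} \<rightarrow> carrier R - {\<zero>}"
  proof
    fix l assume "l \<in> {..<j}"
    with assms have "k l \<in> Units R" by (auto simp: field_Units)
    then have "inv k l \<in> Units R" by simp
    then show "inv k l \<in> carrier R - {\<zero>}" by (simp add: field_Units)
  qed
  moreover have "(\<lambda>l. k ((i + l) mod n)) \<in> {..<j} \<rightarrow> carrier R - {\<zero>}"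
    using assms by (auto simp: Pi_iff)
  ultimately show ?thesis
    using prod[of "{..<j}"] by (auto simp: men_c_def integral_iff)
qed

lemma (in field) Men_mult_elt:
  assumes \<tau>: "\<And>j. j < n \<Longrightarrow> \<tau> j \<in> ring_hom R R"
    and k: "k \<in> {..<n} \<rightarrow> carrier R - {\<zero>}"
    and ij: "i < n" "j < n" and ab: "a \<in> carrier R" "b \<in> carrier R"
  shows "men_elt R n a i \<otimes>\<^bsub>Men R n \<tau> k\<^esub> men_elt R n b j =
    men_elt R n (\<tau> j a \<otimes> b \<otimes> men_c R n k j i) ((i + j) mod n)"
proof -
  have zero: "\<tau> l \<zero> = \<zero>" if "l < n" for l
    using \<tau>[OF that] ring_hom_zero[of "\<tau> l" R R] by (simp add: ring_axioms)
  have cl: "\<tau> l x \<in> carrier R" if "l < n" "x \<in> carrier R" for l x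
    using \<tau>[OF that(1)] that(2) by (rule ring_hom_closed)
  have c: "men_c R n k l m \<in> carrier R" if "l < n" "m < n" for l m
    using men_c_nonzero[OF k that] by simp
  have "finsum R (\<lambda>(i', j'). \<tau> j' (men_elt R n a i i') \<otimes> men_elt R n b j j' \<otimes> men_c R n k j' i')
          {(i', j'). i' < n \<and> j' < n \<and> (i' + j') mod n = l} =
        (if l = (i + j) mod n then \<tau> j a \<otimes> b \<otimes> men_c R n k j i else \<zero>)" (is "?S = ?r") for l
  proof -
    let ?P = "{(i', j'). i' < n \<and> j' < n \<and> (i' + j') mod n = l}"
    have fin: "finite ?P"
      by (rule finite_subset[of _ "{..<n} \<times> {..<n}"]) auto
    have "?S = (\<Oplus>p\<in>?P. if (i, j) = p then \<tau> j a \<otimes> b \<otimes> men_c R n k j i else \<zero>)"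
      using ij ab cl c by (intro finsum_cong') (auto simp: men_elt_def zero split: if_splits)
    also have "\<dots> = ?r"
    proof (cases "l = (i + j) mod n")
      case True
      then have "(i, j) \<in> ?P" using ij by simp
      then show ?thesis
        using True fin ij ab cl c
          finsum_singleton[of "(i, j)" ?P "\<lambda>_. \<tau> j a \<otimes> b \<otimes> men_c R n k j i"] by simp
    next
      case False
      then have "(\<Oplus>p\<in>?P. if (i, j) = p then \<tau> j a \<otimes> b \<otimes> men_c R n k j i else \<zero>) = (\<Oplus>p\<in>?P. \<zero>)"
        by (intro finsum_cong') auto
      with False show ?thesis by simp
    qed
    finally show ?thesis .
  qed
  then show ?thesis by (auto simp: Men_def men_elt_def[of _ _ _ "(i + j) mod n"])
qed

text \<open>The compatibility cannot be dispensed with: it is necessary for \<open>K\<close> to lie in the left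
  nucleus. In particular, it forces the Galois group to be cyclic.\<close>

lemma cyclic_enumeration_necessary:
  assumes K: "galois_extension K F"
    and bij: "bij_betw \<tau> {..<n} (carrier (Gal K F))"
    and k: "k \<in> {..<n} \<rightarrow> carrier K - {\<zero>\<^bsub>K\<^esub>}"
    and comm: "comm_group (Gal K F)"
    and left: "Men_K K n \<subseteq> left_nucleus (Men K n \<tau> k)"
    and id: "\<tau> 0 = \<one>\<^bsub>Gal K F\<^esub>"
  shows "cyclic_enumeration K F n \<tau>"
proof -
  interpret field K using K by (simp add: galois_extension_def)
  interpret G: comm_group "Gal K F" by (fact comm)
  let ?A = "Men K n \<tau> k"
  have \<tau>: "\<tau> j \<in> carrier (Gal K F)" if "j < n" for j
    using bij that by (auto simp: bij_betw_def)
  then have hom: "\<tau> j \<in> ring_hom K K" if "j < n" for j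
    using that by (auto simp: Gal_def)
  have cl: "\<tau> l x \<in> carrier K" if "l < n" "x \<in> carrier K" for l x
    using hom[OF that(1)] that(2) by (rule ring_hom_closed)
  have inBij: "\<tau> j \<in> Bij (carrier K)" if "j < n" for j
    using \<tau>[OF that] by (auto simp: Gal_def)
  have mult: "\<tau> i \<otimes>\<^bsub>Gal K F\<^esub> \<tau> j = compose (carrier K) (\<tau> i) (\<tau> j)" if "i < n" "j < n" for i j
    using inBij[OF that(1)] inBij[OF that(2)] by (simp add: Gal_def BijGroup_def)
  have "\<tau> ((j + l) mod n) = \<tau> j \<otimes>\<^bsub>Gal K F\<^esub> \<tau> l" if jl: "j < n" "l < n" for j l
  proof -
    have m: "(j + l) mod n < n" "n > 0" using jl by auto
    let ?c = "men_c K n k l j"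
    have c: "?c \<in> carrier K - {\<zero>\<^bsub>K\<^esub>}" using men_c_nonzero[OF k jl(2,1)] .
    have "\<tau> ((j + l) mod n) a = \<tau> l (\<tau> j a)" if a: "a \<in> carrier K" for a
    proof -
      let ?x = "men_elt K n a 0" and ?y = "men_elt K n \<one>\<^bsub>K\<^esub> j" and ?z = "men_elt K n \<one>\<^bsub>K\<^esub> l"
      have carr: "men_elt K n b i \<in> carrier ?A" if "b \<in> carrier K" for b i
        using that by (auto simp: Men_def men_elt_def)
      have one: "\<tau> l \<one>\<^bsub>K\<^esub> = \<one>\<^bsub>K\<^esub>" using hom[OF jl(2)] by (rule ring_hom_one)
      have c0: "men_c K n k i 0 = \<one>\<^bsub>K\<^esub>" for i by (simp add: men_c_def)
      have L: "(?x \<otimes>\<^bsub>?A\<^esub> ?y) \<otimes>\<^bsub>?A\<^esub> ?z = men_elt K n (\<tau> l (\<tau> j a) \<otimes>\<^bsub>K\<^esub> ?c) ((j + l) mod n)"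
        using jl m a c cl by (simp add: Men_mult_elt[OF hom k] c0)
      have "?y \<otimes>\<^bsub>?A\<^esub> ?z = men_elt K n ?c ((j + l) mod n)"
        using jl c by (simp add: Men_mult_elt[OF hom k] one)
      then have R: "?x \<otimes>\<^bsub>?A\<^esub> (?y \<otimes>\<^bsub>?A\<^esub> ?z) =
          men_elt K n (\<tau> ((j + l) mod n) a \<otimes>\<^bsub>K\<^esub> ?c) ((j + l) mod n)"
        using m a c cl by (simp add: Men_mult_elt[OF hom k] c0)
      have "?x \<in> left_nucleus ?A" using left a by (auto simp: Men_K_def)
      then have assoc: "(?x \<otimes>\<^bsub>?A\<^esub> ?y) \<otimes>\<^bsub>?A\<^esub> ?z \<ominus>\<^bsub>?A\<^esub> ?x \<otimes>\<^bsub>?A\<^esub> (?y \<otimes>\<^bsub>?A\<^esub> ?z) = \<zero>\<^bsub>?A\<^esub>"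
        using carr[of "\<one>\<^bsub>K\<^esub>"] by (auto simp: left_nucleus_def associator_def)
      have ag: "abelian_group ?A"
      proof (rule abelian_groupI)
        fix x assume x: "x \<in> carrier ?A"
        show "\<exists>y\<in>carrier ?A. y \<oplus>\<^bsub>?A\<^esub> x = \<zero>\<^bsub>?A\<^esub>"
          by (rule bexI[of _ "\<lambda>l\<in>{..<n}. \<ominus>\<^bsub>K\<^esub> x l"])
            (use x in \<open>auto simp: Men_def PiE_def Pi_def l_neg intro!: restrict_ext\<close>)
      qed (auto simp: Men_def PiE_def Pi_def extensional_def restrict_def fun_eq_iff a_ac)
      have eq: "p = q"
        if "p \<in> carrier ?A" "q \<in> carrier ?A" "p \<ominus>\<^bsub>?A\<^esub> q = \<zero>\<^bsub>?A\<^esub>" for p q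
        using that abelian_group.minus_equality[OF ag, of p "\<ominus>\<^bsub>?A\<^esub> q"]
          abelian_group.minus_minus[OF ag] abelian_group.a_inv_closed[OF ag]
        by (simp add: abelian_group.minus_eq[OF ag])
      have "men_elt K n (\<tau> l (\<tau> j a) \<otimes>\<^bsub>K\<^esub> ?c) ((j + l) mod n) =
          men_elt K n (\<tau> ((j + l) mod n) a \<otimes>\<^bsub>K\<^esub> ?c) ((j + l) mod n)"
        using assoc eq carr cl a c m jl unfolding L R by simp
      then have "\<tau> l (\<tau> j a) \<otimes>\<^bsub>K\<^esub> ?c = \<tau> ((j + l) mod n) a \<otimes>\<^bsub>K\<^esub> ?c"
        using m by (auto simp: men_elt_def fun_eq_iff dest!: spec[of _ "(j + l) mod n"])
      then show ?thesis using c cl a m jl by (simp add: m_rcancel)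
    qed
    moreover have "\<tau> ((j + l) mod n) \<in> extensional (carrier K)"
      using inBij[OF m(1)] by (simp add: Bij_def)
    ultimately have "\<tau> ((j + l) mod n) = compose (carrier K) (\<tau> l) (\<tau> j)"
      by (intro extensionalityI[of _ "carrier K"]) (auto simp: compose_def)
    also have "\<dots> = \<tau> j \<otimes>\<^bsub>Gal K F\<^esub> \<tau> l"
      using mult[OF jl(2,1)] \<tau> jl by (simp add: G.m_comm)
    finally show ?thesis .
  qed
  then show ?thesis by (simp add: cyclic_enumeration_def)
qed

end

theory Submission
  imports Defs
begin

text \<open>
  In the Menichetti algebra \<open>A = \<Oplus> K z\<^sub>i\<close> the associator of three monomials
  \<open>a z\<^sub>i\<close>, \<open>b z\<^sub>j\<close>, \<open>d z\<^sub>l\<close> is, up to a factor that vanishes only if one of \<open>a\<close>, \<open>b\<close>,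
  \<open>d\<close> is zero, the defect of the family \<open>c\<close> from being a 2-cocycle at \<open>(i, j, l)\<close>.
  The cocycle identity is trivial as soon as one index is \<open>0\<close>, so \<open>K = K z\<^sub>0\<close> lies in all
  three nuclei. Associators of different monomials with a common pair of partners live in
  different components, so the nucleus is spanned by monomials as well: it is
  \<open>N = \<Oplus> K z\<^sub>i\<close> over those \<open>i\<close> for which the cocycle identity holds whenever \<open>i\<close> is one of
  the three indices (\<open>nucleus_A\<close>). An element commuting with \<open>K\<close> has no component outside
  \<open>K z\<^sub>0\<close>, because every \<open>\<tau>\<^sub>l \<noteq> id\<close> moves some element; hence \<open>K\<close> is a maximal commutative
  subalgebra and the center is the fixed field \<open>F\<close>.

  Everything about \<open>K\<close> as an \<open>F\<close>-space comes from one tool, a preimage \<open>\<Sum> a\<^sub>m \<otimes> b\<^sub>m\<close> of a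
  primitive idempotent under the map
  \<open>K \<otimes>\<^sub>F K \<rightarrow> K\<^sup>n\<close>, \<open>x \<otimes> y \<mapsto> (\<tau>\<^sub>l(x) y)\<^sub>l\<close> (\<open>dual_families_exist\<close>). It is the product over
  \<open>l \<noteq> 0\<close> of elements \<open>u \<otimes> 1 - 1 \<otimes> \<tau>\<^sub>l(u)\<close> with \<open>\<tau>\<^sub>l(u) \<noteq> u\<close>, normalised. It yields the dual basis
  formula \<open>x = \<Sum> Tr(x a\<^sub>m) b\<^sub>m\<close>, so \<open>K\<close> is spanned by the \<open>b\<^sub>m\<close>; and since \<open>K \<otimes> K\<close> acts on
  \<open>x z\<^sub>l\<close> by \<open>(\<tau>\<^sub>l(e) x e') z\<^sub>l\<close>, it projects \<open>A\<close> onto each component inside the \<open>K\<close>-bimodule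
  structure (\<open>bimodule_projection\<close>). Thus \<open>\<Sum> z\<^sub>i\<close> generates \<open>A\<close> over \<open>K \<otimes> K\<close>. The action is
  faithful because the dual basis formula rewrites any tensor \<open>\<Sum> x\<^sub>i \<otimes> y\<^sub>i\<close> as
  \<open>\<Sum> b\<^sub>m \<otimes> Y\<^sub>m\<close>, where \<open>Y\<^sub>m = \<Sum> Tr(x\<^sub>i a\<^sub>m) y\<^sub>i\<close> depends only on the values
  \<open>\<Sum> \<tau>\<^sub>l(x\<^sub>i) y\<^sub>i\<close> (\<open>faithful_E\<close>). Separability of \<open>K\<close> over \<open>F\<close> is the classical argument: the
  monic polynomial whose roots are the conjugates of \<open>x\<close> has coefficients in \<open>F\<close> and simple roots
  (\<open>separable_over_base\<close>). Together these make \<open>A\<close> semiassociative with \<open>E = K\<close>.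

  For the last claim, let \<open>S\<close> be the set of indices supporting the nucleus. It is closed under
  addition modulo \<open>n\<close>, hence a subgroup, and the monomials \<open>a z\<^sub>i\<close> with \<open>i \<in> S\<close> and \<open>a \<noteq> 0\<close> are
  units of \<open>N\<close>. Projection to a component turns any nonzero element of a two-sided ideal of \<open>N\<close> into
  such a unit, so \<open>N\<close> is simple (\<open>nucleus_ideal_contains_one\<close>). Its Jacobson radical is a proper
  ideal, therefore zero, and \<open>N\<close> itself is the atom of \<open>A\<close> (\<open>Q_atom\<close>). The center of \<open>N\<close>
  contains the subfield of \<open>K\<close> fixed by all \<open>\<tau>\<^sub>s\<close>, \<open>s \<in> S\<close>. If \<open>A\<close> is semicentral, this field is \<open>F\<close>;
  then \<open>S\<close> is the whole group by a trace argument (\<open>submonoid_fixing_base_full\<close>), the cocycle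
  identity holds for all indices, and \<open>A\<close> is associative. So a Menichetti algebra that is not
  associative is not even semicentral, and a fortiori not homogeneous.
\<close>

section \<open>Nuclei of nonassociative algebras\<close>

context nonassoc_algebra
begin

lemma l_zero_mult: "x \<in> carrier A \<Longrightarrow> \<zero>\<^bsub>A\<^esub> \<otimes>\<^bsub>A\<^esub> x = \<zero>\<^bsub>A\<^esub>"
  using l_smult_mult[of \<zero> "\<zero>\<^bsub>A\<^esub>" x] mult_closed[of "\<zero>\<^bsub>A\<^esub>" x] by simp

lemma r_zero_mult: "x \<in> carrier A \<Longrightarrow> x \<otimes>\<^bsub>A\<^esub> \<zero>\<^bsub>A\<^esub> = \<zero>\<^bsub>A\<^esub>"
  using r_smult_mult[of \<zero> x "\<zero>\<^bsub>A\<^esub>"] mult_closed[of x "\<zero>\<^bsub>A\<^esub>"] by simp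

lemma associator_zero_iff:
  assumes "x \<in> carrier A" "y \<in> carrier A" "z \<in> carrier A"
  shows "associator A x y z = \<zero>\<^bsub>A\<^esub> \<longleftrightarrow> (x \<otimes>\<^bsub>A\<^esub> y) \<otimes>\<^bsub>A\<^esub> z = x \<otimes>\<^bsub>A\<^esub> (y \<otimes>\<^bsub>A\<^esub> z)"
proof -
  have "p \<ominus>\<^bsub>A\<^esub> q = \<zero>\<^bsub>A\<^esub> \<longleftrightarrow> p = q" if "p \<in> carrier A" "q \<in> carrier A" for p q
    using that M.minus_equality[of p "\<ominus>\<^bsub>A\<^esub> q"] by (auto simp: M.minus_eq M.r_neg)
  then show ?thesis using assms by (simp add: associator_def mult_closed)
qed

lemma nucleus_iff:
  "x \<in> nucleus A \<longleftrightarrow> x \<in> carrier A \<and> (\<forall>y\<in>carrier A. \<forall>z\<in>carrier A.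
     (x \<otimes>\<^bsub>A\<^esub> y) \<otimes>\<^bsub>A\<^esub> z = x \<otimes>\<^bsub>A\<^esub> (y \<otimes>\<^bsub>A\<^esub> z) \<and>
     (y \<otimes>\<^bsub>A\<^esub> x) \<otimes>\<^bsub>A\<^esub> z = y \<otimes>\<^bsub>A\<^esub> (x \<otimes>\<^bsub>A\<^esub> z) \<and>
     (y \<otimes>\<^bsub>A\<^esub> z) \<otimes>\<^bsub>A\<^esub> x = y \<otimes>\<^bsub>A\<^esub> (z \<otimes>\<^bsub>A\<^esub> x))"
  by (auto simp: nucleus_def left_nucleus_def middle_nucleus_def right_nucleus_def
      associator_zero_iff)

lemma nucleus_carrier: "x \<in> nucleus A \<Longrightarrow> x \<in> carrier A"
  by (simp add: nucleus_iff)

text \<open>Each rebracketing of a triple containing the product \<open>xy\<close> is a chain of rebracketings of triples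
  that contain \<open>x\<close> or \<open>y\<close> alone.\<close>

lemma nucleus_mult:
  assumes x: "x \<in> nucleus A" and y: "y \<in> nucleus A"
  shows "x \<otimes>\<^bsub>A\<^esub> y \<in> nucleus A"
proof -
  have c: "x \<in> carrier A" "y \<in> carrier A" using x y by (auto dest: nucleus_carrier)
  have xl: "(x \<otimes>\<^bsub>A\<^esub> p) \<otimes>\<^bsub>A\<^esub> q = x \<otimes>\<^bsub>A\<^esub> (p \<otimes>\<^bsub>A\<^esub> q)"
    and xm: "(p \<otimes>\<^bsub>A\<^esub> x) \<otimes>\<^bsub>A\<^esub> q = p \<otimes>\<^bsub>A\<^esub> (x \<otimes>\<^bsub>A\<^esub> q)"
    and yl: "(y \<otimes>\<^bsub>A\<^esub> p) \<otimes>\<^bsub>A\<^esub> q = y \<otimes>\<^bsub>A\<^esub> (p \<otimes>\<^bsub>A\<^esub> q)"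
    and ym: "(p \<otimes>\<^bsub>A\<^esub> y) \<otimes>\<^bsub>A\<^esub> q = p \<otimes>\<^bsub>A\<^esub> (y \<otimes>\<^bsub>A\<^esub> q)"
    and yr: "(p \<otimes>\<^bsub>A\<^esub> q) \<otimes>\<^bsub>A\<^esub> y = p \<otimes>\<^bsub>A\<^esub> (q \<otimes>\<^bsub>A\<^esub> y)"
    if "p \<in> carrier A" "q \<in> carrier A" for p q
    using x y that by (auto simp: nucleus_iff)
  have "((x \<otimes>\<^bsub>A\<^esub> y) \<otimes>\<^bsub>A\<^esub> p) \<otimes>\<^bsub>A\<^esub> q = (x \<otimes>\<^bsub>A\<^esub> y) \<otimes>\<^bsub>A\<^esub> (p \<otimes>\<^bsub>A\<^esub> q) \<and>
    (p \<otimes>\<^bsub>A\<^esub> (x \<otimes>\<^bsub>A\<^esub> y)) \<otimes>\<^bsub>A\<^esub> q = p \<otimes>\<^bsub>A\<^esub> ((x \<otimes>\<^bsub>A\<^esub> y) \<otimes>\<^bsub>A\<^esub> q) \<and>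
    (p \<otimes>\<^bsub>A\<^esub> q) \<otimes>\<^bsub>A\<^esub> (x \<otimes>\<^bsub>A\<^esub> y) = p \<otimes>\<^bsub>A\<^esub> (q \<otimes>\<^bsub>A\<^esub> (x \<otimes>\<^bsub>A\<^esub> y))"
    if p: "p \<in> carrier A" and q: "q \<in> carrier A" for p q
  proof (intro conjI)
    show "((x \<otimes>\<^bsub>A\<^esub> y) \<otimes>\<^bsub>A\<^esub> p) \<otimes>\<^bsub>A\<^esub> q = (x \<otimes>\<^bsub>A\<^esub> y) \<otimes>\<^bsub>A\<^esub> (p \<otimes>\<^bsub>A\<^esub> q)"
      using c p q by (simp add: xl yl mult_closed)
    show "(p \<otimes>\<^bsub>A\<^esub> (x \<otimes>\<^bsub>A\<^esub> y)) \<otimes>\<^bsub>A\<^esub> q = p \<otimes>\<^bsub>A\<^esub> ((x \<otimes>\<^bsub>A\<^esub> y) \<otimes>\<^bsub>A\<^esub> q)"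
      using c p q by (simp add: xm[symmetric] xl ym mult_closed)
    have "(p \<otimes>\<^bsub>A\<^esub> q) \<otimes>\<^bsub>A\<^esub> (x \<otimes>\<^bsub>A\<^esub> y) = ((p \<otimes>\<^bsub>A\<^esub> q) \<otimes>\<^bsub>A\<^esub> x) \<otimes>\<^bsub>A\<^esub> y"
      using c p q by (simp add: yr mult_closed)
    also have "(p \<otimes>\<^bsub>A\<^esub> q) \<otimes>\<^bsub>A\<^esub> x = p \<otimes>\<^bsub>A\<^esub> (q \<otimes>\<^bsub>A\<^esub> x)"
      using x p q by (simp add: nucleus_iff)
    also have "(p \<otimes>\<^bsub>A\<^esub> (q \<otimes>\<^bsub>A\<^esub> x)) \<otimes>\<^bsub>A\<^esub> y = p \<otimes>\<^bsub>A\<^esub> (q \<otimes>\<^bsub>A\<^esub> (x \<otimes>\<^bsub>A\<^esub> y))"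
      using c p q by (simp add: yr mult_closed)
    finally show "(p \<otimes>\<^bsub>A\<^esub> q) \<otimes>\<^bsub>A\<^esub> (x \<otimes>\<^bsub>A\<^esub> y) = p \<otimes>\<^bsub>A\<^esub> (q \<otimes>\<^bsub>A\<^esub> (x \<otimes>\<^bsub>A\<^esub> y))" .
  qed
  then show ?thesis using c by (simp add: nucleus_iff mult_closed)
qed

lemma nucleus_add:
  "\<lbrakk>x \<in> nucleus A; y \<in> nucleus A\<rbrakk> \<Longrightarrow> x \<oplus>\<^bsub>A\<^esub> y \<in> nucleus A"
  by (simp add: nucleus_iff mult_closed l_add_mult r_add_mult)

lemma nucleus_smult:
  "\<lbrakk>a \<in> carrier R; x \<in> nucleus A\<rbrakk> \<Longrightarrow> a \<odot>\<^bsub>A\<^esub> x \<in> nucleus A"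
  by (simp add: nucleus_iff mult_closed l_smult_mult r_smult_mult)

lemma nucleus_one: "\<one>\<^bsub>A\<^esub> \<in> nucleus A"
  by (simp add: nucleus_iff mult_closed unit_closed l_unit r_unit)

lemma nucleus_zero: "\<zero>\<^bsub>A\<^esub> \<in> nucleus A"
  by (simp add: nucleus_iff mult_closed l_zero_mult r_zero_mult)

lemma nucleus_minus: "x \<in> nucleus A \<Longrightarrow> \<ominus>\<^bsub>A\<^esub> x \<in> nucleus A"
  using nucleus_smult[of "\<ominus> \<one>" x] nucleus_carrier[of x] smult_l_minus[of \<one> x] by simp

lemma nucleus_ring: "ring (A\<lparr>carrier := nucleus A\<rparr>)"
proof (rule ringI)
  show "abelian_group (A\<lparr>carrier := nucleus A\<rparr>)"
  proof (rule abelian_groupI)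
    fix x assume "x \<in> carrier (A\<lparr>carrier := nucleus A\<rparr>)"
    then show "\<exists>y\<in>carrier (A\<lparr>carrier := nucleus A\<rparr>).
        y \<oplus>\<^bsub>A\<lparr>carrier := nucleus A\<rparr>\<^esub> x = \<zero>\<^bsub>A\<lparr>carrier := nucleus A\<rparr>\<^esub>"
      by (intro bexI[of _ "\<ominus>\<^bsub>A\<^esub> x"]) (auto simp: M.l_neg nucleus_carrier nucleus_minus)
  qed (auto simp: nucleus_carrier nucleus_add nucleus_zero M.a_ac)
  show "Group.monoid (A\<lparr>carrier := nucleus A\<rparr>)"
    by (rule Group.monoidI)
      (auto simp: nucleus_carrier nucleus_mult nucleus_one l_unit r_unit, simp add: nucleus_iff)
qed (auto simp: nucleus_carrier l_add_mult r_add_mult)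

end

section \<open>Finitely spanned modules\<close>

text \<open>With this lemma and the next two, finite dimensionality can be shown from expansions indexed by an
  initial segment of the naturals, with repeated vectors allowed, whereas \<open>finite_dim\<close> speaks of
  coefficient functions on a finite set of vectors.\<close>

lemma (in module) finite_span_add_closed:
  assumes S: "finite S" "S \<subseteq> carrier M"
    and x: "\<exists>f\<in>S \<rightarrow> carrier R. x = (\<Oplus>\<^bsub>M\<^esub>s\<in>S. f s \<odot>\<^bsub>M\<^esub> s)"
    and y: "\<exists>f\<in>S \<rightarrow> carrier R. y = (\<Oplus>\<^bsub>M\<^esub>s\<in>S. f s \<odot>\<^bsub>M\<^esub> s)"
  shows "\<exists>f\<in>S \<rightarrow> carrier R. x \<oplus>\<^bsub>M\<^esub> y = (\<Oplus>\<^bsub>M\<^esub>s\<in>S. f s \<odot>\<^bsub>M\<^esub> s)"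
proof -
  from x y obtain f g where f: "f \<in> S \<rightarrow> carrier R" "x = (\<Oplus>\<^bsub>M\<^esub>s\<in>S. f s \<odot>\<^bsub>M\<^esub> s)"
    and g: "g \<in> S \<rightarrow> carrier R" "y = (\<Oplus>\<^bsub>M\<^esub>s\<in>S. g s \<odot>\<^bsub>M\<^esub> s)" by blast
  have cl: "(\<lambda>s. h s \<odot>\<^bsub>M\<^esub> s) \<in> S \<rightarrow> carrier M" if "h \<in> S \<rightarrow> carrier R" for h
    using that S by (auto simp: Pi_iff subset_iff)
  have "x \<oplus>\<^bsub>M\<^esub> y = (\<Oplus>\<^bsub>M\<^esub>s\<in>S. f s \<odot>\<^bsub>M\<^esub> s \<oplus>\<^bsub>M\<^esub> g s \<odot>\<^bsub>M\<^esub> s)"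
    using f g S cl by (simp add: M.finsum_addf)
  also have "\<dots> = (\<Oplus>\<^bsub>M\<^esub>s\<in>S. (f s \<oplus> g s) \<odot>\<^bsub>M\<^esub> s)"
    by (rule M.finsum_cong') (use f g S in \<open>auto simp: smult_l_distr Pi_iff subset_iff\<close>)
  finally show ?thesis using f g
    by (intro bexI[of _ "\<lambda>s. f s \<oplus> g s"]) (auto simp: Pi_iff)
qed

lemma (in module) finite_span_smult:
  assumes S: "finite S" "S \<subseteq> carrier M" and s: "s \<in> S" and c: "c \<in> carrier R"
  shows "\<exists>f\<in>S \<rightarrow> carrier R. c \<odot>\<^bsub>M\<^esub> s = (\<Oplus>\<^bsub>M\<^esub>s\<in>S. f s \<odot>\<^bsub>M\<^esub> s)"
proof (rule bexI[of _ "\<lambda>t. if t = s then c else \<zero>"])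
  have "(\<Oplus>\<^bsub>M\<^esub>t\<in>S. (if t = s then c else \<zero>) \<odot>\<^bsub>M\<^esub> t) = (\<Oplus>\<^bsub>M\<^esub>t\<in>S. if s = t then c \<odot>\<^bsub>M\<^esub> t else \<zero>\<^bsub>M\<^esub>)"
    by (rule M.finsum_cong') (use S c in auto)
  also have "\<dots> = c \<odot>\<^bsub>M\<^esub> s"
    using S s c by (intro M.finsum_singleton) auto
  finally show "c \<odot>\<^bsub>M\<^esub> s = (\<Oplus>\<^bsub>M\<^esub>t\<in>S. (if t = s then c else \<zero>) \<odot>\<^bsub>M\<^esub> t)" ..
qed (use c in auto)

lemma (in module) finite_span_finsum:
  assumes S: "finite S" "S \<subseteq> carrier M"
    and g: "\<And>m. m < (N::nat) \<Longrightarrow> g m \<in> S" and c: "\<And>m. m < N \<Longrightarrow> c m \<in> carrier R"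
  shows "\<exists>f\<in>S \<rightarrow> carrier R. (\<Oplus>\<^bsub>M\<^esub>m\<in>{..<N}. c m \<odot>\<^bsub>M\<^esub> g m) = (\<Oplus>\<^bsub>M\<^esub>s\<in>S. f s \<odot>\<^bsub>M\<^esub> s)"
  using g c
proof (induction N)
  case 0
  have "(\<Oplus>\<^bsub>M\<^esub>s\<in>S. \<zero> \<odot>\<^bsub>M\<^esub> s) = \<zero>\<^bsub>M\<^esub>"
    using S by (subst M.finsum_cong'[of S S "\<lambda>_. \<zero>\<^bsub>M\<^esub>"]) auto
  then show ?case by (intro bexI[of _ "\<lambda>_. \<zero>"]) auto
next
  case (Suc N)
  have "(\<Oplus>\<^bsub>M\<^esub>m\<in>{..<Suc N}. c m \<odot>\<^bsub>M\<^esub> g m) = c N \<odot>\<^bsub>M\<^esub> g N \<oplus>\<^bsub>M\<^esub> (\<Oplus>\<^bsub>M\<^esub>m\<in>{..<N}. c m \<odot>\<^bsub>M\<^esub> g m)"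
    unfolding lessThan_Suc using Suc.prems S by (subst M.finsum_insert) (auto simp: subset_iff)
  then show ?case
    using finite_span_add_closed[OF S finite_span_smult[OF S, of "g N" "c N"] Suc.IH] Suc.prems
    by simp
qed

section \<open>The Jacobson radical\<close>

context ring
begin

lemma left_ideal_one_eq_carrier:
  assumes "left_ideal I R" "\<one> \<in> I"
  shows "I = carrier R"
proof -
  have "I \<subseteq> carrier R"
    using assms by (auto simp: left_ideal_def dest: additive_subgroup.a_Hcarr)
  moreover have "x \<in> I" if "x \<in> carrier R" for x
  proof -
    have "x \<otimes> \<one> \<in> I" using assms that unfolding left_ideal_def by blast
    then show ?thesis using that by simp
  qed
  ultimately show ?thesis by blast
qed

lemma left_ideal_translate:
  assumes I: "left_ideal I R" and u: "u \<in> carrier R"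
  shows "left_ideal {y \<in> carrier R. y \<otimes> u \<in> I} R"
proof -
  interpret I: additive_subgroup I R using I by (simp add: left_ideal_def)
  have sm: "x \<otimes> y \<in> I" if "x \<in> carrier R" "y \<in> I" for x y
    using I that by (simp add: left_ideal_def)
  have "additive_subgroup {y \<in> carrier R. y \<otimes> u \<in> I} R"
  proof (rule additive_subgroupI, rule add.subgroupI)
    show "{y \<in> carrier R. y \<otimes> u \<in> I} \<noteq> {}" using u by (auto intro!: exI[of _ \<zero>])
    fix a assume "a \<in> {y \<in> carrier R. y \<otimes> u \<in> I}"
    then show "\<ominus> a \<in> {y \<in> carrier R. y \<otimes> u \<in> I}"
      using u I.a_inv_closed by (auto simp: l_minus)
  qed (use u in \<open>auto simp: l_distr\<close>)
  then show ?thesis using sm u by (auto simp: left_ideal_def m_assoc)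
qed

text \<open>Right multiplication by the unit \<open>u\<close> is an automorphism of the lattice of left ideals, with inverse
  right multiplication by \<open>v\<close>; the set here is \<open>M v\<close>.\<close>

lemma maximal_left_ideal_translate:
  assumes M: "maximal_left_ideal M R" and uv: "u \<in> carrier R" "v \<in> carrier R"
    and inv: "u \<otimes> v = \<one>" "v \<otimes> u = \<one>"
  shows "maximal_left_ideal {y \<in> carrier R. y \<otimes> u \<in> M} R" (is "maximal_left_ideal ?M R")
proof -
  have lM: "left_ideal M R" and nM: "M \<noteq> carrier R"
    and max: "\<And>I. left_ideal I R \<Longrightarrow> M \<subseteq> I \<Longrightarrow> I = M \<or> I = carrier R"
    using M by (auto simp: maximal_left_ideal_def)
  have sM: "M \<subseteq> carrier R"
    using lM by (auto simp: left_ideal_def dest: additive_subgroup.a_Hcarr)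
  have vu: "(y \<otimes> v) \<otimes> u = y" and uv': "(y \<otimes> u) \<otimes> v = y" if "y \<in> carrier R" for y
    using that uv inv by (simp_all add: m_assoc)
  have "?M \<noteq> carrier R"
  proof
    assume "?M = carrier R"
    then have "v \<in> ?M" using uv by blast
    then have "\<one> \<in> M" using inv by simp
    with lM nM show False using left_ideal_one_eq_carrier by blast
  qed
  moreover have "I = ?M \<or> I = carrier R" if I: "left_ideal I R" and sub: "?M \<subseteq> I" for I
  proof -
    let ?I = "{w \<in> carrier R. w \<otimes> v \<in> I}"
    have sI: "I \<subseteq> carrier R"
      using I by (auto simp: left_ideal_def dest: additive_subgroup.a_Hcarr)
    have "M \<subseteq> ?I" using sM sub uv by (auto simp: vu subset_iff)
    then consider "?I = M" | "?I = carrier R"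
      using max[OF left_ideal_translate[OF I uv(2)]] by blast
    then show ?thesis
    proof cases
      case 1
      have "I \<subseteq> ?M" using sI uv by (auto simp: 1[symmetric] uv' subset_iff)
      with sub show ?thesis by blast
    next
      case 2
      then have "u \<in> ?I" using uv by blast
      then show ?thesis using left_ideal_one_eq_carrier[OF I] inv by simp
    qed
  qed
  ultimately show ?thesis
    using left_ideal_translate[OF lM uv(1)] by (simp add: maximal_left_ideal_def)
qed

text \<open>Zorn's lemma: a left ideal is proper exactly if it misses \<open>\<one>\<close>, and this property passes to unions
  of chains.\<close>

lemma maximal_left_ideal_exists:
  assumes "\<one> \<noteq> \<zero>"
  shows "\<exists>M. maximal_left_ideal M R"
proof -
  define \<A> where "\<A> = {I. left_ideal I R \<and> \<one> \<notin> I}"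
  have "\<exists>M\<in>\<A>. \<forall>I\<in>\<A>. M \<subseteq> I \<longrightarrow> I = M"
  proof (rule subset_Zorn_nonempty)
    have "left_ideal {\<zero>} R"
      using zeroideal by (auto simp: left_ideal_def ideal_def ideal_axioms_def)
    with assms have "{\<zero>} \<in> \<A>" by (simp add: \<A>_def)
    then show "\<A> \<noteq> {}" by blast
    fix C assume ne: "C \<noteq> {}" and C: "subset.chain \<A> C"
    have CA: "left_ideal I R" "\<one> \<notin> I" if "I \<in> C" for I
      using C that by (auto simp: subset.chain_def \<A>_def)
    have asub: "additive_subgroup I R" if "I \<in> C" for I
      using CA[OF that] by (simp add: left_ideal_def)
    have "left_ideal (\<Union>C) R"
      unfolding left_ideal_def
    proof (intro conjI ballI)
      show "additive_subgroup (\<Union>C) R"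
      proof (rule additive_subgroupI, rule add.subgroupI)
        show "\<Union>C \<subseteq> carrier R"
          using asub additive_subgroup.a_Hcarr by fastforce
        show "\<Union>C \<noteq> {}"
          using ne asub additive_subgroup.zero_closed by fastforce
        show "\<ominus> a \<in> \<Union>C" if "a \<in> \<Union>C" for a
          using that additive_subgroup.a_inv_closed[OF asub] by blast
        fix a b assume "a \<in> \<Union>C" "b \<in> \<Union>C"
        then obtain I J where IJ: "I \<in> C" "J \<in> C" "a \<in> I" "b \<in> J" by blast
        then have "I \<subseteq> J \<or> J \<subseteq> I" using C by (auto simp: subset.chain_def \<A>_def)
        then obtain H where "H \<in> C" "a \<in> H" "b \<in> H" using IJ by blast
        then show "a \<oplus> b \<in> \<Union>C"
          using additive_subgroup.a_closed[OF asub] by auto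
      qed
      show "x \<otimes> y \<in> \<Union>C" if "x \<in> carrier R" "y \<in> \<Union>C" for x y
        using that CA unfolding left_ideal_def by blast
    qed
    then show "\<Union>C \<in> \<A>" using CA by (auto simp: \<A>_def)
  qed
  then obtain M where M: "left_ideal M R" "\<one> \<notin> M"
    and max: "\<And>I. left_ideal I R \<Longrightarrow> \<one> \<notin> I \<Longrightarrow> M \<subseteq> I \<Longrightarrow> I = M" by (auto simp: \<A>_def)
  then have "maximal_left_ideal M R"
    unfolding maximal_left_ideal_def using left_ideal_one_eq_carrier by blast
  then show ?thesis ..
qed

lemma jacobson_radical_left_ideal: "left_ideal (jacobson_radical R) R"
  unfolding left_ideal_def
proof (intro conjI ballI)
  have M: "additive_subgroup M R" if "maximal_left_ideal M R" for M
    using that by (simp add: maximal_left_ideal_def left_ideal_def)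
  show "additive_subgroup (jacobson_radical R) R"
  proof (rule additive_subgroupI, rule add.subgroupI)
    show "jacobson_radical R \<noteq> {}"
      using additive_subgroup.zero_closed[OF M] by (auto simp: jacobson_radical_def)
    fix a assume "a \<in> jacobson_radical R"
    then show "\<ominus> a \<in> jacobson_radical R"
      using additive_subgroup.a_inv_closed[OF M]
      by (auto simp: jacobson_radical_def)
  qed (auto simp: jacobson_radical_def intro: additive_subgroup.a_closed[OF M])
  show "x \<otimes> y \<in> jacobson_radical R" if "x \<in> carrier R" "y \<in> jacobson_radical R" for x y
    using that by (auto simp: jacobson_radical_def maximal_left_ideal_def left_ideal_def)
qed

text \<open>Translation by a unit permutes the maximal left ideals, so it preserves their intersection. In a
  ring additively generated by units this makes the radical a two-sided ideal without any appeal to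
  simple modules.\<close>

lemma jacobson_radical_mult_unit:
  assumes x: "x \<in> jacobson_radical R" and uv: "u \<in> carrier R" "v \<in> carrier R"
    and inv: "u \<otimes> v = \<one>" "v \<otimes> u = \<one>"
  shows "x \<otimes> u \<in> jacobson_radical R"
  using x maximal_left_ideal_translate[OF _ uv inv] uv(1)
  by (auto simp: jacobson_radical_def)

lemma jacobson_radical_proper:
  assumes "\<one> \<noteq> \<zero>"
  shows "\<one> \<notin> jacobson_radical R"
proof
  assume J: "\<one> \<in> jacobson_radical R"
  obtain M where M: "maximal_left_ideal M R" using maximal_left_ideal_exists[OF assms] ..
  with J have "\<one> \<in> M" by (auto simp: jacobson_radical_def)
  then show False using M left_ideal_one_eq_carrier by (auto simp: maximal_left_ideal_def)
qed

end

section \<open>Roots of polynomials over a field\<close>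

context UP_domain
begin

lemma coeff_linear_factor_mult:
  assumes g: "g \<in> carrier P" and a: "a \<in> carrier R"
  shows "up_ring.coeff P ((up_ring.monom P \<one> 1 \<ominus>\<^bsub>P\<^esub> up_ring.monom P a 0) \<otimes>\<^bsub>P\<^esub> g) (Suc i) =
    up_ring.coeff P g i \<ominus> a \<otimes> up_ring.coeff P g (Suc i)"
proof -
  have "(up_ring.monom P \<one> 1 \<ominus>\<^bsub>P\<^esub> up_ring.monom P a 0) \<otimes>\<^bsub>P\<^esub> g =
      up_ring.monom P \<one> 1 \<otimes>\<^bsub>P\<^esub> g \<ominus>\<^bsub>P\<^esub> a \<odot>\<^bsub>P\<^esub> g"
    using g a by (simp add: P.minus_eq P.l_distr P.l_minus monom_mult_is_smult)
  then show ?thesis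
    using g a coeff_monom_mult[of \<one> g 1 i] by simp
qed

lemma eval_linear_factor_mult:
  assumes "g \<in> carrier P" "a \<in> carrier R" "x \<in> carrier R"
  shows "UnivPoly.eval R R id x ((up_ring.monom P \<one> 1 \<ominus>\<^bsub>P\<^esub> up_ring.monom P a 0) \<otimes>\<^bsub>P\<^esub> g) = (x \<ominus> a) \<otimes> UnivPoly.eval R R id x g"
proof -
  interpret E: UP_pre_univ_prop R R id P by standard simp
  interpret H: ring_hom_cring P R "UnivPoly.eval R R id x"
    by (intro ring_hom_cring.intro ring_hom_cring_axioms.intro E.eval_ring_hom assms UP_cring R_cring)
  show ?thesis using assms by (simp add: P.minus_eq R.minus_eq E.eval_const E.eval_monom1[unfolded One_nat_def])
qed

lemma eval_closed:
  assumes "g \<in> carrier P" "x \<in> carrier R"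
  shows "UnivPoly.eval R R id x g \<in> carrier R"
proof -
  interpret E: UP_pre_univ_prop R R id P by standard simp
  show ?thesis using E.eval_ring_hom[OF assms(2)] assms(1) by (rule ring_hom_closed)
qed

lemma eval_eq_sum:
  assumes g: "g \<in> carrier P" and x: "x \<in> carrier R" and m: "\<And>i. i > m \<Longrightarrow> up_ring.coeff P g i = \<zero>"
  shows "UnivPoly.eval R R id x g = (\<Oplus>i\<in>{..m}. up_ring.coeff P g i \<otimes> x [^] i)"
proof -
  have "deg R g \<le> m" using g m by (intro deg_aboveI) auto
  then have "(\<Oplus>i\<in>{..deg R g}. up_ring.coeff P g i \<otimes> x [^] i) = (\<Oplus>i\<in>{..m}. up_ring.coeff P g i \<otimes> x [^] i)"
    using g x by (intro R.add.finprod_mono_neutral_cong_left) (auto simp: deg_aboveD)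
  then show ?thesis using g by (simp add: eval_on_carrier)
qed

lemma card_roots_le_deg:
  assumes "finite S" "S \<subseteq> carrier R" "f \<in> carrier P" "f \<noteq> \<zero>\<^bsub>P\<^esub>"
    "\<And>s. s \<in> S \<Longrightarrow> UnivPoly.eval R R id s f = \<zero>"
  shows "card S \<le> deg R f"
  using assms
proof (induction S arbitrary: f rule: finite_induct)
  case (insert a S)
  have a: "a \<in> carrier R" and f: "f \<in> carrier P" using insert.prems by auto
  have nt: "carrier R \<noteq> {\<zero>}" by (simp add: R.carrier_one_not_zero)
  obtain q where q: "q \<in> carrier P"
    and fq: "f = (up_ring.monom P \<one> 1 \<ominus>\<^bsub>P\<^esub> up_ring.monom P a 0) \<otimes>\<^bsub>P\<^esub> q \<oplus>\<^bsub>P\<^esub> up_ring.monom P (UnivPoly.eval R R id a f) 0"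
    using remainder_theorem[OF f a nt] by blast
  let ?g = "up_ring.monom P \<one> 1 \<ominus>\<^bsub>P\<^esub> up_ring.monom P a 0"
  have g: "?g \<in> carrier P" using a by simp
  have fq: "f = ?g \<otimes>\<^bsub>P\<^esub> q"
    using fq insert.prems(4)[of a] q g by simp
  have q0: "q \<noteq> \<zero>\<^bsub>P\<^esub>" using insert.prems(3) fq g by auto
  have "UnivPoly.eval R R id s q = \<zero>" if s: "s \<in> S" for s
  proof -
    have sc: "s \<in> carrier R" using s insert.prems by auto
    have "(s \<ominus> a) \<otimes> UnivPoly.eval R R id s q = \<zero>"
      using insert.prems(4)[of s] s eval_linear_factor_mult[OF q a sc] fq by (metis insertI2)
    moreover have "s \<ominus> a \<noteq> \<zero>" using s insert.hyps sc a by auto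
    ultimately show ?thesis
      using R.integral sc a eval_closed[OF q sc] by blast
  qed
  then have le: "card S \<le> deg R q" using insert.IH[OF _ q q0] insert.prems(1) by blast
  have "deg R ?g = 1" using deg_minus_monom[OF a nt] by simp
  moreover from this have "?g \<noteq> \<zero>\<^bsub>P\<^esub>" by (metis deg_nzero_nzero zero_neq_one)
  ultimately have "deg R f = 1 + deg R q"
    unfolding fq using g q q0 by (subst deg_mult) auto
  with le show ?case using insert.hyps by simp
qed simp

lemma monic_polynomial_with_roots:
  assumes "finite S" "S \<subseteq> carrier R"
  shows "\<exists>f\<in>carrier P. deg R f = card S \<and> up_ring.coeff P f (card S) = \<one> \<and>
    (\<forall>x\<in>carrier R. UnivPoly.eval R R id x f = \<zero> \<longleftrightarrow> x \<in> S)"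
  using assms
proof (induction S rule: finite_induct)
  case empty
  interpret E: UP_pre_univ_prop R R id P by standard simp
  have "UnivPoly.eval R R id x \<one>\<^bsub>P\<^esub> = \<one>" if "x \<in> carrier R" for x
    using ring_hom_one[OF E.eval_ring_hom[OF that]] .
  then show ?case by (intro bexI[of _ "\<one>\<^bsub>P\<^esub>"]) (auto simp: id_def)
next
  case (insert a S)
  then obtain f where f: "f \<in> carrier P" "deg R f = card S" "up_ring.coeff P f (card S) = \<one>"
    and roots: "\<And>x. x \<in> carrier R \<Longrightarrow> UnivPoly.eval R R id x f = \<zero> \<longleftrightarrow> x \<in> S" by blast
  let ?g = "up_ring.monom P \<one> 1 \<ominus>\<^bsub>P\<^esub> up_ring.monom P a 0"
  have a: "a \<in> carrier R" using insert.prems by simp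
  have f0: "f \<noteq> \<zero>\<^bsub>P\<^esub>" using f(3) by auto
  have "deg R ?g = 1" using deg_minus_monom[OF a] R.carrier_one_not_zero by simp
  moreover from this have "?g \<noteq> \<zero>\<^bsub>P\<^esub>" by (metis deg_nzero_nzero zero_neq_one)
  ultimately have d: "deg R (?g \<otimes>\<^bsub>P\<^esub> f) = card (insert a S)"
    using f f0 a insert.hyps by (subst deg_mult) auto
  have "up_ring.coeff P f (Suc (card S)) = \<zero>" using f by (simp add: deg_aboveD)
  then have "up_ring.coeff P (?g \<otimes>\<^bsub>P\<^esub> f) (card (insert a S)) = \<one>"
    using coeff_linear_factor_mult[OF f(1) a, of "card S"] insert.hyps f(3) a
    by (simp add: R.minus_eq)
  moreover have "UnivPoly.eval R R id x (?g \<otimes>\<^bsub>P\<^esub> f) = \<zero> \<longleftrightarrow> x \<in> insert a S" if x: "x \<in> carrier R" for x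
    using eval_linear_factor_mult[OF f(1) a x] roots[OF x] eval_closed[OF f(1) x] a x
    by (simp add: R.integral_iff)
  moreover have "?g \<otimes>\<^bsub>P\<^esub> f \<in> carrier P" using f a by simp
  ultimately show ?case using d by blast
qed

text \<open>If the derivative of \<open>p = (X - x) g\<close> vanishes, then \<open>x\<close> is a multiple root of \<open>p\<close>. Comparing
  coefficients, a zero derivative means \<open>(i + 1) g\<^sub>i = (i + 1) x g\<^sub>i\<^sub>+\<^sub>1\<close>, which makes the partial sums
  telescope: \<open>g\<^sub>0 + \<dots> + g\<^sub>m\<^sub>-\<^sub>1 x\<^sup>m\<^sup>-\<^sup>1 = m g\<^sub>m x\<^sup>m\<close>. For large \<open>m\<close> the left side is \<open>g(x)\<close> and the right
  side is \<open>0\<close>. This avoids the product rule.\<close>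

lemma zero_derivative_multiple_root:
  assumes g: "g \<in> carrier P" and x: "x \<in> carrier R"
    and deriv: "\<And>i. [Suc i] \<cdot>\<^bsub>R\<^esub> up_ring.coeff P ((up_ring.monom P \<one> 1 \<ominus>\<^bsub>P\<^esub> up_ring.monom P x 0) \<otimes>\<^bsub>P\<^esub> g) (Suc i) = \<zero>"
  shows "UnivPoly.eval R R id x g = \<zero>"
proof -
  have c: "up_ring.coeff P g i \<in> carrier R" for i using g by simp
  have rec: "[Suc i] \<cdot>\<^bsub>R\<^esub> up_ring.coeff P g i = [Suc i] \<cdot>\<^bsub>R\<^esub> (x \<otimes> up_ring.coeff P g (Suc i))" for i
  proof -
    let ?b = "x \<otimes> up_ring.coeff P g (Suc i)"
    have "[Suc i] \<cdot>\<^bsub>R\<^esub> up_ring.coeff P g i = [Suc i] \<cdot>\<^bsub>R\<^esub> ((up_ring.coeff P g i \<ominus> ?b) \<oplus> ?b)"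
      using c x by (simp add: R.minus_eq R.a_assoc R.l_neg)
    also have "\<dots> = [Suc i] \<cdot>\<^bsub>R\<^esub> (up_ring.coeff P g i \<ominus> ?b) \<oplus> [Suc i] \<cdot>\<^bsub>R\<^esub> ?b"
      using c x by (intro R.add.nat_pow_distrib) auto
    finally show ?thesis
      using deriv[of i] coeff_linear_factor_mult[OF g x, of i] c x by simp
  qed
  have sum: "(\<Oplus>i\<in>{..<m}. up_ring.coeff P g i \<otimes> x [^] i) = [m] \<cdot>\<^bsub>R\<^esub> (up_ring.coeff P g m \<otimes> x [^] m)" for m
  proof (induction m)
    case (Suc m)
    have "(\<Oplus>i\<in>{..<Suc m}. up_ring.coeff P g i \<otimes> x [^] i) =
        up_ring.coeff P g m \<otimes> x [^] m \<oplus> [m] \<cdot>\<^bsub>R\<^esub> (up_ring.coeff P g m \<otimes> x [^] m)"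
      unfolding lessThan_Suc using c x Suc by (subst R.finsum_insert) auto
    also have "\<dots> = [Suc m] \<cdot>\<^bsub>R\<^esub> (up_ring.coeff P g m \<otimes> x [^] m)"
      using c x by (simp add: R.a_comm)
    also have "\<dots> = [Suc m] \<cdot>\<^bsub>R\<^esub> up_ring.coeff P g m \<otimes> x [^] m"
      using c x by (intro R.add_pow_ldistr[symmetric]) auto
    also have "\<dots> = [Suc m] \<cdot>\<^bsub>R\<^esub> (x \<otimes> up_ring.coeff P g (Suc m) \<otimes> x [^] m)"
      unfolding rec using c x by (intro R.add_pow_ldistr) auto
    also have "x \<otimes> up_ring.coeff P g (Suc m) \<otimes> x [^] m = up_ring.coeff P g (Suc m) \<otimes> x [^] Suc m"
      using c x by (simp add: R.m_ac)
    finally show ?case .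
  qed simp
  have "UnivPoly.eval R R id x g = (\<Oplus>i\<in>{..<Suc (deg R g)}. up_ring.coeff P g i \<otimes> x [^] i)"
    using g by (simp add: eval_on_carrier lessThan_Suc_atMost)
  also have "\<dots> = \<zero>"
    unfolding sum using g x by (simp add: deg_aboveD del: R.add.nat_pow_Suc)
  finally show ?thesis .
qed

end

section \<open>Polynomials over a subfield\<close>

context field
begin

lemma UP_coeff_eq: "d \<in> carrier (UP R) \<Longrightarrow> up_ring.coeff (UP R) d i = d i"
  by (simp add: UP_def)

text \<open>Polynomials are coefficient functions, so a polynomial over a subfield is literally a polynomial over
  the field. This lemma and the next three transfer coefficients, degrees and values.\<close>

lemma UP_subfield_carrier:
  assumes F: "subfield F R"
  shows "p \<in> carrier (UP (R\<lparr>carrier := F\<rparr>)) \<longleftrightarrow> p \<in> carrier (UP R) \<and> range p \<subseteq> F"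
proof -
  have "p \<in> UNIV \<rightarrow> F \<longleftrightarrow> p \<in> UNIV \<rightarrow> carrier R \<and> range p \<subseteq> F"
    using subfieldE(3)[OF F] by blast
  then show ?thesis by (simp add: UP_def up_def) blast
qed

lemma UP_subfield_coeff:
  assumes F: "subfield F R" and p: "p \<in> carrier (UP (R\<lparr>carrier := F\<rparr>))"
  shows "up_ring.coeff (UP (R\<lparr>carrier := F\<rparr>)) p i = p i" "up_ring.coeff (UP R) p i = p i"
  using p UP_subfield_carrier[OF F, of p] by (auto simp: UP_def)

lemma UP_subfield_deg:
  assumes F: "subfield F R" and p: "p \<in> carrier (UP (R\<lparr>carrier := F\<rparr>))"
  shows "deg (R\<lparr>carrier := F\<rparr>) p = deg R p"
proof -
  have "up_ring.coeff (UP (R\<lparr>carrier := F\<rparr>)) p = up_ring.coeff (UP R) p"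
    using UP_subfield_coeff[OF F p] by (intro ext) simp
  then show ?thesis by (simp add: deg_def bound_def)
qed

lemma UP_subfield_eval:
  assumes F: "subfield F R" and p: "p \<in> carrier (UP (R\<lparr>carrier := F\<rparr>))"
  shows "UnivPoly.eval (R\<lparr>carrier := F\<rparr>) R id x p = UnivPoly.eval R R id x p"
  using p UP_subfield_carrier[OF F, of p]
  by (simp add: UnivPoly.eval_def UP_subfield_deg[OF F p] UP_subfield_coeff[OF F p])

lemma UP_deg_zero_unit:
  assumes "p \<in> carrier (UP R)" "p \<noteq> \<zero>\<^bsub>UP R\<^esub>" "deg R p = 0"
  shows "p \<in> Units (UP R)"
proof -
  interpret UP_domain R "UP R" by unfold_locales
  define c where "c = up_ring.coeff (UP R) p 0"
  have pc: "p = up_ring.monom (UP R) c 0"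
    using deg_zero_impl_monom[OF assms(1,3)] by (simp add: c_def)
  have c: "c \<in> carrier R" using assms(1) by (simp add: c_def)
  have "c \<noteq> \<zero>" using pc assms(2) monom_zero by metis
  then have u: "inv c \<in> carrier R" "inv c \<otimes> c = \<one>" "c \<otimes> inv c = \<one>"
    using c Units_l_inv Units_r_inv Units_inv_closed by (simp_all add: field_Units)
  have m: "up_ring.monom (UP R) a 0 \<otimes>\<^bsub>UP R\<^esub> up_ring.monom (UP R) b 0 = \<one>\<^bsub>UP R\<^esub>"
    if "a \<in> carrier R" "b \<in> carrier R" "a \<otimes> b = \<one>" for a b
    using monom_mult[OF that(1,2), of 0 0] that(3) monom_one by simp
  have "up_ring.monom (UP R) (inv c) 0 \<in> carrier (UP R)" using u(1) by (rule monom_closed)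
  then show ?thesis
    using assms(1) m[OF u(1) c u(2)] m[OF c u(1) u(3)] unfolding pc Units_def by blast
qed

text \<open>Of the two factors in a factorization of \<open>p\<close> one vanishes at \<open>x\<close>. By the last hypothesis it
  then vanishes on all of \<open>S\<close>, so its degree is already that of \<open>p\<close> and the other factor is constant.\<close>

lemma full_root_set_irreducible:
  assumes F: "subfield F R" and p: "p \<in> carrier (UP (R\<lparr>carrier := F\<rparr>))"
    and S: "finite S" "S \<subseteq> carrier R" and x: "x \<in> S"
    and deg: "deg R p = card S" and px: "UnivPoly.eval R R id x p = \<zero>"
    and conj: "\<And>d s. \<lbrakk>d \<in> carrier (UP (R\<lparr>carrier := F\<rparr>)); UnivPoly.eval R R id x d = \<zero>; s \<in> S\<rbrakk>
      \<Longrightarrow> UnivPoly.eval R R id s d = \<zero>"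
  shows "ring_irreducible\<^bsub>UP (R\<lparr>carrier := F\<rparr>)\<^esub> p"
proof -
  let ?F = "R\<lparr>carrier := F\<rparr>"
  let ?PF = "UP ?F"
  interpret F: field ?F using subfield_iff(2)[OF F] .
  interpret K: UP_domain R "UP R" by unfold_locales simp
  interpret PF: UP_domain ?F ?PF by unfold_locales simp
  have sub: "F \<subseteq> carrier R" using F by (rule subfieldE(3))
  have xc: "x \<in> carrier R" using x S by auto
  have "id \<in> ring_hom ?F R" using sub by (intro ring_hom_memI) auto
  then interpret E: UP_pre_univ_prop ?F R id ?PF
    by (intro UP_pre_univ_prop.intro ring_hom_cring.intro ring_hom_cring_axioms.intro
        F.is_cring is_cring PF.UP_cring_axioms)
  have ehom: "UnivPoly.eval ?F R id x \<in> ring_hom ?PF R"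
    by (rule E.eval_ring_hom[OF xc])
  have carr: "q \<in> carrier (UP R)" if "q \<in> carrier ?PF" for q
    using that UP_subfield_carrier[OF F] by blast
  have pos: "0 < card S" using S x by (auto simp: card_gt_0_iff)
  have p0: "p \<noteq> \<zero>\<^bsub>?PF\<^esub>"
  proof
    assume "p = \<zero>\<^bsub>?PF\<^esub>"
    then have "deg ?F p = 0" by simp
    then show False using UP_subfield_deg[OF F p] deg pos by simp
  qed
  have low: "deg ?F d = deg ?F p"
    if d: "d \<in> carrier ?PF" "e \<in> carrier ?PF" "p = d \<otimes>\<^bsub>?PF\<^esub> e" "UnivPoly.eval R R id x d = \<zero>" for d e
  proof -
    have nz: "d \<noteq> \<zero>\<^bsub>?PF\<^esub>" "e \<noteq> \<zero>\<^bsub>?PF\<^esub>" using p0 d by auto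
    have z: "\<zero>\<^bsub>?PF\<^esub> = \<zero>\<^bsub>UP R\<^esub>" by (simp add: UP_def)
    have "card S \<le> deg R d"
      by (rule K.card_roots_le_deg[OF S carr[OF d(1)]]) (use nz z conj[OF d(1,4)] in auto)
    moreover have "deg ?F p = deg ?F d + deg ?F e"
      using PF.deg_mult[OF nz d(1,2)] d(3) by simp
    ultimately show ?thesis
      using deg UP_subfield_deg[OF F p] UP_subfield_deg[OF F d(1)] by linarith
  qed
  have unit: "e \<in> Units ?PF"
    if d: "d \<in> carrier ?PF" "e \<in> carrier ?PF" "p = d \<otimes>\<^bsub>?PF\<^esub> e" "UnivPoly.eval R R id x d = \<zero>" for d e
  proof -
    have nz: "d \<noteq> \<zero>\<^bsub>?PF\<^esub>" "e \<noteq> \<zero>\<^bsub>?PF\<^esub>" using p0 d by auto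
    have "deg ?F p = deg ?F d + deg ?F e"
      using PF.deg_mult[OF nz d(1,2)] d(3) by simp
    then show ?thesis using low[OF d] F.UP_deg_zero_unit[OF d(2) nz(2)] by simp
  qed
  have split: "d \<in> Units ?PF \<or> e \<in> Units ?PF"
    if d: "d \<in> carrier ?PF" "e \<in> carrier ?PF" "p = d \<otimes>\<^bsub>?PF\<^esub> e" for d e
  proof -
    have "UnivPoly.eval R R id x d \<otimes> UnivPoly.eval R R id x e = \<zero>"
      using ring_hom_mult[OF ehom d(1,2)] px d
      by (simp add: UP_subfield_eval[OF F] p del: id_apply)
    then have "UnivPoly.eval R R id x d = \<zero> \<or> UnivPoly.eval R R id x e = \<zero>"
      using integral K.eval_closed[OF carr xc] d by blast
    then show ?thesis using unit[OF d] unit[OF d(2,1)] d PF.P.m_comm by blast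
  qed
  show ?thesis
  proof (rule PF.ring_irreducibleI)
    show "p \<in> carrier ?PF - {\<zero>\<^bsub>?PF\<^esub>}" using p p0 by simp
    show "p \<notin> Units ?PF"
    proof
      assume "p \<in> Units ?PF"
      then obtain q where q: "q \<in> carrier ?PF" "p \<otimes>\<^bsub>?PF\<^esub> q = \<one>\<^bsub>?PF\<^esub>"
        by (auto simp: Units_def)
      then have nz: "q \<noteq> \<zero>\<^bsub>?PF\<^esub>" using p by auto
      have "deg ?F p + deg ?F q = 0" using PF.deg_mult[OF p0 nz p q(1)] q(2) by simp
      then show False using UP_subfield_deg[OF F p] deg pos by simp
    qed
  qed (use split in blast)
qed

end

section \<open>Galois extensions with a cyclic enumeration of the group\<close>

locale cyclic_galois = field K for K :: "('k, 'm) ring_scheme" (structure) +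
  fixes F :: "'k set" and n :: nat and \<tau> :: "nat \<Rightarrow> 'k \<Rightarrow> 'k"
  assumes galois: "galois_extension K F"
    and enum: "bij_betw \<tau> {..<n} (carrier (Gal K F))"
    and tau_0_one: "\<tau> 0 = \<one>\<^bsub>Gal K F\<^esub>"
    and cyclic: "cyclic_enumeration K F n \<tau>"
begin

abbreviation "base \<equiv> K\<lparr>carrier := F\<rparr>"

lemma F: "subfield F K" and F_sub: "F \<subseteq> carrier K"
  using galois subfieldE(3) by (auto simp: galois_extension_def)

lemma base_field: "field base"
  using subfield_iff(2)[OF F] .

lemma tau_Gal: "j < n \<Longrightarrow> \<tau> j \<in> carrier (Gal K F)"
  using enum by (auto simp: bij_betw_def)

lemma tau_hom: "j < n \<Longrightarrow> \<tau> j \<in> ring_hom K K"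
  and tau_Bij: "j < n \<Longrightarrow> \<tau> j \<in> Bij (carrier K)"
  and tau_F: "\<lbrakk>j < n; x \<in> F\<rbrakk> \<Longrightarrow> \<tau> j x = x"
  using tau_Gal by (auto simp: Gal_def)

lemma id_Gal: "(\<lambda>x\<in>carrier K. x) \<in> carrier (Gal K F)"
  using F_sub by (auto simp: Gal_def id_Bij intro!: ring_hom_memI)

lemma n_pos: "0 < n"
  using enum id_Gal by (cases n) (auto simp: bij_betw_def)

lemma tau_closed [simp]: "\<lbrakk>j < n; x \<in> carrier K\<rbrakk> \<Longrightarrow> \<tau> j x \<in> carrier K"
  using tau_hom by (auto intro: ring_hom_closed)

lemma tau_mult: "\<lbrakk>j < n; x \<in> carrier K; y \<in> carrier K\<rbrakk> \<Longrightarrow> \<tau> j (x \<otimes> y) = \<tau> j x \<otimes> \<tau> j y"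
  and tau_add: "\<lbrakk>j < n; x \<in> carrier K; y \<in> carrier K\<rbrakk> \<Longrightarrow> \<tau> j (x \<oplus> y) = \<tau> j x \<oplus> \<tau> j y"
  and tau_one [simp]: "j < n \<Longrightarrow> \<tau> j \<one> = \<one>"
  using tau_hom ring_hom_mult ring_hom_add ring_hom_one by fastforce+

lemma tau_ring_hom_ring: "j < n \<Longrightarrow> ring_hom_ring K K (\<tau> j)"
  by (intro ring_hom_ringI2 ring_axioms tau_hom)

lemma tau_zero [simp]: "j < n \<Longrightarrow> \<tau> j \<zero> = \<zero>"
  using ring_hom_zero[OF tau_hom] ring_axioms by blast

lemma tau_finsum: "\<lbrakk>j < n; f \<in> S \<rightarrow> carrier K\<rbrakk> \<Longrightarrow> \<tau> j (finsum K f S) = finsum K (\<lambda>i. \<tau> j (f i)) S"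
  using ring_hom_ring.hom_finsum[OF tau_ring_hom_ring] by (simp add: comp_def)

lemma tau_inj: "\<lbrakk>j < n; x \<in> carrier K; y \<in> carrier K; \<tau> j x = \<tau> j y\<rbrakk> \<Longrightarrow> x = y"
  using tau_Bij[of j] by (auto simp: Bij_def bij_betw_def dest: inj_onD)

lemma tau_0 [simp]: "x \<in> carrier K \<Longrightarrow> \<tau> 0 x = x"
  by (simp add: tau_0_one Gal_def BijGroup_def)

lemma tau_comp:
  assumes "i < n" "j < n" "x \<in> carrier K"
  shows "\<tau> ((i + j) mod n) x = \<tau> i (\<tau> j x)"
proof -
  have "\<tau> ((i + j) mod n) = \<tau> i \<otimes>\<^bsub>Gal K F\<^esub> \<tau> j"
    using cyclic assms by (simp add: cyclic_enumeration_def)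
  also have "\<dots> = compose (carrier K) (\<tau> i) (\<tau> j)"
    using tau_Bij assms by (simp add: Gal_def BijGroup_def)
  finally show ?thesis using assms by (simp add: compose_def)
qed

lemma F_iff: "x \<in> F \<longleftrightarrow> x \<in> carrier K \<and> (\<forall>j<n. \<tau> j x = x)"
proof -
  have "carrier (Gal K F) = \<tau> ` {..<n}" using enum by (simp add: bij_betw_def)
  moreover have "F = {x \<in> carrier K. \<forall>\<sigma> \<in> carrier (Gal K F). \<sigma> x = x}"
    using galois by (simp add: galois_extension_def)
  ultimately show ?thesis by auto
qed

lemma tau_moves:
  assumes "i < n" "j < n" "i \<noteq> j"
  shows "\<exists>u\<in>carrier K. \<tau> i u \<noteq> \<tau> j u"
proof (rule ccontr)
  assume "\<not> ?thesis"
  then have "\<tau> i = \<tau> j"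
    using tau_Bij assms by (intro extensionalityI[of _ "carrier K"]) (auto simp: Bij_def)
  then show False using enum assms by (auto simp: bij_betw_def inj_on_def)
qed

text \<open>Subtraction of \<open>j\<close> in the cyclic group of residues, written without negative numbers.\<close>

lemma translate_inverse:
  assumes "j < n" "l < n"
  shows "(n - j + (j + l) mod n) mod n = l" "(j + (n - j + l) mod n) mod n = l"
proof -
  have "(n - j + (j + l) mod n) mod n = (n - j + (j + l)) mod n" by (rule mod_add_right_eq)
  also have "n - j + (j + l) = n + l" using assms by simp
  finally show "(n - j + (j + l) mod n) mod n = l" using assms by simp
  have "(j + (n - j + l) mod n) mod n = (j + (n - j + l)) mod n" by (rule mod_add_right_eq)
  also have "j + (n - j + l) = n + l" using assms by simp
  finally show "(j + (n - j + l) mod n) mod n = l" using assms by simp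
qed

lemma bij_translate:
  assumes "j < n"
  shows "bij_betw (\<lambda>l. (j + l) mod n) {..<n} {..<n}"
  by (rule bij_betw_byWitness[where f' = "\<lambda>l. (n - j + l) mod n"])
    (use translate_inverse[OF assms] n_pos in auto)

lemma hom_eval:
  assumes j: "j < n" and d: "d \<in> carrier (UP K)" and x: "x \<in> carrier K"
  shows "\<tau> j \<circ> d \<in> carrier (UP K)"
    and "\<tau> j (UnivPoly.eval K K id x d) = UnivPoly.eval K K id (\<tau> j x) (\<tau> j \<circ> d)"
proof -
  interpret UP_domain K "UP K" by unfold_locales simp
  have up: "d \<in> up K" using d by (simp add: UP_def)
  then have dc: "d i \<in> carrier K" for i by (rule mem_upD)
  obtain m where "bound \<zero> m d" using up unfolding up_def by blast
  then have m: "d i = \<zero>" if "i > m" for i using that by (rule bound.bound)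
  have cd: "up_ring.coeff (UP K) d i = d i" for i using d by (rule UP_coeff_eq)
  have "bound \<zero> m (\<tau> j \<circ> d)" by (rule bound.intro) (simp add: j m)
  moreover have "\<tau> j \<circ> d \<in> UNIV \<rightarrow> carrier K" using dc j by auto
  ultimately show td: "\<tau> j \<circ> d \<in> carrier (UP K)"
    unfolding UP_def up_def partial_object.simps by blast
  have ctd: "up_ring.coeff (UP K) (\<tau> j \<circ> d) i = \<tau> j (d i)" for i using UP_coeff_eq[OF td] by simp
  have pow: "\<tau> j (x [^] i) = \<tau> j x [^] (i::nat)" for i
    using j x by (induction i) (auto simp: tau_mult)
  have "UnivPoly.eval K K id x d = (\<Oplus>i\<in>{..m}. d i \<otimes> x [^] i)"
    using eval_eq_sum[OF d x, of m] m by (simp add: cd)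
  moreover have "UnivPoly.eval K K id (\<tau> j x) (\<tau> j \<circ> d) = (\<Oplus>i\<in>{..m}. \<tau> j (d i) \<otimes> \<tau> j x [^] i)"
    using eval_eq_sum[OF td, of "\<tau> j x" m] m x j by (simp add: ctd)
  moreover have "\<tau> j (\<Oplus>i\<in>{..m}. d i \<otimes> x [^] i) = (\<Oplus>i\<in>{..m}. \<tau> j (d i) \<otimes> \<tau> j x [^] i)"
    using j x dc by (simp add: tau_finsum tau_mult pow)
  ultimately show "\<tau> j (UnivPoly.eval K K id x d) = UnivPoly.eval K K id (\<tau> j x) (\<tau> j \<circ> d)"
    by simp
qed

text \<open>The witness is the monic polynomial whose roots are the Galois conjugates of \<open>x\<close>, each of
  them simple; up to a unit it is the minimal polynomial of \<open>x\<close>.\<close>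

lemma separable_over_base:
  assumes x: "x \<in> carrier K"
  shows "\<exists>p\<in>carrier (UP base). ring_irreducible\<^bsub>UP base\<^esub> p \<and>
    UnivPoly.eval K K id x p = \<zero> \<and> separable_poly base p"
proof -
  interpret K: UP_domain K "UP K" by unfold_locales simp
  interpret B: field base by (rule base_field)
  interpret PB: UP_domain base "UP base" by unfold_locales simp
  define S where "S = (\<lambda>j. \<tau> j x) ` {..<n}"
  have S: "finite S" "S \<subseteq> carrier K" "x \<in> S"
    using x n_pos by (auto simp: S_def image_iff intro!: bexI[of _ 0])
  have pos: "0 < card S" using S by (auto simp: card_gt_0_iff)
  have stable: "\<exists>t\<in>S. \<tau> j t = s" if j: "j < n" and s: "s \<in> S" for j s
  proof -
    obtain l where l: "l < n" "s = \<tau> l x" using s by (auto simp: S_def)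
    then obtain i where i: "i < n" "(j + i) mod n = l"
      using translate_inverse(2)[OF j l(1)] n_pos by (metis mod_less_divisor)
    then show ?thesis using tau_comp[OF j i(1) x] l by (auto simp: S_def)
  qed
  obtain p where p: "p \<in> carrier (UP K)" and dp: "deg K p = card S"
    and lp: "up_ring.coeff (UP K) p (card S) = \<one>"
    and roots: "\<And>s. s \<in> carrier K \<Longrightarrow> UnivPoly.eval K K id s p = \<zero> \<longleftrightarrow> s \<in> S"
    using K.monic_polynomial_with_roots[OF S(1,2)] by blast
  have cp: "up_ring.coeff (UP K) p i = p i" for i using p by (rule UP_coeff_eq)
  have px: "UnivPoly.eval K K id x p = \<zero>" using roots[OF x] S by blast
  \<comment> \<open>Both polynomials are monic of degree \<open>card S\<close> and vanish on \<open>S\<close>, so their difference has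
    more roots than its degree allows.\<close>
  have fix_p: "\<tau> j \<circ> p = p" if j: "j < n" for j
  proof (rule ccontr)
    assume ne: "\<tau> j \<circ> p \<noteq> p"
    let ?q = "\<tau> j \<circ> p"
    have q: "?q \<in> carrier (UP K)" using hom_eval(1)[OF j p x] .
    let ?d = "p \<ominus>\<^bsub>UP K\<^esub> ?q"
    have d: "?d \<in> carrier (UP K)" "?d \<noteq> \<zero>\<^bsub>UP K\<^esub>" using p q ne by auto
    have cq: "up_ring.coeff (UP K) ?q i = \<tau> j (p i)" for i using UP_coeff_eq[OF q] by simp
    have ev: "UnivPoly.eval K K id s ?d = \<zero>" if s: "s \<in> S" for s
    proof -
      interpret E: UP_pre_univ_prop K K id "UP K" by standard simp
      have sc: "s \<in> carrier K" using s S by auto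
      interpret H: ring_hom_cring "UP K" K "UnivPoly.eval K K id s"
        by (intro ring_hom_cring.intro ring_hom_cring_axioms.intro E.eval_ring_hom sc
            K.UP_cring is_cring)
      obtain t where t: "t \<in> S" "\<tau> j t = s" using stable[OF j s] by blast
      then have tc: "t \<in> carrier K" using S by auto
      have "UnivPoly.eval K K id s ?q = \<tau> j (UnivPoly.eval K K id t p)"
        using hom_eval(2)[OF j p tc] t by simp
      also have "UnivPoly.eval K K id t p = \<zero>" using roots[OF tc] t by blast
      finally have "UnivPoly.eval K K id s ?q = \<zero>" by (simp only: tau_zero[OF j])
      moreover have "UnivPoly.eval K K id s p = \<zero>" using roots[OF sc] s by blast
      ultimately show ?thesis using p q by (simp add: K.P.minus_eq del: id_apply)
    qed
    have "card S \<le> deg K ?d" using K.card_roots_le_deg[OF S(1,2) d ev] .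
    moreover have "deg K ?d \<le> card S"
      using p q dp j by (intro K.deg_aboveI) (auto simp: cq cp[symmetric] K.deg_aboveD)
    ultimately have "deg K ?d = card S" by simp
    moreover have "up_ring.coeff (UP K) ?d (card S) = \<zero>"
      using p q lp j by (simp add: cq cp)
    ultimately show False using K.lcoeff_nonzero2[OF d] by simp
  qed
  have pF: "p \<in> carrier (UP base)"
  proof -
    have "p i \<in> F" for i
      using fix_p p cp[of i] K.coeff_closed[OF p, of i] by (auto simp: F_iff fun_eq_iff)
    then show ?thesis using p UP_subfield_carrier[OF F] by blast
  qed
  have irr: "ring_irreducible\<^bsub>UP base\<^esub> p"
  proof (rule full_root_set_irreducible[OF F pF S(1,2,3) dp px])
    fix d s assume d: "d \<in> carrier (UP base)" and dx: "UnivPoly.eval K K id x d = \<zero>" and s: "s \<in> S"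
    have dK: "d \<in> carrier (UP K)" "range d \<subseteq> F" using d UP_subfield_carrier[OF F] by auto
    obtain j where j: "j < n" "s = \<tau> j x" using s by (auto simp: S_def)
    have "\<tau> j \<circ> d = d" using dK(2) tau_F[OF j(1)] by (auto simp: fun_eq_iff)
    then show "UnivPoly.eval K K id s d = \<zero>"
      using hom_eval(2)[OF j(1) dK(1) x] dx j by simp
  qed
  obtain g where g: "g \<in> carrier (UP K)"
    and pg: "p = (up_ring.monom (UP K) \<one> 1 \<ominus>\<^bsub>UP K\<^esub> up_ring.monom (UP K) x 0) \<otimes>\<^bsub>UP K\<^esub> g"
  proof -
    obtain g where g: "g \<in> carrier (UP K)" and "p = (up_ring.monom (UP K) \<one> 1 \<ominus>\<^bsub>UP K\<^esub>
        up_ring.monom (UP K) x 0) \<otimes>\<^bsub>UP K\<^esub> g \<oplus>\<^bsub>UP K\<^esub> up_ring.monom (UP K) (UnivPoly.eval K K id x p) 0"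
      using K.remainder_theorem[OF p x] carrier_one_not_zero by auto
    then show ?thesis using that[OF g] x px by simp
  qed
  \<comment> \<open>Otherwise \<open>g\<close> would vanish on all of \<open>S\<close>, although its degree is only \<open>card S - 1\<close>.\<close>
  have gx: "UnivPoly.eval K K id x g \<noteq> \<zero>"
  proof
    assume gx: "UnivPoly.eval K K id x g = \<zero>"
    let ?l = "up_ring.monom (UP K) \<one> 1 \<ominus>\<^bsub>UP K\<^esub> up_ring.monom (UP K) x 0"
    have g0: "g \<noteq> \<zero>\<^bsub>UP K\<^esub>" using lp pg x by auto
    have "UnivPoly.eval K K id s g = \<zero>" if s: "s \<in> S" for s
    proof (cases "s = x")
      case False
      have sc: "s \<in> carrier K" using s S by auto
      have "(s \<ominus> x) \<otimes> UnivPoly.eval K K id s g = \<zero>"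
        using K.eval_linear_factor_mult[OF g x sc] roots[OF sc] s pg by metis
      moreover have "s \<ominus> x \<noteq> \<zero>" using False sc x by simp
      ultimately show ?thesis using integral[OF _ _ K.eval_closed[OF g sc]] minus_closed[OF sc x] by blast
    qed (use gx in simp)
    then have "card S \<le> deg K g" by (rule K.card_roots_le_deg[OF S(1,2) g g0])
    moreover have dl: "deg K ?l = 1" using K.deg_minus_monom[OF x] carrier_one_not_zero by simp
    moreover have "?l \<noteq> \<zero>\<^bsub>UP K\<^esub>" using dl K.deg_nzero_nzero by (metis zero_neq_one)
    then have "deg K p = deg K ?l + deg K g"
      unfolding pg using g x g0 by (intro K.deg_mult) auto
    ultimately show False using dp by simp
  qed
  have "separable_poly base p"
    unfolding separable_poly_def
  proof (intro ballI impI, elim conjE)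
    fix d assume d: "d \<in> carrier (UP base)" and dvd: "d divides\<^bsub>UP base\<^esub> p"
      and dvd': "d divides\<^bsub>UP base\<^esub> formal_deriv base p"
    obtain e where e: "e \<in> carrier (UP base)" "p = d \<otimes>\<^bsub>UP base\<^esub> e"
      using dvd by (auto simp: factor_def)
    obtain q where q: "q \<in> carrier (UP base)" "formal_deriv base p = d \<otimes>\<^bsub>UP base\<^esub> q"
      using dvd' by (auto simp: factor_def)
    show "d \<in> Units (UP base)"
    proof (rule ccontr)
      assume "d \<notin> Units (UP base)"
      then have "e \<in> Units (UP base)"
        using PB.ring_irreducibleE(5)[OF pF irr d e] by blast
      then obtain e' where e': "e' \<in> carrier (UP base)" "e \<otimes>\<^bsub>UP base\<^esub> e' = \<one>\<^bsub>UP base\<^esub>"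
        by (auto simp: Units_def)
      have "d = p \<otimes>\<^bsub>UP base\<^esub> e'"
        using e e' d by (simp add: PB.P.m_assoc)
      then have r: "formal_deriv base p = p \<otimes>\<^bsub>UP base\<^esub> (e' \<otimes>\<^bsub>UP base\<^esub> q)"
        using q pF e' d by (simp add: PB.P.m_assoc)
      have dc: "formal_deriv base p \<in> carrier (UP base)" using q d by simp
      have cf: "up_ring.coeff (UP base) (formal_deriv base p) i = [Suc i] \<cdot>\<^bsub>base\<^esub> p (Suc i)" for i
        using UP_subfield_coeff(1)[OF F dc] UP_subfield_coeff(1)[OF F pF]
        by (simp add: formal_deriv_def)
      \<comment> \<open>A nonunit common divisor is associated to the irreducible \<open>p\<close>, so \<open>p\<close> divides its own
        derivative, which has smaller degree.\<close>
      have "formal_deriv base p = \<zero>\<^bsub>UP base\<^esub>"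
      proof (rule ccontr)
        assume nz: "formal_deriv base p \<noteq> \<zero>\<^bsub>UP base\<^esub>"
        have le: "deg base (formal_deriv base p) \<le> card S - 1"
        proof (rule PB.deg_aboveI[OF _ dc])
          fix i assume "card S - 1 < i"
          then have "deg base p < Suc i" using dp UP_subfield_deg[OF F pF] by simp
          then have "p (Suc i) = \<zero>"
            using PB.deg_aboveD[of p "Suc i"] pF UP_subfield_coeff(1)[OF F pF] by simp
          then show "up_ring.coeff (UP base) (formal_deriv base p) i = \<zero>\<^bsub>base\<^esub>"
            using B.add.nat_pow_one[of "Suc i"] by (simp only: cf) simp
        qed
        have p0: "p \<noteq> \<zero>\<^bsub>UP base\<^esub>" using PB.ring_irreducibleE(1)[OF pF irr] .
        have eq: "e' \<otimes>\<^bsub>UP base\<^esub> q \<in> carrier (UP base)" using e' q by simp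
        have w0: "e' \<otimes>\<^bsub>UP base\<^esub> q \<noteq> \<zero>\<^bsub>UP base\<^esub>"
          using nz r PB.P.r_null[OF pF] by metis
        have "deg base p + deg base (e' \<otimes>\<^bsub>UP base\<^esub> q) \<le> card S - 1"
          using le PB.deg_mult[OF p0 w0 pF eq] r by metis
        then have "card S \<le> card S - 1"
          using dp UP_subfield_deg[OF F pF] by (metis add_leE)
        with pos show False by linarith
      qed
      then have "[Suc i] \<cdot>\<^bsub>base\<^esub> p (Suc i) = \<zero>" for i
        using cf[of i] by simp
      then have "[Suc i] \<cdot> p (Suc i) = \<zero>" for i
        by (simp add: add_pow_def nat_pow_def)
      then have "UnivPoly.eval K K id x g = \<zero>"
        using K.zero_derivative_multiple_root[OF g x] pg cp by metis
      with gx show False by simp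
    qed
  qed
  with pF irr px show ?thesis by blast
qed

end

section \<open>Dual families and partial traces\<close>

lemma (in abelian_monoid) finsum_lessThan_add:
  fixes f :: "nat \<Rightarrow> 'a"
  assumes "\<And>i. f i \<in> carrier G"
  shows "finsum G f {..<M + N} = finsum G f {..<M} \<oplus> finsum G (\<lambda>i. f (M + i)) {..<N}"
proof (induction N)
  case (Suc N)
  have "finsum G f {..<M + Suc N} = f (M + N) \<oplus> finsum G f {..<M + N}"
    using assms by (simp add: lessThan_Suc finsum_insert)
  moreover have "finsum G (\<lambda>i. f (M + i)) {..<Suc N} = f (M + N) \<oplus> finsum G (\<lambda>i. f (M + i)) {..<N}"
    using assms by (simp add: lessThan_Suc finsum_insert)
  ultimately show ?case using Suc assms by (simp add: a_lcomm)
qed (use assms in simp)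

lemma (in abelian_monoid) finsum_swap:
  assumes "finite S" "finite T" "\<And>i j. i \<in> S \<Longrightarrow> j \<in> T \<Longrightarrow> f i j \<in> carrier G"
  shows "(\<Oplus>i\<in>S. \<Oplus>j\<in>T. f i j) = (\<Oplus>j\<in>T. \<Oplus>i\<in>S. f i j)"
  using assms(1,3)
proof (induction S rule: finite_induct)
  case (insert i S)
  have "(\<Oplus>i\<in>insert i S. \<Oplus>j\<in>T. f i j) = (\<Oplus>j\<in>T. f i j) \<oplus> (\<Oplus>j\<in>T. \<Oplus>i\<in>S. f i j)"
    using insert assms(2) by (subst finsum_insert) (auto intro!: finsum_closed)
  also have "\<dots> = (\<Oplus>j\<in>T. f i j \<oplus> (\<Oplus>i\<in>S. f i j))"
    using insert assms(2) by (intro finsum_addf[symmetric]) (auto intro!: finsum_closed)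
  also have "\<dots> = (\<Oplus>j\<in>T. \<Oplus>i\<in>insert i S. f i j)"
    using insert by (intro finsum_cong') (auto intro!: finsum_closed)
  finally show ?case .
qed (use assms in simp)

context cyclic_galois
begin

text \<open>The vectors in the image of the map \<open>K \<otimes>\<^sub>F K \<rightarrow> K\<^sup>n\<close>, \<open>a \<otimes> b \<mapsto> (\<tau>\<^sub>l(a) b)\<^sub>l\<close>. This image is a
  subring of \<open>K\<^sup>n\<close>; only its stability under addition and under multiplication by pure tensors is
  established, as this suffices to multiply by elements of the form \<open>u \<otimes> 1 - 1 \<otimes> v\<close>.\<close>

definition realizable :: "(nat \<Rightarrow> 'k) \<Rightarrow> bool" where
  "realizable e \<longleftrightarrow> (\<exists>(M::nat) a b. (\<forall>m. a m \<in> carrier K \<and> b m \<in> carrier K) \<and>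
     (\<forall>l<n. e l = (\<Oplus>m\<in>{..<M}. \<tau> l (a m) \<otimes> b m)))"

lemma realizable_closed: "\<lbrakk>realizable e; l < n\<rbrakk> \<Longrightarrow> e l \<in> carrier K"
  by (auto simp: realizable_def intro!: finsum_closed)

lemma realizable_one: "realizable (\<lambda>_. \<one>)"
  unfolding realizable_def
  by (intro exI[of _ "1::nat"] exI[of _ "\<lambda>_. \<one>"]) (auto simp: lessThan_Suc)

lemma realizable_scale:
  assumes "realizable e" "u \<in> carrier K" "v \<in> carrier K"
  shows "realizable (\<lambda>l. \<tau> l u \<otimes> e l \<otimes> v)"
proof -
  obtain M :: nat and a b where ab: "\<And>m. a m \<in> carrier K" "\<And>m. b m \<in> carrier K"
    and e: "\<And>l. l < n \<Longrightarrow> e l = (\<Oplus>m\<in>{..<M}. \<tau> l (a m) \<otimes> b m)"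
    using assms(1) unfolding realizable_def by blast
  have "\<tau> l u \<otimes> e l \<otimes> v = (\<Oplus>m\<in>{..<M}. \<tau> l (u \<otimes> a m) \<otimes> (b m \<otimes> v))" if l: "l < n" for l
  proof -
    have "\<tau> l u \<otimes> e l \<otimes> v = (\<Oplus>m\<in>{..<M}. \<tau> l u \<otimes> (\<tau> l (a m) \<otimes> b m) \<otimes> v)"
      using l ab assms by (simp add: e finsum_rdistr finsum_ldistr)
    also have "\<dots> = (\<Oplus>m\<in>{..<M}. \<tau> l (u \<otimes> a m) \<otimes> (b m \<otimes> v))"
      using l ab assms by (intro finsum_cong') (auto simp: tau_mult m_ac)
    finally show ?thesis .
  qed
  then show ?thesis
    unfolding realizable_def using ab assms
    by (intro exI[of _ M] exI[of _ "\<lambda>m. u \<otimes> a m"] exI[of _ "\<lambda>m. b m \<otimes> v"]) auto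
qed

lemma realizable_add:
  assumes "realizable e" "realizable f"
  shows "realizable (\<lambda>l. e l \<oplus> f l)"
proof -
  obtain M :: nat and a b where ab: "\<And>m. a m \<in> carrier K" "\<And>m. b m \<in> carrier K"
    and e: "\<And>l. l < n \<Longrightarrow> e l = (\<Oplus>m\<in>{..<M}. \<tau> l (a m) \<otimes> b m)"
    using assms(1) unfolding realizable_def by blast
  obtain N :: nat and c d where cd: "\<And>m. c m \<in> carrier K" "\<And>m. d m \<in> carrier K"
    and f: "\<And>l. l < n \<Longrightarrow> f l = (\<Oplus>m\<in>{..<N}. \<tau> l (c m) \<otimes> d m)"
    using assms(2) unfolding realizable_def by blast
  let ?a = "\<lambda>m. if m < M then a m else c (m - M)"
  let ?b = "\<lambda>m. if m < M then b m else d (m - M)"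
  have "e l \<oplus> f l = (\<Oplus>m\<in>{..<M + N}. \<tau> l (?a m) \<otimes> ?b m)" if l: "l < n" for l
  proof -
    have "(\<Oplus>m\<in>{..<M + N}. \<tau> l (?a m) \<otimes> ?b m) =
        (\<Oplus>m\<in>{..<M}. \<tau> l (?a m) \<otimes> ?b m) \<oplus> (\<Oplus>m\<in>{..<N}. \<tau> l (?a (M + m)) \<otimes> ?b (M + m))"
      using l ab cd by (intro finsum_lessThan_add) auto
    also have "(\<Oplus>m\<in>{..<M}. \<tau> l (?a m) \<otimes> ?b m) = e l"
      unfolding e[OF l] using l ab by (intro finsum_cong') auto
    also have "(\<Oplus>m\<in>{..<N}. \<tau> l (?a (M + m)) \<otimes> ?b (M + m)) = f l"
      unfolding f[OF l] using l cd by (intro finsum_cong') auto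
    finally show ?thesis ..
  qed
  then show ?thesis
    unfolding realizable_def using ab cd
    by (intro exI[of _ "M + N"] exI[of _ ?a] exI[of _ ?b]) auto
qed

text \<open>Multiplication by \<open>u \<otimes> 1 - 1 \<otimes> \<tau>\<^sub>j(u)\<close>, where \<open>\<tau>\<^sub>j(u) \<noteq> u\<close>, kills the component \<open>j\<close>, keeps the zeros
  obtained before, and does not kill the component \<open>0\<close>.\<close>

lemma realizable_separating:
  assumes "finite D" "D \<subseteq> {..<n}" "0 \<notin> D"
  shows "\<exists>e. realizable e \<and> (\<forall>l\<in>D. e l = \<zero>) \<and> e 0 \<noteq> \<zero>"
  using assms
proof (induction D rule: finite_induct)
  case empty
  show ?case using realizable_one by (intro exI[of _ "\<lambda>_. \<one>"]) simp
next
  case (insert j D)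
  then obtain e where e: "realizable e" "\<And>l. l \<in> D \<Longrightarrow> e l = \<zero>" "e 0 \<noteq> \<zero>" by auto
  have j: "j < n" "0 < n" "0 \<noteq> j" using insert.prems n_pos by auto
  then obtain u where u: "u \<in> carrier K" "\<tau> 0 u \<noteq> \<tau> j u" using tau_moves by blast
  let ?f = "\<lambda>l. \<tau> l u \<otimes> e l \<otimes> \<one> \<oplus> \<tau> l \<one> \<otimes> e l \<otimes> (\<ominus> \<tau> j u)"
  have r: "realizable ?f"
    using e(1) u j by (intro realizable_add realizable_scale) auto
  have f: "?f l = (\<tau> l u \<ominus> \<tau> j u) \<otimes> e l" if "l < n" for l
    using that j u realizable_closed[OF e(1) that]
    by (simp add: minus_eq l_distr l_minus r_minus m_comm[of "e l"])
  have "?f l = \<zero>" if "l \<in> insert j D" for l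
    using that e(2) f[of l] insert.prems u j realizable_closed[OF e(1) j(1)]
    by (auto simp: minus_eq r_neg)
  moreover have "?f 0 \<noteq> \<zero>"
    unfolding f[OF j(2)] using u j e(3) realizable_closed[OF e(1) j(2)]
    by (simp add: integral_iff)
  ultimately show ?case using r by blast
qed

text \<open>For \<open>j = 0\<close> the condition says that \<open>\<Sum> a\<^sub>m \<otimes> b\<^sub>m\<close> is the separability idempotent of \<open>K\<close> over \<open>F\<close>,
  that is, its image in \<open>K\<^sup>n\<close> is the idempotent of the component \<open>0\<close>; if the families are bases of
  \<open>K\<close> over \<open>F\<close>, they are then dual under the trace form. The version with two automorphisms
  follows by applying \<open>\<tau>\<^sub>j\<close>.\<close>

definition dual_families :: "nat \<Rightarrow> (nat \<Rightarrow> 'k) \<Rightarrow> (nat \<Rightarrow> 'k) \<Rightarrow> bool" where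
  "dual_families M a b \<longleftrightarrow> (\<forall>m. a m \<in> carrier K \<and> b m \<in> carrier K) \<and>
     (\<forall>i<n. \<forall>j<n. (\<Oplus>m\<in>{..<M}. \<tau> i (a m) \<otimes> \<tau> j (b m)) = (if i = j then \<one> else \<zero>))"

lemma dual_familiesD:
  assumes "dual_families M a b"
  shows "a m \<in> carrier K" "b m \<in> carrier K"
    "\<lbrakk>i < n; j < n\<rbrakk> \<Longrightarrow> (\<Oplus>m\<in>{..<M}. \<tau> i (a m) \<otimes> \<tau> j (b m)) = (if i = j then \<one> else \<zero>)"
  using assms by (auto simp: dual_families_def)

lemma dual_families_exist: "\<exists>M a b. dual_families M a b"
proof -
  obtain e where e: "realizable e" "\<And>l. l \<in> {1..<n} \<Longrightarrow> e l = \<zero>" "e 0 \<noteq> \<zero>"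
    using realizable_separating[of "{1..<n}"] by (auto simp: subset_iff)
  have e0: "e 0 \<in> carrier K" "inv (e 0) \<in> carrier K" "e 0 \<otimes> inv (e 0) = \<one>"
    using realizable_closed[OF e(1) n_pos] e(3) Units_r_inv[of "e 0"] Units_inv_closed[of "e 0"]
    by (simp_all add: field_Units)
  obtain M :: nat and a b where ab: "\<And>m. a m \<in> carrier K" "\<And>m. b m \<in> carrier K"
    and s: "\<And>l. l < n \<Longrightarrow> \<tau> l \<one> \<otimes> e l \<otimes> inv (e 0) = (\<Oplus>m\<in>{..<M}. \<tau> l (a m) \<otimes> b m)"
    using realizable_scale[OF e(1) one_closed e0(2)] unfolding realizable_def by blast
  have delta: "(\<Oplus>m\<in>{..<M}. \<tau> l (a m) \<otimes> b m) = (if l = 0 then \<one> else \<zero>)" if "l < n" for l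
    using s[OF that] that e(2)[of l] e0 by auto
  have "(\<Oplus>m\<in>{..<M}. \<tau> i (a m) \<otimes> \<tau> j (b m)) = (if i = j then \<one> else \<zero>)"
    if ij: "i < n" "j < n" for i j
  proof -
    let ?l = "(n - j + i) mod n"
    have l: "?l < n" and jl: "(j + ?l) mod n = i"
      using n_pos translate_inverse(2)[OF ij(2,1)] by simp_all
    have "(\<Oplus>m\<in>{..<M}. \<tau> i (a m) \<otimes> \<tau> j (b m)) = (\<Oplus>m\<in>{..<M}. \<tau> j (\<tau> ?l (a m) \<otimes> b m))"
      using ab ij l tau_comp[OF ij(2) l] unfolding jl by (intro finsum_cong') (auto simp: tau_mult)
    also have "\<dots> = \<tau> j (\<Oplus>m\<in>{..<M}. \<tau> ?l (a m) \<otimes> b m)"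
      using ab ij l by (intro tau_finsum[symmetric]) auto
    also have "\<dots> = (if ?l = 0 then \<one> else \<zero>)"
      unfolding delta[OF l] using ij by simp
    also have "?l = 0 \<longleftrightarrow> i = j"
    proof
      assume "?l = 0" then show "i = j" using jl ij by simp
    qed (use ij in simp)
    finally show ?thesis .
  qed
  with ab show ?thesis unfolding dual_families_def by blast
qed

text \<open>If \<open>S\<close> corresponds to a subgroup of the Galois group, this is the trace of \<open>K\<close> over the fixed field
  of that subgroup.\<close>

definition gtrace :: "nat set \<Rightarrow> 'k \<Rightarrow> 'k" where
  "gtrace S x = (\<Oplus>l\<in>S. \<tau> l x)"

lemma gtrace_closed: "\<lbrakk>S \<subseteq> {..<n}; x \<in> carrier K\<rbrakk> \<Longrightarrow> gtrace S x \<in> carrier K"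
  unfolding gtrace_def by (rule finsum_closed) auto

lemma gtrace_fixed:
  assumes S: "S \<subseteq> {..<n}" "\<And>i j. \<lbrakk>i \<in> S; j \<in> S\<rbrakk> \<Longrightarrow> (i + j) mod n \<in> S"
    and i: "i \<in> S" and x: "x \<in> carrier K"
  shows "\<tau> i (gtrace S x) = gtrace S x"
proof -
  let ?h = "\<lambda>l. (i + l) mod n"
  have fin: "finite S" using S(1) by (rule finite_subset) simp
  have iN: "i < n" using i S by auto
  have inj: "inj_on ?h S"
    using bij_translate[OF iN] S(1) by (auto simp: bij_betw_def intro: inj_on_subset)
  have "?h ` S = S" using S(2)[OF i] by (intro endo_inj_surj[OF fin _ inj]) auto
  then have "gtrace S x = (\<Oplus>l\<in>?h ` S. \<tau> l x)" by (simp add: gtrace_def)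
  also have "\<dots> = (\<Oplus>l\<in>S. \<tau> (?h l) x)"
    using inj n_pos x by (intro finsum_reindex) auto
  also have "\<dots> = (\<Oplus>l\<in>S. \<tau> i (\<tau> l x))"
    using S(1) iN x by (intro finsum_cong') (auto simp: tau_comp subset_iff)
  also have "\<dots> = \<tau> i (gtrace S x)"
    unfolding gtrace_def using S(1) iN x by (intro tau_finsum[symmetric]) auto
  finally show ?thesis ..
qed

lemma full_trace_base: "x \<in> carrier K \<Longrightarrow> gtrace {..<n} x \<in> F"
  using gtrace_fixed[of "{..<n}"] gtrace_closed[of "{..<n}"] n_pos by (simp add: F_iff)

text \<open>Interchanging the two sums leaves \<open>\<Sum>\<^sub>l \<tau>\<^sub>l(x) \<Sum>\<^sub>m \<tau>\<^sub>l(a\<^sub>m) \<tau>\<^sub>j(b\<^sub>m)\<close>, where duality selects the term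
  \<open>l = j\<close>. For \<open>j = 0\<close> it is the dual basis formula for \<open>x\<close>; for \<open>j\<close> outside \<open>S\<close> it gives the
  vanishing that determines \<open>S\<close> from its fixed field.\<close>

lemma gtrace_expansion:
  assumes dual: "dual_families M a b"
    and S: "S \<subseteq> {..<n}" and j: "j < n" and x: "x \<in> carrier K"
  shows "(\<Oplus>m\<in>{..<M}. gtrace S (x \<otimes> a m) \<otimes> \<tau> j (b m)) = (if j \<in> S then \<tau> j x else \<zero>)"
proof -
  note ab = dual_familiesD(1,2)[OF dual] and delta = dual_familiesD(3)[OF dual]
  have fin: "finite S" using S by (rule finite_subset) simp
  have lS: "l < n" if "l \<in> S" for l using that S by auto
  have "(\<Oplus>m\<in>{..<M}. gtrace S (x \<otimes> a m) \<otimes> \<tau> j (b m)) =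
      (\<Oplus>m\<in>{..<M}. \<Oplus>l\<in>S. \<tau> l x \<otimes> (\<tau> l (a m) \<otimes> \<tau> j (b m)))"
  proof (intro finsum_cong' refl)
    fix m assume "m \<in> {..<M}"
    have "gtrace S (x \<otimes> a m) \<otimes> \<tau> j (b m) = (\<Oplus>l\<in>S. \<tau> l (x \<otimes> a m) \<otimes> \<tau> j (b m))"
      unfolding gtrace_def using fin lS ab x j by (intro finsum_ldistr) auto
    also have "\<dots> = (\<Oplus>l\<in>S. \<tau> l x \<otimes> (\<tau> l (a m) \<otimes> \<tau> j (b m)))"
      using lS ab x j by (intro finsum_cong') (auto simp: tau_mult m_assoc)
    finally show "gtrace S (x \<otimes> a m) \<otimes> \<tau> j (b m) =
      (\<Oplus>l\<in>S. \<tau> l x \<otimes> (\<tau> l (a m) \<otimes> \<tau> j (b m)))" .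
  qed (use lS ab x j in \<open>auto intro!: finsum_closed\<close>)
  also have "\<dots> = (\<Oplus>l\<in>S. \<Oplus>m\<in>{..<M}. \<tau> l x \<otimes> (\<tau> l (a m) \<otimes> \<tau> j (b m)))"
    using fin lS ab x j by (intro finsum_swap) auto
  also have "\<dots> = (\<Oplus>l\<in>S. if j = l then \<tau> l x else \<zero>)"
  proof (intro finsum_cong' refl)
    fix l assume l: "l \<in> S"
    have "(\<Oplus>m\<in>{..<M}. \<tau> l x \<otimes> (\<tau> l (a m) \<otimes> \<tau> j (b m))) =
        \<tau> l x \<otimes> (\<Oplus>m\<in>{..<M}. \<tau> l (a m) \<otimes> \<tau> j (b m))"
      using lS[OF l] ab x j by (intro finsum_rdistr[symmetric]) auto
    also have "\<dots> = (if j = l then \<tau> l x else \<zero>)"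
      unfolding delta[OF lS[OF l] j] using lS[OF l] x by simp
    finally show "(\<Oplus>m\<in>{..<M}. \<tau> l x \<otimes> (\<tau> l (a m) \<otimes> \<tau> j (b m))) =
      (if j = l then \<tau> l x else \<zero>)" .
  qed (use lS x in auto)
  also have "\<dots> = (if j \<in> S then \<tau> j x else \<zero>)"
  proof (cases "j \<in> S")
    case True
    then show ?thesis using fin lS x by (simp add: finsum_singleton Pi_def)
  next
    case False
    then have "(\<Oplus>l\<in>S. if j = l then \<tau> l x else \<zero>) = (\<Oplus>l\<in>S. \<zero>)"
      by (intro finsum_cong') auto
    with False show ?thesis by simp
  qed
  finally show ?thesis .
qed

text \<open>The instance of the Galois correspondence needed here. If the traces over \<open>S\<close> lie in \<open>F\<close>, the
  expansion of \<open>1\<close> with coefficients \<open>Tr\<^sub>S(a\<^sub>m)\<close> is compatible with every \<open>\<tau>\<^sub>j\<close>. For \<open>j\<close>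
  outside \<open>S\<close> the expansion of \<open>\<tau>\<^sub>j(1) = 1\<close> would be \<open>0\<close>.\<close>

lemma submonoid_fixing_base_full:
  assumes S: "S \<subseteq> {..<n}" "0 \<in> S" "\<And>i j. \<lbrakk>i \<in> S; j \<in> S\<rbrakk> \<Longrightarrow> (i + j) mod n \<in> S"
    and fix_F: "\<And>x. \<lbrakk>x \<in> carrier K; \<And>s. s \<in> S \<Longrightarrow> \<tau> s x = x\<rbrakk> \<Longrightarrow> x \<in> F"
  shows "S = {..<n}"
proof (rule ccontr)
  assume "S \<noteq> {..<n}"
  then obtain j where j: "j < n" "j \<notin> S" using S(1) by auto
  obtain M a b where dual: "dual_families M a b" using dual_families_exist by blast
  note ab = dual_familiesD(1,2)[OF dual]
  note expand = gtrace_expansion[OF dual S(1) _ one_closed]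
  have tF: "gtrace S (\<one> \<otimes> a m) \<in> F" for m
    using ab S gtrace_fixed[OF S(1,3)] gtrace_closed[OF S(1)] by (intro fix_F) auto
  have tc: "gtrace S (\<one> \<otimes> a m) \<in> carrier K" for m using tF F_sub by blast
  have "\<zero> = (\<Oplus>m\<in>{..<M}. gtrace S (\<one> \<otimes> a m) \<otimes> \<tau> j (b m))"
    using expand[OF j(1)] j(2) by simp
  also have "\<dots> = (\<Oplus>m\<in>{..<M}. \<tau> j (gtrace S (\<one> \<otimes> a m) \<otimes> \<tau> 0 (b m)))"
    using ab j tc tF tau_F[OF j(1)] by (intro finsum_cong') (auto simp: tau_mult)
  also have "\<dots> = \<tau> j (\<Oplus>m\<in>{..<M}. gtrace S (\<one> \<otimes> a m) \<otimes> \<tau> 0 (b m))"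
    using ab j tc n_pos by (intro tau_finsum[symmetric]) auto
  also have "\<dots> = \<one>"
    using expand[OF n_pos] S(2) j by simp
  finally show False by simp
qed

end

section \<open>The nucleus and the center of a Menichetti algebra\<close>

locale menichetti = cyclic_galois +
  fixes k :: "nat \<Rightarrow> 'a"
  assumes k: "k \<in> {..<n} \<rightarrow> carrier K - {\<zero>}"
begin

abbreviation "A \<equiv> Men K n \<tau> k"
abbreviation "c \<equiv> men_c K n k"
abbreviation "elt \<equiv> men_elt K n"

lemma c_closed: "\<lbrakk>i < n; j < n\<rbrakk> \<Longrightarrow> c i j \<in> carrier K"
  and c_nonzero: "\<lbrakk>i < n; j < n\<rbrakk> \<Longrightarrow> c i j \<noteq> \<zero>"
  using men_c_nonzero[OF k] by auto

lemma c_0 [simp]: "c 0 j = \<one>" "c i 0 = \<one>"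
  by (simp_all add: men_c_def)

lemma carrier_A: "carrier A = {..<n} \<rightarrow>\<^sub>E carrier K"
  by (simp add: Men_def)

lemma coord_closed: "\<lbrakk>x \<in> carrier A; i < n\<rbrakk> \<Longrightarrow> x i \<in> carrier K"
  by (auto simp: carrier_A)

lemma A_eqI: "\<lbrakk>x \<in> carrier A; y \<in> carrier A; \<And>i. i < n \<Longrightarrow> x i = y i\<rbrakk> \<Longrightarrow> x = y"
  unfolding carrier_A by (rule PiE_ext) auto

lemma add_coord [simp]: "i < n \<Longrightarrow> (x \<oplus>\<^bsub>A\<^esub> y) i = x i \<oplus> y i"
  and zero_coord [simp]: "i < n \<Longrightarrow> \<zero>\<^bsub>A\<^esub> i = \<zero>"
  and smult_coord [simp]: "i < n \<Longrightarrow> (a \<odot>\<^bsub>A\<^esub> x) i = a \<otimes> x i"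
  by (simp_all add: Men_def)

lemma add_A_closed: "\<lbrakk>x \<in> carrier A; y \<in> carrier A\<rbrakk> \<Longrightarrow> x \<oplus>\<^bsub>A\<^esub> y \<in> carrier A"
  and zero_A_closed: "\<zero>\<^bsub>A\<^esub> \<in> carrier A"
  and smult_A_closed: "\<lbrakk>a \<in> carrier K; x \<in> carrier A\<rbrakk> \<Longrightarrow> a \<odot>\<^bsub>A\<^esub> x \<in> carrier A"
  by (auto simp: Men_def PiE_def Pi_def)

lemma elt_closed [simp]: "a \<in> carrier K \<Longrightarrow> elt a i \<in> carrier A"
  by (auto simp: carrier_A men_elt_def)

lemma elt_coord: "l < n \<Longrightarrow> elt a i l = (if l = i then a else \<zero>)"
  by (simp add: men_elt_def)

lemma elt_add: "\<lbrakk>a \<in> carrier K; b \<in> carrier K\<rbrakk> \<Longrightarrow> elt (a \<oplus> b) i = elt a i \<oplus>\<^bsub>A\<^esub> elt b i"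
  by (rule A_eqI) (auto simp: elt_coord add_A_closed)

lemma elt_zero: "elt \<zero> i = \<zero>\<^bsub>A\<^esub>"
  by (rule A_eqI) (auto simp: elt_coord zero_A_closed)

lemma smult_elt: "\<lbrakk>a \<in> carrier K; b \<in> carrier K\<rbrakk> \<Longrightarrow> a \<odot>\<^bsub>A\<^esub> elt b i = elt (a \<otimes> b) i"
  by (rule A_eqI) (auto simp: elt_coord smult_A_closed)

lemma elt_eq_iff: "i < n \<Longrightarrow> elt a i = elt b i \<longleftrightarrow> a = b"
  using elt_coord by metis

lemma one_A: "\<one>\<^bsub>A\<^esub> = elt \<one> 0"
  by (simp add: Men_def)

lemma elt_mult:
  "\<lbrakk>i < n; j < n; a \<in> carrier K; b \<in> carrier K\<rbrakk> \<Longrightarrow>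
    elt a i \<otimes>\<^bsub>A\<^esub> elt b j = elt (\<tau> j a \<otimes> b \<otimes> c j i) ((i + j) mod n)"
  by (rule Men_mult_elt[OF tau_hom k])

lemma abelian_group_A: "abelian_group A"
proof (rule abelian_groupI)
  fix x assume x: "x \<in> carrier A"
  show "\<exists>y\<in>carrier A. y \<oplus>\<^bsub>A\<^esub> x = \<zero>\<^bsub>A\<^esub>"
  proof (rule bexI[of _ "\<lambda>l\<in>{..<n}. \<ominus> x l"])
    show "(\<lambda>l\<in>{..<n}. \<ominus> x l) \<in> carrier A" using x by (auto simp: carrier_A)
    then show "(\<lambda>l\<in>{..<n}. \<ominus> x l) \<oplus>\<^bsub>A\<^esub> x = \<zero>\<^bsub>A\<^esub>"
      using x by (intro A_eqI) (auto simp: add_A_closed zero_A_closed coord_closed l_neg)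
  qed
next
  fix x y z assume "x \<in> carrier A" "y \<in> carrier A" "z \<in> carrier A"
  then show "x \<oplus>\<^bsub>A\<^esub> y \<oplus>\<^bsub>A\<^esub> z = x \<oplus>\<^bsub>A\<^esub> (y \<oplus>\<^bsub>A\<^esub> z)"
    by (intro A_eqI) (auto simp: add_A_closed coord_closed a_assoc)
next
  fix x y assume "x \<in> carrier A" "y \<in> carrier A"
  then show "x \<oplus>\<^bsub>A\<^esub> y = y \<oplus>\<^bsub>A\<^esub> x"
    by (intro A_eqI) (auto simp: add_A_closed coord_closed a_comm)
next
  fix x assume "x \<in> carrier A"
  then show "\<zero>\<^bsub>A\<^esub> \<oplus>\<^bsub>A\<^esub> x = x"
    by (intro A_eqI) (auto simp: add_A_closed zero_A_closed coord_closed)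
qed (simp_all add: add_A_closed zero_A_closed)

lemma module_A: "module base A"
proof (rule moduleI)
  show "cring base" using base_field by (rule fieldE(1))
qed (auto intro!: A_eqI abelian_group_A
    simp: add_A_closed smult_A_closed coord_closed l_distr r_distr m_assoc subsetD[OF F_sub])

abbreviation (input) "idx l \<equiv> {(i, j). i < n \<and> j < n \<and> (i + j) mod n = l}"

lemma mult_coord:
  "l < n \<Longrightarrow> (x \<otimes>\<^bsub>A\<^esub> y) l = (\<Oplus>p\<in>idx l. \<tau> (snd p) (x (fst p)) \<otimes> y (snd p) \<otimes> c (snd p) (fst p))"
  by (simp add: Men_def case_prod_unfold)

lemma mult_term_closed:
  "\<lbrakk>x \<in> carrier A; y \<in> carrier A\<rbrakk> \<Longrightarrow>
    (\<lambda>p. \<tau> (snd p) (x (fst p)) \<otimes> y (snd p) \<otimes> c (snd p) (fst p)) \<in> idx l \<rightarrow> carrier K"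
  by (auto simp: coord_closed c_closed)

lemma mult_A_closed: "\<lbrakk>x \<in> carrier A; y \<in> carrier A\<rbrakk> \<Longrightarrow> x \<otimes>\<^bsub>A\<^esub> y \<in> carrier A"
proof -
  assume xy: "x \<in> carrier A" "y \<in> carrier A"
  have "x \<otimes>\<^bsub>A\<^esub> y \<in> extensional {..<n}" by (simp add: Men_def)
  moreover have "(x \<otimes>\<^bsub>A\<^esub> y) l \<in> carrier K" if "l < n" for l
    unfolding mult_coord[OF that] by (rule finsum_closed[OF mult_term_closed[OF xy]])
  ultimately show ?thesis by (auto simp: carrier_A PiE_def)
qed

lemma l_add_mult_A:
  assumes "x \<in> carrier A" "y \<in> carrier A" "z \<in> carrier A"
  shows "(x \<oplus>\<^bsub>A\<^esub> y) \<otimes>\<^bsub>A\<^esub> z = x \<otimes>\<^bsub>A\<^esub> z \<oplus>\<^bsub>A\<^esub> y \<otimes>\<^bsub>A\<^esub> z"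
proof (rule A_eqI)
  fix l assume l: "l < n"
  show "((x \<oplus>\<^bsub>A\<^esub> y) \<otimes>\<^bsub>A\<^esub> z) l = (x \<otimes>\<^bsub>A\<^esub> z \<oplus>\<^bsub>A\<^esub> y \<otimes>\<^bsub>A\<^esub> z) l"
    unfolding add_coord[OF l] mult_coord[OF l]
      finsum_addf[OF mult_term_closed[OF assms(1,3)] mult_term_closed[OF assms(2,3)], symmetric]
    using assms by (intro finsum_cong') (auto simp: coord_closed c_closed tau_add l_distr)
qed (use assms in \<open>auto intro: mult_A_closed add_A_closed\<close>)

lemma r_add_mult_A:
  assumes "x \<in> carrier A" "y \<in> carrier A" "z \<in> carrier A"
  shows "z \<otimes>\<^bsub>A\<^esub> (x \<oplus>\<^bsub>A\<^esub> y) = z \<otimes>\<^bsub>A\<^esub> x \<oplus>\<^bsub>A\<^esub> z \<otimes>\<^bsub>A\<^esub> y"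
proof (rule A_eqI)
  fix l assume l: "l < n"
  show "(z \<otimes>\<^bsub>A\<^esub> (x \<oplus>\<^bsub>A\<^esub> y)) l = (z \<otimes>\<^bsub>A\<^esub> x \<oplus>\<^bsub>A\<^esub> z \<otimes>\<^bsub>A\<^esub> y) l"
    unfolding add_coord[OF l] mult_coord[OF l]
      finsum_addf[OF mult_term_closed[OF assms(3,1)] mult_term_closed[OF assms(3,2)], symmetric]
    using assms by (intro finsum_cong') (auto simp: coord_closed c_closed l_distr r_distr)
qed (use assms in \<open>auto intro: mult_A_closed add_A_closed\<close>)

lemma finite_idx: "finite (idx l)"
  by (rule finite_subset[of _ "{..<n} \<times> {..<n}"]) auto

lemma smult_mult_A:
  assumes "a \<in> F" "x \<in> carrier A" "y \<in> carrier A"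
  shows "(a \<odot>\<^bsub>A\<^esub> x) \<otimes>\<^bsub>A\<^esub> y = a \<odot>\<^bsub>A\<^esub> (x \<otimes>\<^bsub>A\<^esub> y)"
    and "x \<otimes>\<^bsub>A\<^esub> (a \<odot>\<^bsub>A\<^esub> y) = a \<odot>\<^bsub>A\<^esub> (x \<otimes>\<^bsub>A\<^esub> y)"
proof -
  have a: "a \<in> carrier K" by (rule subsetD[OF F_sub assms(1)])
  note cl = a assms(2,3) mult_A_closed smult_A_closed
  show "(a \<odot>\<^bsub>A\<^esub> x) \<otimes>\<^bsub>A\<^esub> y = a \<odot>\<^bsub>A\<^esub> (x \<otimes>\<^bsub>A\<^esub> y)"
  proof (rule A_eqI)
    fix l assume l: "l < n"
    show "((a \<odot>\<^bsub>A\<^esub> x) \<otimes>\<^bsub>A\<^esub> y) l = (a \<odot>\<^bsub>A\<^esub> (x \<otimes>\<^bsub>A\<^esub> y)) l"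
      unfolding smult_coord[OF l] mult_coord[OF l]
        finsum_rdistr[OF finite_idx a mult_term_closed[OF assms(2,3)]]
      using assms a by (intro finsum_cong') (auto simp: coord_closed c_closed tau_mult tau_F m_assoc)
  qed (auto intro: cl)
  show "x \<otimes>\<^bsub>A\<^esub> (a \<odot>\<^bsub>A\<^esub> y) = a \<odot>\<^bsub>A\<^esub> (x \<otimes>\<^bsub>A\<^esub> y)"
  proof (rule A_eqI)
    fix l assume l: "l < n"
    show "(x \<otimes>\<^bsub>A\<^esub> (a \<odot>\<^bsub>A\<^esub> y)) l = (a \<odot>\<^bsub>A\<^esub> (x \<otimes>\<^bsub>A\<^esub> y)) l"
      unfolding smult_coord[OF l] mult_coord[OF l]
        finsum_rdistr[OF finite_idx a mult_term_closed[OF assms(2,3)]]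
      using assms a by (intro finsum_cong') (auto simp: coord_closed c_closed m_ac)
  qed (auto intro: cl)
qed

text \<open>An element is the sum of its monomials, so additive properties need to be checked only on the
  monomials whose index lies in a set containing the support. All bilinear identities in \<open>A\<close> are
  reduced to monomials in this way, which replaces computations with double and triple sums.\<close>

lemma supported_induct:
  assumes x: "x \<in> carrier A" and supp: "\<And>i. \<lbrakk>i < n; x i \<noteq> \<zero>\<rbrakk> \<Longrightarrow> i \<in> S"
    and P0: "P \<zero>\<^bsub>A\<^esub>"
    and Padd: "\<And>u v. \<lbrakk>u \<in> carrier A; v \<in> carrier A; P u; P v\<rbrakk> \<Longrightarrow> P (u \<oplus>\<^bsub>A\<^esub> v)"
    and Pelt: "\<And>a i. \<lbrakk>a \<in> carrier K; i < n; i \<in> S\<rbrakk> \<Longrightarrow> P (elt a i)"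
  shows "P x"
proof -
  define t where "t m = (\<lambda>l\<in>{..<n}. if l < m then x l else \<zero>)" for m
  have tc: "t m \<in> carrier A" for m
    unfolding t_def carrier_A using coord_closed[OF x] by (intro restrict_PiE_iff[THEN iffD2]) simp
  have tl: "t m l = (if l < m then x l else \<zero>)" if "l < n" for m l using that by (simp add: t_def)
  have "P (t m)" if "m \<le> n" for m
    using that
  proof (induction m)
    case 0
    have "t 0 = \<zero>\<^bsub>A\<^esub>" by (rule A_eqI) (auto simp: tc zero_A_closed tl)
    then show ?case using P0 by simp
  next
    case (Suc m)
    then have m: "m < n" and IH: "P (t m)" by auto
    have xm: "x m \<in> carrier K" using x m by (rule coord_closed)
    have e: "t (Suc m) = t m \<oplus>\<^bsub>A\<^esub> elt (x m) m"
      by (rule A_eqI)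
        (use x xm in \<open>auto simp: tc add_A_closed tl elt_coord coord_closed less_Suc_eq\<close>)
    show ?case
    proof (cases "x m = \<zero>")
      case True
      then have "t (Suc m) = t m"
        by (intro A_eqI) (auto simp: tc tl less_Suc_eq)
      then show ?thesis using IH by simp
    next
      case False
      then show ?thesis unfolding e using m xm IH tc supp by (intro Padd Pelt) auto
    qed
  qed
  moreover have "t n = x" by (rule A_eqI) (auto simp: tc x tl)
  ultimately show ?thesis by auto
qed

lemma monomial_induct [consumes 1, case_names zero add elt]:
  assumes "x \<in> carrier A" "P \<zero>\<^bsub>A\<^esub>"
    "\<And>u v. \<lbrakk>u \<in> carrier A; v \<in> carrier A; P u; P v\<rbrakk> \<Longrightarrow> P (u \<oplus>\<^bsub>A\<^esub> v)"
    "\<And>a i. \<lbrakk>a \<in> carrier K; i < n\<rbrakk> \<Longrightarrow> P (elt a i)"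
  shows "P x"
  by (rule supported_induct[of x UNIV]) (use assms in auto)

lemma nonassoc_algebra_A: "nonassoc_algebra base A"
proof -
  have one_l: "\<one>\<^bsub>A\<^esub> \<otimes>\<^bsub>A\<^esub> x = x" and one_r: "x \<otimes>\<^bsub>A\<^esub> \<one>\<^bsub>A\<^esub> = x" if x: "x \<in> carrier A" for x
  proof -
    have one: "\<one>\<^bsub>A\<^esub> \<in> carrier A" by (simp add: one_A)
    have ez: "\<zero>\<^bsub>A\<^esub> = elt \<zero> 0" by (simp add: elt_zero)
    from x show "\<one>\<^bsub>A\<^esub> \<otimes>\<^bsub>A\<^esub> x = x"
    proof (induction x rule: monomial_induct)
      case zero
      show ?case unfolding ez one_A using n_pos by (simp add: elt_mult)
    next
      case (elt a i)
      then show ?case using n_pos by (simp add: one_A elt_mult)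
    qed (simp add: r_add_mult_A one)
    from x show "x \<otimes>\<^bsub>A\<^esub> \<one>\<^bsub>A\<^esub> = x"
    proof (induction x rule: monomial_induct)
      case zero
      show ?case unfolding ez one_A using n_pos by (simp add: elt_mult)
    next
      case (elt a i)
      then show ?case using n_pos by (simp add: one_A elt_mult)
    qed (simp add: l_add_mult_A one)
  qed
  show ?thesis
    by (intro nonassoc_algebra.intro nonassoc_algebra_axioms.intro base_field module_A)
      (auto simp: mult_A_closed l_add_mult_A r_add_mult_A smult_mult_A one_l one_r,
        simp add: one_A)
qed

sublocale N: nonassoc_algebra base A
  by (rule nonassoc_algebra_A)

text \<open>Multiplication by a monomial permutes the components and, up to an automorphism, rescales each of
  them, so one coordinate of the product reads off one coordinate of \<open>x\<close>. This detects whether \<open>x\<close> lies in the nucleus.\<close>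

lemma mult_monomial_coord:
  assumes x: "x \<in> carrier A" and ij: "i < n" "j < n" and b: "b \<in> carrier K"
  shows "(x \<otimes>\<^bsub>A\<^esub> elt b j) ((i + j) mod n) = \<tau> j (x i) \<otimes> b \<otimes> c j i"
    and "(elt b j \<otimes>\<^bsub>A\<^esub> x) ((j + i) mod n) = \<tau> i b \<otimes> x i \<otimes> c i j"
proof -
  have m: "(i + j) mod n < n" "(j + i) mod n < n" using n_pos by auto
  have inj: "(i + j) mod n = (l + j) mod n \<longleftrightarrow> i = l" "(j + i) mod n = (j + l) mod n \<longleftrightarrow> i = l"
    if "l < n" for l
    using translate_inverse(1)[OF ij(2,1)] translate_inverse(1)[OF ij(2) that]
    by (metis add.commute)+
  show "(x \<otimes>\<^bsub>A\<^esub> elt b j) ((i + j) mod n) = \<tau> j (x i) \<otimes> b \<otimes> c j i"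
    using x
  proof (induction x rule: monomial_induct)
    case zero
    show ?case using m ij b by (simp add: N.l_zero_mult c_closed)
  next
    case (add u v)
    then show ?case
      using m ij b by (simp add: N.l_add_mult tau_add coord_closed c_closed l_distr)
  next
    case (elt a l)
    then show ?case using m ij b by (auto simp: elt_mult elt_coord inj c_closed)
  qed
  show "(elt b j \<otimes>\<^bsub>A\<^esub> x) ((j + i) mod n) = \<tau> i b \<otimes> x i \<otimes> c i j"
    using x
  proof (induction x rule: monomial_induct)
    case zero
    show ?case using m ij b by (simp add: N.r_zero_mult c_closed)
  next
    case (add u v)
    then show ?case
      using m ij b by (simp add: N.r_add_mult coord_closed c_closed l_distr r_distr)
  next
    case (elt a l)
    then show ?case using m ij b by (auto simp: elt_mult elt_coord inj c_closed)
  qed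
qed

lemma mult_K_coord:
  assumes "x \<in> carrier A" "l < n" "a \<in> carrier K"
  shows "(elt a 0 \<otimes>\<^bsub>A\<^esub> x) l = \<tau> l a \<otimes> x l" "(x \<otimes>\<^bsub>A\<^esub> elt a 0) l = x l \<otimes> a"
  using mult_monomial_coord[OF assms(1,2) n_pos assms(3)] assms n_pos
  by (simp_all add: coord_closed)

text \<open>The identity under which \<open>z\<^sub>i\<close>, \<open>z\<^sub>j\<close>, \<open>z\<^sub>l\<close> associate, in this order.\<close>

definition cocycle :: "nat \<Rightarrow> nat \<Rightarrow> nat \<Rightarrow> bool" where
  "cocycle i j l \<longleftrightarrow>
     \<tau> l (c j i) \<otimes> c l ((i + j) mod n) = c l j \<otimes> c ((j + l) mod n) i"

lemma cocycle_0:
  assumes "i < n" "j < n"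
  shows "cocycle 0 i j" "cocycle i 0 j" "cocycle i j 0"
  using assms n_pos c_closed[OF assms] c_closed[OF assms(2,1)] by (simp_all add: cocycle_def)

lemma monomials_assoc:
  assumes ijl: "i < n" "j < n" "l < n" and coc: "cocycle i j l"
    and abd: "a \<in> carrier K" "b \<in> carrier K" "d \<in> carrier K"
  shows "(elt a i \<otimes>\<^bsub>A\<^esub> elt b j) \<otimes>\<^bsub>A\<^esub> elt d l = elt a i \<otimes>\<^bsub>A\<^esub> (elt b j \<otimes>\<^bsub>A\<^esub> elt d l)"
proof -
  let ?ij = "(i + j) mod n" and ?jl = "(j + l) mod n"
  have m: "?ij < n" "?jl < n" using n_pos by auto
  note cl = c_closed[OF ijl(2,1)] c_closed[OF ijl(3,2)] c_closed[OF ijl(3) m(1)] c_closed[OF m(2) ijl(1)]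
  have idx: "(?ij + l) mod n = (i + ?jl) mod n" by (simp add: mod_simps add.assoc)
  have tjl: "\<tau> ?jl a = \<tau> l (\<tau> j a)"
    using tau_comp[OF ijl(3,2) abd(1)] by (simp add: add.commute)
  have "(elt a i \<otimes>\<^bsub>A\<^esub> elt b j) \<otimes>\<^bsub>A\<^esub> elt d l =
      elt (\<tau> l (\<tau> j a \<otimes> b \<otimes> c j i) \<otimes> d \<otimes> c l ?ij) ((?ij + l) mod n)"
    using ijl m abd cl by (simp add: elt_mult)
  also have "\<tau> l (\<tau> j a \<otimes> b \<otimes> c j i) \<otimes> d \<otimes> c l ?ij =
      \<tau> l (\<tau> j a) \<otimes> \<tau> l b \<otimes> d \<otimes> (\<tau> l (c j i) \<otimes> c l ?ij)"
    using ijl abd cl by (simp add: tau_mult m_ac)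
  also have "\<dots> = \<tau> ?jl a \<otimes> (\<tau> l b \<otimes> d \<otimes> c l j) \<otimes> c ?jl i"
    using coc ijl abd cl unfolding cocycle_def tjl by (simp add: m_ac)
  also have "elt \<dots> ((?ij + l) mod n) = elt a i \<otimes>\<^bsub>A\<^esub> (elt b j \<otimes>\<^bsub>A\<^esub> elt d l)"
    unfolding idx using ijl m abd cl by (simp add: elt_mult)
  finally show ?thesis .
qed

lemma supported_assoc:
  assumes xyz: "x \<in> carrier A" "y \<in> carrier A" "z \<in> carrier A"
    and coc: "\<And>i j l. \<lbrakk>i < n; j < n; l < n; x i \<noteq> \<zero>; y j \<noteq> \<zero>; z l \<noteq> \<zero>\<rbrakk> \<Longrightarrow> cocycle i j l"
  shows "(x \<otimes>\<^bsub>A\<^esub> y) \<otimes>\<^bsub>A\<^esub> z = x \<otimes>\<^bsub>A\<^esub> (y \<otimes>\<^bsub>A\<^esub> z)"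
proof -
  define I J L where "I = {i. i < n \<and> x i \<noteq> \<zero>}" and "J = {i. i < n \<and> y i \<noteq> \<zero>}"
    and "L = {i. i < n \<and> z i \<noteq> \<zero>}"
  have 1: "(elt a i \<otimes>\<^bsub>A\<^esub> elt b j) \<otimes>\<^bsub>A\<^esub> z = elt a i \<otimes>\<^bsub>A\<^esub> (elt b j \<otimes>\<^bsub>A\<^esub> z)"
    if ij: "i \<in> I" "j \<in> J" "a \<in> carrier K" "b \<in> carrier K" for a i b j
  proof (rule supported_induct[OF xyz(3), of L])
    show "l \<in> L" if "l < n" "z l \<noteq> \<zero>" for l using that by (simp add: L_def)
    fix d l assume "d \<in> carrier K" "l < n" "l \<in> L"
    then show "(elt a i \<otimes>\<^bsub>A\<^esub> elt b j) \<otimes>\<^bsub>A\<^esub> elt d l = elt a i \<otimes>\<^bsub>A\<^esub> (elt b j \<otimes>\<^bsub>A\<^esub> elt d l)"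
      using ij coc by (intro monomials_assoc) (auto simp: I_def J_def L_def)
  qed (use ij in \<open>simp_all add: N.r_zero_mult N.r_add_mult N.mult_closed\<close>)
  have 2: "(elt a i \<otimes>\<^bsub>A\<^esub> y) \<otimes>\<^bsub>A\<^esub> z = elt a i \<otimes>\<^bsub>A\<^esub> (y \<otimes>\<^bsub>A\<^esub> z)"
    if i: "i \<in> I" "a \<in> carrier K" for a i
  proof (rule supported_induct[OF xyz(2), of J])
    show "l \<in> J" if "l < n" "y l \<noteq> \<zero>" for l using that by (simp add: J_def)
  qed (use i 1 xyz(3) in \<open>simp_all add: N.r_zero_mult N.l_zero_mult N.l_add_mult N.r_add_mult N.mult_closed\<close>)
  show ?thesis
  proof (rule supported_induct[OF xyz(1), of I])
    show "l \<in> I" if "l < n" "x l \<noteq> \<zero>" for l using that by (simp add: I_def)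
  qed (use 2 xyz in \<open>simp_all add: N.l_zero_mult N.l_add_mult N.mult_closed\<close>)
qed

definition nuc_support :: "nat set" where
  "nuc_support = {i. i < n \<and> (\<forall>j<n. \<forall>l<n. cocycle i j l \<and> cocycle j i l \<and> cocycle j l i)}"

lemma nuc_support_sub: "nuc_support \<subseteq> {..<n}"
  and nuc_support_0: "0 \<in> nuc_support"
  using n_pos cocycle_0 by (auto simp: nuc_support_def)

text \<open>If \<open>x\<close> is in the nucleus, associativity of \<open>x\<close>, \<open>z\<^sub>j\<close>, \<open>z\<^sub>l\<close> in all three orders is compared
  at the one coordinate to which \<open>x\<^sub>i z\<^sub>i\<close> contributes; there it says that \<open>x\<^sub>i\<close> (up to an
  automorphism) times the defect of the cocycle identity is zero.\<close>

lemma nucleus_A: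
  "x \<in> nucleus A \<longleftrightarrow> x \<in> carrier A \<and> (\<forall>i<n. x i \<noteq> \<zero> \<longrightarrow> i \<in> nuc_support)"
proof -
  have suff: "x \<in> nucleus A" if "x \<in> carrier A" "\<forall>i<n. x i \<noteq> \<zero> \<longrightarrow> i \<in> nuc_support"
    unfolding N.nucleus_iff using that
    by (intro conjI ballI supported_assoc) (auto simp: nuc_support_def)
  have forth: "i \<in> nuc_support" if x: "x \<in> nucleus A" and i: "i < n" "x i \<noteq> \<zero>" for i
    unfolding nuc_support_def
  proof (intro CollectI conjI allI impI i(1))
    have xc: "x \<in> carrier A" using x by (rule N.nucleus_carrier)
    have xi: "x i \<in> carrier K" using xc i(1) by (rule coord_closed)
    fix j l assume j: "j < n" and l: "l < n"
    let ?u = "elt \<one> j" and ?v = "elt \<one> l"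
    let ?ij = "(i + j) mod n" and ?jl = "(j + l) mod n" and ?il = "(i + l) mod n"
    have m: "?ij < n" "?jl < n" "?il < n" using n_pos by auto
    have uv: "?u \<in> carrier A" "?v \<in> carrier A" by auto
    note mc = mult_monomial_coord
    note cl = c_closed[OF i(1) j] c_closed[OF j i(1)] c_closed[OF i(1) l] c_closed[OF l i(1)]
      c_closed[OF l j] c_closed[OF l m(1)] c_closed[OF m(2) i(1)] c_closed[OF m(3) j]
      c_closed[OF i(1) m(2)]
    have nz: "\<tau> m (x i) \<noteq> \<zero>" if "m < n" for m
      using tau_inj[OF that xi zero_closed] i(2) that by auto
    have prod: "?u \<otimes>\<^bsub>A\<^esub> ?v = elt (c l j) ?jl" using j l cl by (simp add: elt_mult)
    have tjl: "\<tau> ?jl (x i) = \<tau> l (\<tau> j (x i))"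
      using tau_comp[OF l j xi] by (simp add: add.commute)
    have a: "(x \<otimes>\<^bsub>A\<^esub> ?u) \<otimes>\<^bsub>A\<^esub> ?v = x \<otimes>\<^bsub>A\<^esub> (?u \<otimes>\<^bsub>A\<^esub> ?v)"
      "(?u \<otimes>\<^bsub>A\<^esub> x) \<otimes>\<^bsub>A\<^esub> ?v = ?u \<otimes>\<^bsub>A\<^esub> (x \<otimes>\<^bsub>A\<^esub> ?v)"
      "(?u \<otimes>\<^bsub>A\<^esub> ?v) \<otimes>\<^bsub>A\<^esub> x = ?u \<otimes>\<^bsub>A\<^esub> (?v \<otimes>\<^bsub>A\<^esub> x)"
      using x uv by (auto simp: N.nucleus_iff)
    have idx: "(?ij + l) mod n = (i + ?jl) mod n" "(?ij + l) mod n = (j + ?il) mod n"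
      "(?jl + i) mod n = (j + ?il) mod n"
      by (simp_all add: mod_simps add.assoc add.left_commute add.commute)
    have "((x \<otimes>\<^bsub>A\<^esub> ?u) \<otimes>\<^bsub>A\<^esub> ?v) ((?ij + l) mod n) = \<tau> l (\<tau> j (x i)) \<otimes> (\<tau> l (c j i) \<otimes> c l ?ij)"
      using i j l m xc xi uv cl by (simp add: mc N.mult_closed tau_mult m_assoc)
    moreover have "(x \<otimes>\<^bsub>A\<^esub> (?u \<otimes>\<^bsub>A\<^esub> ?v)) ((i + ?jl) mod n) = \<tau> l (\<tau> j (x i)) \<otimes> (c l j \<otimes> c ?jl i)"
      unfolding prod using i j l m xc xi uv cl by (simp add: mc tjl m_assoc)
    ultimately have "\<tau> l (\<tau> j (x i)) \<otimes> (\<tau> l (c j i) \<otimes> c l ?ij) = \<tau> l (\<tau> j (x i)) \<otimes> (c l j \<otimes> c ?jl i)"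
      using a(1) idx(1) by simp
    then show "cocycle i j l"
      unfolding cocycle_def using m_lcancel[of "\<tau> l (\<tau> j (x i))"] nz[OF m(2)] tjl xi j l cl by simp
    have "((?u \<otimes>\<^bsub>A\<^esub> x) \<otimes>\<^bsub>A\<^esub> ?v) ((?ij + l) mod n) = \<tau> l (x i) \<otimes> (\<tau> l (c i j) \<otimes> c l ?ij)"
      using i j l m xc xi uv cl mc(1)[of "?u \<otimes>\<^bsub>A\<^esub> x" ?ij l \<one>] mc(2)[of x i j \<one>]
      by (simp add: N.mult_closed tau_mult m_assoc add.commute)
    moreover have "(?u \<otimes>\<^bsub>A\<^esub> (x \<otimes>\<^bsub>A\<^esub> ?v)) ((j + ?il) mod n) = \<tau> l (x i) \<otimes> (c l i \<otimes> c ?il j)"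
      using i j l m xc xi uv cl by (simp add: mc N.mult_closed m_assoc)
    ultimately have "\<tau> l (x i) \<otimes> (\<tau> l (c i j) \<otimes> c l ?ij) = \<tau> l (x i) \<otimes> (c l i \<otimes> c ?il j)"
      using a(2) idx(2) by simp
    then show "cocycle j i l"
      unfolding cocycle_def using m_lcancel[of "\<tau> l (x i)"] nz[OF l] xi j l cl
      by (simp add: add.commute)
    have "((?u \<otimes>\<^bsub>A\<^esub> ?v) \<otimes>\<^bsub>A\<^esub> x) ((?jl + i) mod n) = x i \<otimes> (\<tau> i (c l j) \<otimes> c i ?jl)"
      unfolding prod using i j l m xc xi uv cl by (simp add: mc m_ac)
    moreover have "(?u \<otimes>\<^bsub>A\<^esub> (?v \<otimes>\<^bsub>A\<^esub> x)) ((j + ?il) mod n) = x i \<otimes> (c i l \<otimes> c ?il j)"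
      using i j l m xc xi uv cl mc(2)[of "?v \<otimes>\<^bsub>A\<^esub> x" ?il j \<one>] mc(2)[of x i l \<one>]
      by (simp add: N.mult_closed m_assoc add.commute)
    ultimately have "x i \<otimes> (\<tau> i (c l j) \<otimes> c i ?jl) = x i \<otimes> (c i l \<otimes> c ?il j)"
      using a(3) idx(3) by simp
    then show "cocycle j l i"
      unfolding cocycle_def using m_lcancel[of "x i"] i xi j l cl
      by (simp add: add.commute)
  qed
  show ?thesis using suff forth N.nucleus_carrier by blast
qed

text \<open>The nucleus is closed under multiplication and \<open>z\<^sub>i z\<^sub>j\<close> is a nonzero multiple of \<open>z\<^sub>i\<^sub>+\<^sub>j\<close>.\<close>

lemma nuc_support_add:
  assumes "i \<in> nuc_support" "j \<in> nuc_support"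
  shows "(i + j) mod n \<in> nuc_support"
proof -
  have ij: "i < n" "j < n" and m: "(i + j) mod n < n" using assms nuc_support_sub n_pos by auto
  have "elt \<one> i \<in> nucleus A" "elt \<one> j \<in> nucleus A"
    using assms by (auto simp: nucleus_A elt_coord)
  then have "elt \<one> i \<otimes>\<^bsub>A\<^esub> elt \<one> j \<in> nucleus A" by (rule N.nucleus_mult)
  moreover have "(elt \<one> i \<otimes>\<^bsub>A\<^esub> elt \<one> j) ((i + j) mod n) = c j i"
    using ij m c_closed[OF ij(2,1)] by (simp add: elt_mult elt_coord)
  ultimately show ?thesis using m c_nonzero[OF ij(2,1)] by (simp add: nucleus_A)
qed

lemma associative_if_full_support:
  assumes "nuc_support = {..<n}"
  shows "associative_mult A"
  unfolding associative_mult_def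
  using assms by (intro ballI supported_assoc) (auto simp: nuc_support_def set_eq_iff)

lemma K_nucleus: "Men_K K n \<subseteq> nucleus A"
  using nuc_support_0 by (auto simp: Men_K_def nucleus_A elt_coord)

text \<open>Commuting with \<open>u \<in> K\<close> forces \<open>\<tau>\<^sub>l(u) x\<^sub>l = u x\<^sub>l\<close> for all \<open>l\<close>, and for \<open>l \<noteq> 0\<close> some \<open>u\<close> is moved by \<open>\<tau>\<^sub>l\<close>.\<close>

lemma centralizer_K:
  assumes x: "x \<in> carrier A" and comm: "\<And>a. a \<in> carrier K \<Longrightarrow> elt a 0 \<otimes>\<^bsub>A\<^esub> x = x \<otimes>\<^bsub>A\<^esub> elt a 0"
  shows "x = elt (x 0) 0"
proof (rule A_eqI[OF x])
  show "elt (x 0) 0 \<in> carrier A" using coord_closed[OF x n_pos] by simp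
  fix l assume l: "l < n"
  show "x l = elt (x 0) 0 l"
  proof (cases "l = 0")
    case False
    obtain u where u: "u \<in> carrier K" "\<tau> l u \<noteq> \<tau> 0 u" using tau_moves[OF l n_pos False] by blast
    have xl: "x l \<in> carrier K" using x l by (rule coord_closed)
    have "\<tau> l u \<otimes> x l = u \<otimes> x l"
      using mult_K_coord[OF x l u(1)] comm[OF u(1)] xl u(1) by (simp add: m_comm)
    then have "x l = \<zero>" using m_rcancel[of "x l" "\<tau> l u" u] u l xl by auto
    then show ?thesis using l False by (simp add: elt_coord)
  qed (use l in \<open>simp add: elt_coord\<close>)
qed

lemma K_mult: "\<lbrakk>a \<in> carrier K; b \<in> carrier K\<rbrakk> \<Longrightarrow> elt a 0 \<otimes>\<^bsub>A\<^esub> elt b 0 = elt (a \<otimes> b) 0"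
  using n_pos by (simp add: elt_mult)

lemma commutative_subalgebra_K: "commutative_subalgebra base A (Men_K K n)"
  unfolding commutative_subalgebra_def unital_subalgebra_def
proof (intro conjI ballI)
  show "Men_K K n \<subseteq> carrier A" "\<one>\<^bsub>A\<^esub> \<in> Men_K K n" by (auto simp: Men_K_def one_A)
  show "a \<odot>\<^bsub>A\<^esub> x \<in> Men_K K n" if "a \<in> carrier base" "x \<in> Men_K K n" for a x
    using that F_sub by (auto simp: Men_K_def smult_elt)
  fix x y assume "x \<in> Men_K K n" "y \<in> Men_K K n"
  then obtain a b where ab: "x = elt a 0" "y = elt b 0" "a \<in> carrier K" "b \<in> carrier K"
    by (auto simp: Men_K_def)
  show "x \<oplus>\<^bsub>A\<^esub> y \<in> Men_K K n" using ab by (auto simp: Men_K_def simp flip: elt_add)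
  show "x \<otimes>\<^bsub>A\<^esub> y \<in> Men_K K n" using ab by (auto simp: Men_K_def K_mult)
  show "x \<otimes>\<^bsub>A\<^esub> y = y \<otimes>\<^bsub>A\<^esub> x" using ab by (simp add: K_mult m_comm)
qed

lemma maximal_commutative_K: "maximal_commutative_subalgebra base A (Men_K K n)"
  unfolding maximal_commutative_subalgebra_def
proof (intro conjI allI impI commutative_subalgebra_K)
  fix C assume C: "commutative_subalgebra base A C \<and> Men_K K n \<subseteq> C"
  have "x \<in> Men_K K n" if x: "x \<in> C" for x
  proof -
    have xc: "x \<in> carrier A"
      using C x by (auto simp: commutative_subalgebra_def unital_subalgebra_def)
    have "elt a 0 \<otimes>\<^bsub>A\<^esub> x = x \<otimes>\<^bsub>A\<^esub> elt a 0" if "a \<in> carrier K" for a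
      using C x that by (auto simp: commutative_subalgebra_def Men_K_def)
    then have "x = elt (x 0) 0" using centralizer_K[OF xc] by blast
    then show ?thesis using coord_closed[OF xc n_pos] unfolding Men_K_def by blast
  qed
  with C show "C = Men_K K n" by blast
qed

lemma central_A: "central_algebra base A"
  unfolding central_algebra_def
proof (intro conjI subset_antisym subsetI)
  show "\<one>\<^bsub>A\<^esub> \<noteq> \<zero>\<^bsub>A\<^esub>"
    using elt_eq_iff[OF n_pos, of \<one> \<zero>] by (simp add: one_A flip: elt_zero[of 0])
  fix x assume "x \<in> alg_center A"
  then have x: "x \<in> carrier A" and comm: "\<And>y. y \<in> carrier A \<Longrightarrow> x \<otimes>\<^bsub>A\<^esub> y = y \<otimes>\<^bsub>A\<^esub> x"
    by (auto simp: alg_center_def N.nucleus_carrier)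
  have e: "x = elt (x 0) 0" using comm by (intro centralizer_K[OF x]) simp
  have x0: "x 0 \<in> carrier K" using coord_closed[OF x n_pos] .
  have "\<tau> j (x 0) = x 0" if j: "j < n" for j
  proof -
    have "elt (x 0) 0 \<otimes>\<^bsub>A\<^esub> elt \<one> j = elt \<one> j \<otimes>\<^bsub>A\<^esub> elt (x 0) 0"
      using comm[of "elt \<one> j"] e by simp
    then show ?thesis using x0 j n_pos by (simp add: elt_mult elt_eq_iff)
  qed
  then have "x 0 \<in> F" using x0 by (simp add: F_iff)
  moreover have "x = x 0 \<odot>\<^bsub>A\<^esub> \<one>\<^bsub>A\<^esub>" using e x0 by (simp add: one_A smult_elt)
  ultimately show "x \<in> (\<lambda>c. c \<odot>\<^bsub>A\<^esub> \<one>\<^bsub>A\<^esub>) ` carrier base" by simp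
next
  fix x assume "x \<in> (\<lambda>c. c \<odot>\<^bsub>A\<^esub> \<one>\<^bsub>A\<^esub>) ` carrier base"
  then obtain f where f: "f \<in> carrier base" "x = f \<odot>\<^bsub>A\<^esub> \<one>\<^bsub>A\<^esub>" by auto
  have "x \<in> nucleus A" unfolding f(2) by (rule N.nucleus_smult[OF f(1) N.nucleus_one])
  moreover have "x \<otimes>\<^bsub>A\<^esub> y = y \<otimes>\<^bsub>A\<^esub> x" if "y \<in> carrier A" for y
    unfolding f(2) using that f(1) by (simp add: N.l_smult_mult N.r_smult_mult N.l_unit N.r_unit N.unit_closed)
  ultimately show "x \<in> alg_center A" by (simp add: alg_center_def)
qed

lemma base_expansion:
  assumes dual: "dual_families M a b" and x: "x \<in> carrier K"
  shows "x = (\<Oplus>m\<in>{..<M}. gtrace {..<n} (x \<otimes> a m) \<otimes> b m)"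
proof -
  note ab = dual_familiesD(1,2)[OF dual]
  have "(\<Oplus>m\<in>{..<M}. gtrace {..<n} (x \<otimes> a m) \<otimes> \<tau> 0 (b m)) = x"
    using gtrace_expansion[OF dual subset_refl n_pos x] n_pos x by simp
  then show ?thesis using ab by simp
qed

end

section \<open>Etale algebras and the action of a tensor square\<close>

lemma etale_algebra_of_field:
  fixes L :: "('f, 'a) module"
  assumes L: "finite_separable_extension R L"
  shows "etale_algebra R L"
proof -
  interpret L: field L using L by (simp add: finite_separable_extension_def)
  interpret LA: algebra R L using L by (simp add: finite_separable_extension_def)
  let ?P = "product_algebra 1 (\<lambda>_. L)"
  let ?h = "\<lambda>x. \<lambda>i\<in>{..<1::nat}. x"
  have "?h \<in> ring_hom L ?P"
    by (rule ring_hom_memI) (auto simp: product_algebra_def restrict_def fun_eq_iff split: if_splits)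
  moreover have "bij_betw ?h (carrier L) (carrier ?P)"
  proof (rule bij_betw_byWitness[where f' = "\<lambda>f. f 0"])
    show "\<forall>f\<in>carrier ?P. ?h (f 0) = f"
      by (auto simp: product_algebra_def PiE_def extensional_def fun_eq_iff)
  qed (auto simp: product_algebra_def PiE_def Pi_def)
  moreover have "?h (a \<odot>\<^bsub>L\<^esub> x) = a \<odot>\<^bsub>?P\<^esub> ?h x" for a x
    by (auto simp: product_algebra_def restrict_def fun_eq_iff)
  ultimately have "?h \<in> alg_iso R L ?P" by (simp add: alg_iso_def ring_iso_def)
  then show ?thesis
    unfolding etale_algebra_def using L by (intro exI[of _ 1] exI[of _ "\<lambda>_. L"]) auto
qed

text \<open>The setting in which \<open>frag_action\<close> is additive and kills the relations defining the tensor square,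
  so that cyclicity and faithfulness can be checked on representatives in the free abelian group.\<close>

locale algebra_subspace = nonassoc_algebra R A
  for R :: "('f, 'r) ring_scheme" (structure) and A :: "('f, 'c, 'm) module_scheme" (structure) +
  fixes E :: "'c set"
  assumes E: "E \<subseteq> carrier A"
    and E_add: "\<lbrakk>x \<in> E; y \<in> E\<rbrakk> \<Longrightarrow> x \<oplus>\<^bsub>A\<^esub> y \<in> E"
    and E_smult: "\<lbrakk>a \<in> carrier R; x \<in> E\<rbrakk> \<Longrightarrow> a \<odot>\<^bsub>A\<^esub> x \<in> E"
begin

lemma bimodule_term_closed:
  assumes "p \<in> E \<times> E" "x \<in> carrier A"
  shows "(fst p \<otimes>\<^bsub>A\<^esub> x) \<otimes>\<^bsub>A\<^esub> snd p \<in> carrier A"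
  using assms E by (cases p) (auto intro!: mult_closed)

text \<open>Summing over a larger finite set than the support allows two representatives to be compared
  termwise.\<close>

lemma frag_action_superset:
  assumes U: "finite U" "Poly_Mapping.keys t \<subseteq> U" "U \<subseteq> E \<times> E" and x: "x \<in> carrier A"
  shows "frag_action A t x =
    (\<Oplus>\<^bsub>A\<^esub>p\<in>U. [Poly_Mapping.lookup t p] \<cdot>\<^bsub>A\<^esub> ((fst p \<otimes>\<^bsub>A\<^esub> x) \<otimes>\<^bsub>A\<^esub> snd p))"
proof -
  have cl: "(fst p \<otimes>\<^bsub>A\<^esub> x) \<otimes>\<^bsub>A\<^esub> snd p \<in> carrier A" if "p \<in> U" for p
    using that U(3) x by (auto intro!: bimodule_term_closed)
  show ?thesis
    unfolding frag_action_def
  proof (rule M.add.finprod_mono_neutral_cong_left[OF U(1,2)])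
    show "[Poly_Mapping.lookup t i] \<cdot>\<^bsub>A\<^esub> ((fst i \<otimes>\<^bsub>A\<^esub> x) \<otimes>\<^bsub>A\<^esub> snd i) = \<zero>\<^bsub>A\<^esub>"
      if "i \<in> U - Poly_Mapping.keys t" for i
      using that by (simp add: in_keys_iff add_pow_def)
  qed (use cl in auto)
qed

lemma frag_action_closed:
  assumes t: "Poly_Mapping.keys t \<subseteq> E \<times> E" and x: "x \<in> carrier A"
  shows "frag_action A t x \<in> carrier A"
  unfolding frag_action_def using t x
  by (intro M.finsum_closed) (auto intro!: bimodule_term_closed M.add.int_pow_closed)

lemma frag_action_add:
  assumes t: "Poly_Mapping.keys t \<subseteq> E \<times> E" "Poly_Mapping.keys s \<subseteq> E \<times> E" and x: "x \<in> carrier A"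
  shows "frag_action A (t + s) x = frag_action A t x \<oplus>\<^bsub>A\<^esub> frag_action A s x"
proof -
  let ?U = "Poly_Mapping.keys t \<union> Poly_Mapping.keys s"
  have U: "finite ?U" "?U \<subseteq> E \<times> E" using t by auto
  have cl: "(fst p \<otimes>\<^bsub>A\<^esub> x) \<otimes>\<^bsub>A\<^esub> snd p \<in> carrier A" if "p \<in> ?U" for p
    using that U(2) x by (auto intro!: bimodule_term_closed)
  have "frag_action A (t + s) x = (\<Oplus>\<^bsub>A\<^esub>p\<in>?U.
      [Poly_Mapping.lookup (t + s) p] \<cdot>\<^bsub>A\<^esub> ((fst p \<otimes>\<^bsub>A\<^esub> x) \<otimes>\<^bsub>A\<^esub> snd p))"
    using U x Poly_Mapping.keys_add[of t s] by (intro frag_action_superset) auto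
  also have "\<dots> = (\<Oplus>\<^bsub>A\<^esub>p\<in>?U.
      [Poly_Mapping.lookup t p] \<cdot>\<^bsub>A\<^esub> ((fst p \<otimes>\<^bsub>A\<^esub> x) \<otimes>\<^bsub>A\<^esub> snd p) \<oplus>\<^bsub>A\<^esub>
      [Poly_Mapping.lookup s p] \<cdot>\<^bsub>A\<^esub> ((fst p \<otimes>\<^bsub>A\<^esub> x) \<otimes>\<^bsub>A\<^esub> snd p))"
    using cl by (intro M.finsum_cong')
      (auto simp: Poly_Mapping.lookup_add M.add.int_pow_mult intro!: M.add.int_pow_closed)
  also have "\<dots> = frag_action A t x \<oplus>\<^bsub>A\<^esub> frag_action A s x"
    using cl U x
    by (subst M.finsum_addf) (auto simp: frag_action_superset[of ?U] intro!: M.add.int_pow_closed)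
  finally show ?thesis .
qed

lemma frag_action_0: "frag_action A 0 x = \<zero>\<^bsub>A\<^esub>"
  by (simp add: frag_action_def)

lemma frag_action_of:
  assumes "e \<in> E" "e' \<in> E" "x \<in> carrier A"
  shows "frag_action A (frag_of (e, e')) x = (e \<otimes>\<^bsub>A\<^esub> x) \<otimes>\<^bsub>A\<^esub> e'"
proof -
  have c: "(e \<otimes>\<^bsub>A\<^esub> x) \<otimes>\<^bsub>A\<^esub> e' \<in> carrier A" using assms E by (auto intro!: mult_closed)
  then have "add_pow A (1::int) ((e \<otimes>\<^bsub>A\<^esub> x) \<otimes>\<^bsub>A\<^esub> e') = (e \<otimes>\<^bsub>A\<^esub> x) \<otimes>\<^bsub>A\<^esub> e'"
    by (rule M.add.int_pow_1)
  with c show ?thesis by (simp add: frag_action_def)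
qed

lemma frag_action_diff:
  assumes t: "Poly_Mapping.keys t \<subseteq> E \<times> E" "Poly_Mapping.keys s \<subseteq> E \<times> E" and x: "x \<in> carrier A"
  shows "frag_action A (t - s) x = frag_action A t x \<ominus>\<^bsub>A\<^esub> frag_action A s x"
proof -
  have k: "Poly_Mapping.keys (t - s) \<subseteq> E \<times> E" using t Poly_Mapping.keys_diff[of t s] by blast
  have "frag_action A t x = frag_action A (t - s) x \<oplus>\<^bsub>A\<^esub> frag_action A s x"
    using frag_action_add[OF k t(2) x] by simp
  then show ?thesis
    using frag_action_closed[OF k x] frag_action_closed[OF t(2) x]
    by (simp add: M.minus_eq M.a_assoc M.r_neg)
qed

lemma frag_action_sum:
  fixes p :: "nat \<Rightarrow> 'c \<times> 'c"
  assumes p: "\<And>m. p m \<in> E \<times> E" and x: "x \<in> carrier A"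
  shows "frag_action A (\<Sum>m<M. frag_of (p m)) x = (\<Oplus>\<^bsub>A\<^esub>m\<in>{..<M}. (fst (p m) \<otimes>\<^bsub>A\<^esub> x) \<otimes>\<^bsub>A\<^esub> snd (p m))"
proof (induction M)
  case (Suc M)
  have k: "Poly_Mapping.keys (\<Sum>m<M. frag_of (p m)) \<subseteq> E \<times> E"
    using sum_closed_free_Abelian_group[of "{..<M}" "\<lambda>m. frag_of (p m)" "E \<times> E"] p by simp
  have c: "(fst (p m) \<otimes>\<^bsub>A\<^esub> x) \<otimes>\<^bsub>A\<^esub> snd (p m) \<in> carrier A" for m
    using p x by (rule bimodule_term_closed)
  have "frag_action A (frag_of (p M)) x = (fst (p M) \<otimes>\<^bsub>A\<^esub> x) \<otimes>\<^bsub>A\<^esub> snd (p M)"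
    using frag_action_of[of "fst (p M)" "snd (p M)" x] p[of M] x by auto
  then show ?case
    using Suc c k p x by (simp add: lessThan_Suc M.finsum_insert frag_action_add M.a_comm)
qed (simp add: frag_action_0)

abbreviation "G \<equiv> free_Abelian_group (E \<times> E)"
abbreviation "H \<equiv> generate G (tensor_relations R A E)"

lemma tensor_relations_carrier: "tensor_relations R A E \<subseteq> carrier G"
proof
  have d2: "frag_of u - frag_of v \<in> carrier G"
    if "u \<in> E \<times> E" "v \<in> E \<times> E" for u v :: "'c \<times> 'c"
    using that keys_diff[of "frag_of u" "frag_of v"] by auto
  have d3: "frag_of u - frag_of v - frag_of w \<in> carrier G"
    if "u \<in> E \<times> E" "v \<in> E \<times> E" "w \<in> E \<times> E" for u v w :: "'c \<times> 'c"
    using that d2[of u v] keys_diff[of "frag_of u - frag_of v" "frag_of w"] by auto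
  fix r assume "r \<in> tensor_relations R A E"
  then show "r \<in> carrier G"
    unfolding tensor_relations_def
    by (elim UnE CollectE exE conjE; hypsubst; intro d2 d3; simp add: E_add E_smult)
qed

lemma H_subgroup: "subgroup H G"
  by (rule group.generate_is_subgroup[OF group_free_Abelian_group tensor_relations_carrier])

lemma H_carrier: "t \<in> H \<Longrightarrow> Poly_Mapping.keys t \<subseteq> E \<times> E"
  using subgroup.mem_carrier[OF H_subgroup] by simp

lemma H_zero: "0 \<in> H"
  using subgroup.one_closed[OF H_subgroup] by simp

lemma H_add: "\<lbrakk>s \<in> H; t \<in> H\<rbrakk> \<Longrightarrow> s + t \<in> H"
  using subgroup.m_closed[OF H_subgroup] by simp

lemma H_minus: "t \<in> H \<Longrightarrow> - t \<in> H"
  using subgroup.m_inv_closed[OF H_subgroup] H_carrier by fastforce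

lemma H_diff: "\<lbrakk>s \<in> H; t \<in> H\<rbrakk> \<Longrightarrow> s - t \<in> H"
  using H_add[OF _ H_minus] by fastforce

lemma H_add_left:
  "\<lbrakk>x \<in> E; y \<in> E; z \<in> E\<rbrakk> \<Longrightarrow> frag_of (x \<oplus>\<^bsub>A\<^esub> y, z) - frag_of (x, z) - frag_of (y, z) \<in> H"
  unfolding tensor_relations_def by (intro generate.incl UnI1) blast

lemma H_add_right:
  "\<lbrakk>x \<in> E; y \<in> E; z \<in> E\<rbrakk> \<Longrightarrow> frag_of (z, x \<oplus>\<^bsub>A\<^esub> y) - frag_of (z, x) - frag_of (z, y) \<in> H"
  unfolding tensor_relations_def by (rule generate.incl, rule UnI1, rule UnI2) blast

lemma H_smult:
  "\<lbrakk>a \<in> carrier R; x \<in> E; y \<in> E\<rbrakk> \<Longrightarrow> frag_of (a \<odot>\<^bsub>A\<^esub> x, y) - frag_of (x, a \<odot>\<^bsub>A\<^esub> y) \<in> H"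
  unfolding tensor_relations_def by (rule generate.incl, rule UnI2) blast

lemma frag_action_H:
  assumes t: "t \<in> H" and x: "x \<in> carrier A"
  shows "frag_action A t x = \<zero>\<^bsub>A\<^esub>"
  using t
proof (induction t rule: generate.induct)
  case one
  then show ?case by (simp add: frag_action_0)
next
  have rel: "frag_action A r x = \<zero>\<^bsub>A\<^esub>" if r: "r \<in> tensor_relations R A E" for r
  proof -
    have c: "e \<in> carrier A" if "e \<in> E" for e using that E by auto
    have k: "Poly_Mapping.keys (frag_of u - frag_of v) \<subseteq> E \<times> E"
      if "u \<in> E \<times> E" "v \<in> E \<times> E" for u v :: "'c \<times> 'c"
      using that keys_diff[of "frag_of u" "frag_of v"] by auto
    have cancel: "(p \<oplus>\<^bsub>A\<^esub> q) \<ominus>\<^bsub>A\<^esub> p \<ominus>\<^bsub>A\<^esub> q = \<zero>\<^bsub>A\<^esub>"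
      if "p \<in> carrier A" "q \<in> carrier A" for p q
    proof -
      have "(p \<oplus>\<^bsub>A\<^esub> q) \<oplus>\<^bsub>A\<^esub> \<ominus>\<^bsub>A\<^esub> p = q"
        using that by (metis M.a_comm M.a_assoc M.a_inv_closed M.r_neg M.r_zero)
      then show ?thesis using that by (simp add: M.minus_eq M.r_neg)
    qed
    from r consider
      (l) u v w where "r = frag_of (u \<oplus>\<^bsub>A\<^esub> v, w) - frag_of (u, w) - frag_of (v, w)"
        "u \<in> E" "v \<in> E" "w \<in> E"
      | (r) u v w where "r = frag_of (w, u \<oplus>\<^bsub>A\<^esub> v) - frag_of (w, u) - frag_of (w, v)"
        "u \<in> E" "v \<in> E" "w \<in> E"
      | (s) a u v where "r = frag_of (a \<odot>\<^bsub>A\<^esub> u, v) - frag_of (u, a \<odot>\<^bsub>A\<^esub> v)"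
        "a \<in> carrier R" "u \<in> E" "v \<in> E"
      unfolding tensor_relations_def by (elim UnE CollectE exE conjE) simp_all
    then show ?thesis
    proof cases
      case l
      then show ?thesis
        using x by (simp add: frag_action_diff k frag_action_of E_add l_add_mult mult_closed c cancel)
    next
      case r
      then show ?thesis
        using x by (simp add: frag_action_diff k frag_action_of E_add r_add_mult mult_closed c cancel)
    next
      case s
      then show ?thesis
        using x by (simp add: frag_action_diff k frag_action_of E_smult l_smult_mult r_smult_mult
            mult_closed c M.minus_eq M.r_neg)
    qed
  qed
  {
    case (incl h)
    then show ?case by (rule rel)
  next
    case (inv h)
    have kh: "Poly_Mapping.keys h \<subseteq> E \<times> E" using subsetD[OF tensor_relations_carrier inv] by simp
    have "frag_action A (0 - h) x = \<zero>\<^bsub>A\<^esub>"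
      using rel[OF inv] frag_action_diff[of 0 h x] kh x by (simp add: frag_action_0 M.minus_eq)
    then show ?case using kh by simp
  next
    case (eng h1 h2)
    then have "Poly_Mapping.keys h1 \<subseteq> E \<times> E" "Poly_Mapping.keys h2 \<subseteq> E \<times> E"
      using H_carrier by auto
    with eng show ?case using x by (simp add: frag_action_add)
  }
qed

lemma tensor_action_coset:
  assumes t: "Poly_Mapping.keys t \<subseteq> E \<times> E" and x: "x \<in> carrier A"
  shows "tensor_action A (H #>\<^bsub>G\<^esub> t) x = frag_action A t x"
proof -
  have "frag_action A (h + t) x = frag_action A t x" if "h \<in> H" for h
    using frag_action_add[OF H_carrier[OF that] t x] frag_action_H[OF that x]
      frag_action_closed[OF t x] by simp
  then have "(\<lambda>s. frag_action A s x) ` (H #>\<^bsub>G\<^esub> t) = {frag_action A t x}"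
    using H_zero by (auto simp: r_coset_def)
  then show ?thesis by (simp add: tensor_action_def)
qed

lemma carrier_tensor_square:
  "carrier (tensor_square R A E) = (\<lambda>t. H #>\<^bsub>G\<^esub> t) ` {t. Poly_Mapping.keys t \<subseteq> E \<times> E}"
  by (auto simp: tensor_square_def FactGroup_def RCOSETS_def)

lemma cyclic_tensor_moduleI:
  assumes x: "x \<in> carrier A"
    and gen: "\<And>y. y \<in> carrier A \<Longrightarrow> \<exists>t. Poly_Mapping.keys t \<subseteq> E \<times> E \<and> frag_action A t x = y"
  shows "cyclic_tensor_module R A E"
  unfolding cyclic_tensor_module_def
proof (intro bexI[OF _ x])
  have "(\<lambda>T. tensor_action A T x) ` carrier (tensor_square R A E) =
      (\<lambda>t. frag_action A t x) ` {t. Poly_Mapping.keys t \<subseteq> E \<times> E}"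
    using tensor_action_coset[OF _ x] by (auto simp: carrier_tensor_square image_image)
  also have "\<dots> = carrier A" using gen frag_action_closed[OF _ x] by blast
  finally show "carrier A = (\<lambda>T. tensor_action A T x) ` carrier (tensor_square R A E)" ..
qed

lemma faithful_tensor_moduleI:
  assumes "\<And>t. \<lbrakk>Poly_Mapping.keys t \<subseteq> E \<times> E; \<And>x. x \<in> carrier A \<Longrightarrow> frag_action A t x = \<zero>\<^bsub>A\<^esub>\<rbrakk> \<Longrightarrow> t \<in> H"
  shows "faithful_tensor_module R A E"
  unfolding faithful_tensor_module_def
proof (intro ballI impI)
  fix T assume "T \<in> carrier (tensor_square R A E)"
    and zero: "\<forall>x\<in>carrier A. tensor_action A T x = \<zero>\<^bsub>A\<^esub>"
  then obtain t where t: "Poly_Mapping.keys t \<subseteq> E \<times> E" "T = H #>\<^bsub>G\<^esub> t"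
    by (auto simp: carrier_tensor_square)
  then have "t \<in> H" using assms[OF t(1)] zero tensor_action_coset[OF t(1)] by simp
  then have "H #>\<^bsub>G\<^esub> t = H"
    by (rule subgroup.rcos_const[OF H_subgroup group_free_Abelian_group])
  then show "T = \<one>\<^bsub>tensor_square R A E\<^esub>" using t(2) by (simp add: tensor_square_def FactGroup_def)
qed

end

section \<open>Menichetti algebras are semiassociative\<close>

context menichetti
begin

lemma elt_finsum:
  assumes "finite I" "f \<in> I \<rightarrow> carrier K"
  shows "elt (finsum K f I) i = (\<Oplus>\<^bsub>A\<^esub>m\<in>I. elt (f m) i)"
  using assms
proof (induction I rule: finite_induct)
  case (insert m I)
  then show ?case by (simp add: elt_add N.M.finsum_insert Pi_def)
qed (simp add: elt_zero)

lemma finsum_coord: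
  assumes "finite I" "f \<in> I \<rightarrow> carrier A" "l < n"
  shows "(finsum A f I) l = (\<Oplus>m\<in>I. f m l)"
  using assms(1,2)
proof (induction I rule: finite_induct)
  case (insert m I)
  then show ?case using assms(3) coord_closed by (simp add: N.M.finsum_insert Pi_def)
qed (use assms(3) in simp)

lemma finite_dim_A: "finite_dim base A"
proof -
  obtain M a b where dual: "dual_families M a b" using dual_families_exist by blast
  note ab = dual_familiesD(1,2)[OF dual]
  let ?S = "(\<lambda>(m, i). elt (b m) i) ` ({..<M} \<times> {..<n})"
  have S: "finite ?S" "?S \<subseteq> carrier A" using ab by auto
  have span: "\<exists>f\<in>?S \<rightarrow> carrier base. x = (\<Oplus>\<^bsub>A\<^esub>s\<in>?S. f s \<odot>\<^bsub>A\<^esub> s)" if "x \<in> carrier A" for x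
    using that
  proof (induction x rule: monomial_induct)
    case zero
    show ?case using N.finite_span_finsum[OF S, of 0] by simp
  next
    case (add u v)
    then show ?case using N.finite_span_add_closed[OF S] by blast
  next
    case (elt x i)
    let ?t = "\<lambda>m. gtrace {..<n} (x \<otimes> a m)"
    have t: "?t m \<in> F" for m using elt ab by (intro full_trace_base) auto
    then have tc: "?t m \<in> carrier K" for m using F_sub by blast
    have "elt x i = elt (\<Oplus>m\<in>{..<M}. ?t m \<otimes> b m) i"
      using base_expansion[OF dual elt(1)] by simp
    also have "\<dots> = (\<Oplus>\<^bsub>A\<^esub>m\<in>{..<M}. elt (?t m \<otimes> b m) i)"
      using tc ab by (intro elt_finsum) auto
    also have "\<dots> = (\<Oplus>\<^bsub>A\<^esub>m\<in>{..<M}. ?t m \<odot>\<^bsub>A\<^esub> elt (b m) i)"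
      using tc ab by (simp add: smult_elt)
    finally have e: "elt x i = \<dots>" .
    have "\<exists>f\<in>?S \<rightarrow> carrier base.
        (\<Oplus>\<^bsub>A\<^esub>m\<in>{..<M}. ?t m \<odot>\<^bsub>A\<^esub> elt (b m) i) = (\<Oplus>\<^bsub>A\<^esub>s\<in>?S. f s \<odot>\<^bsub>A\<^esub> s)"
      by (rule N.finite_span_finsum[OF S]) (use t elt in auto)
    then show ?case unfolding e .
  qed
  show ?thesis unfolding finite_dim_def using S span by blast
qed

abbreviation "L \<equiv> A\<lparr>carrier := Men_K K n\<rparr>"

lemma embed_iso: "(\<lambda>a. elt a 0) \<in> ring_iso K L"
  unfolding ring_iso_def
proof (intro CollectI conjI)
  show "(\<lambda>a. elt a 0) \<in> ring_hom K L"
    by (rule ring_hom_memI) (auto simp: Men_K_def K_mult elt_add one_A)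
  show "bij_betw (\<lambda>a. elt a 0) (carrier K) (carrier L)"
    using elt_eq_iff[OF n_pos] by (auto simp: bij_betw_def inj_on_def Men_K_def)
qed

lemma L_field: "field L"
proof -
  have "field (L\<lparr>zero := elt \<zero> 0\<rparr>)" by (rule ring_iso_imp_img_field[OF embed_iso])
  moreover have "L\<lparr>zero := elt \<zero> 0\<rparr> = L" by (simp add: elt_zero Men_def)
  ultimately show ?thesis by simp
qed

lemma L_algebra: "algebra base L"
proof (rule algebraI)
  interpret L: field L by (rule L_field)
  show "cring L" by (rule L.is_cring)
  show "cring base" using base_field by (rule fieldE(1))
  have sub: "x \<in> carrier A" if "x \<in> carrier L" for x using that by (auto simp: Men_K_def)
  fix a x assume "a \<in> carrier base" "x \<in> carrier L"
  then show "a \<odot>\<^bsub>L\<^esub> x \<in> carrier L" using F_sub by (auto simp: Men_K_def smult_elt)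
  fix y assume "y \<in> carrier L"
  with \<open>a \<in> _\<close> \<open>x \<in> _\<close> show "(a \<odot>\<^bsub>L\<^esub> x) \<otimes>\<^bsub>L\<^esub> y = a \<odot>\<^bsub>L\<^esub> (x \<otimes>\<^bsub>L\<^esub> y)"
    "a \<odot>\<^bsub>L\<^esub> (x \<oplus>\<^bsub>L\<^esub> y) = a \<odot>\<^bsub>L\<^esub> x \<oplus>\<^bsub>L\<^esub> a \<odot>\<^bsub>L\<^esub> y"
    using sub[of x] sub[of y] by (simp_all add: N.l_smult_mult N.smult_r_distr)
next
  have sub: "x \<in> carrier A" if "x \<in> carrier L" for x using that by (auto simp: Men_K_def)
  fix a b x assume abx: "a \<in> carrier base" "b \<in> carrier base" "x \<in> carrier L"
  show "(a \<oplus>\<^bsub>base\<^esub> b) \<odot>\<^bsub>L\<^esub> x = a \<odot>\<^bsub>L\<^esub> x \<oplus>\<^bsub>L\<^esub> b \<odot>\<^bsub>L\<^esub> x"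
    "(a \<otimes>\<^bsub>base\<^esub> b) \<odot>\<^bsub>L\<^esub> x = a \<odot>\<^bsub>L\<^esub> (b \<odot>\<^bsub>L\<^esub> x)"
    using N.smult_l_distr[OF abx(1,2) sub[OF abx(3)]] N.smult_assoc1[OF abx(1,2) sub[OF abx(3)]]
    by simp_all
next
  fix x assume "x \<in> carrier L"
  then have "x \<in> carrier A" by (auto simp: Men_K_def)
  then show "\<one>\<^bsub>base\<^esub> \<odot>\<^bsub>L\<^esub> x = x" using N.smult_one by simp
qed

lemma L_finite_dim: "finite_dim base L"
proof -
  interpret L: algebra base L by (rule L_algebra)
  interpret H: ring_hom_ring K L "\<lambda>a. elt a 0"
    using embed_iso L_field by (intro ring_hom_ringI2 ring_axioms) (auto simp: ring_iso_def field_def domain_def cring_def)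
  obtain M a b where dual: "dual_families M a b" using dual_families_exist by blast
  note ab = dual_familiesD(1,2)[OF dual]
  let ?S = "(\<lambda>m. elt (b m) 0) ` {..<M}"
  have S: "finite ?S" "?S \<subseteq> carrier L" using ab by (auto simp: Men_K_def)
  have span: "\<exists>f\<in>?S \<rightarrow> carrier base. x = (\<Oplus>\<^bsub>L\<^esub>s\<in>?S. f s \<odot>\<^bsub>L\<^esub> s)" if "x \<in> carrier L" for x
  proof -
    obtain y where y: "y \<in> carrier K" "x = elt y 0" using \<open>x \<in> carrier L\<close> by (auto simp: Men_K_def)
    let ?t = "\<lambda>m. gtrace {..<n} (y \<otimes> a m)"
    have t: "?t m \<in> F" for m using y ab by (intro full_trace_base) auto
    then have tc: "?t m \<in> carrier K" for m using F_sub by blast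
    have "x = elt (\<Oplus>m\<in>{..<M}. ?t m \<otimes> b m) 0"
      using base_expansion[OF dual y(1)] y(2) by simp
    also have "\<dots> = (\<Oplus>\<^bsub>L\<^esub>m\<in>{..<M}. elt (?t m \<otimes> b m) 0)"
      using H.hom_finsum[of "\<lambda>m. ?t m \<otimes> b m" "{..<M}"] tc ab by (simp add: comp_def)
    also have "\<dots> = (\<Oplus>\<^bsub>L\<^esub>m\<in>{..<M}. ?t m \<odot>\<^bsub>L\<^esub> elt (b m) 0)"
      using tc ab by (simp add: smult_elt)
    finally have e: "x = \<dots>" .
    have "\<exists>f\<in>?S \<rightarrow> carrier base.
        (\<Oplus>\<^bsub>L\<^esub>m\<in>{..<M}. ?t m \<odot>\<^bsub>L\<^esub> elt (b m) 0) = (\<Oplus>\<^bsub>L\<^esub>s\<in>?S. f s \<odot>\<^bsub>L\<^esub> s)"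
      by (rule L.finite_span_finsum[OF S]) (use t in auto)
    then show ?thesis unfolding e .
  qed
  show ?thesis unfolding finite_dim_def using S span by blast
qed

text \<open>The embedding of \<open>K\<close> carries the vanishing of the separable polynomial at \<open>a\<close> to its vanishing at the
  image of \<open>a\<close>, because the structure map of \<open>L\<close> over \<open>F\<close> is the restriction of this embedding.\<close>

lemma L_separable:
  assumes "x \<in> carrier L"
  shows "separable_element base L x"
proof -
  obtain a where a: "a \<in> carrier K" "x = elt a 0" using assms by (auto simp: Men_K_def)
  obtain p where p: "p \<in> carrier (UP base)" "ring_irreducible\<^bsub>UP base\<^esub> p"
    "UnivPoly.eval K K id a p = \<zero>" "separable_poly base p"
    using separable_over_base[OF a(1)] by blast
  have pF: "p i \<in> F" for i using UP_subfield_carrier[OF F] p(1) by blast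
  then have pK: "p i \<in> carrier K" for i using F_sub by blast
  have t1: "p i \<odot>\<^bsub>L\<^esub> \<one>\<^bsub>L\<^esub> = elt (p i) 0" for i
    using smult_elt[OF pK one_closed] pK by (simp add: one_A)
  interpret H: ring_hom_cring K L "\<lambda>a. elt a 0"
    using embed_iso L_field is_cring fieldE(1)[OF L_field]
    by (intro ring_hom_cring.intro ring_hom_cring_axioms.intro) (auto simp: ring_iso_def)
  have t: "(p i \<odot>\<^bsub>L\<^esub> \<one>\<^bsub>L\<^esub>) \<otimes>\<^bsub>L\<^esub> x [^]\<^bsub>L\<^esub> i = elt (p i \<otimes> a [^] i) 0" for i
  proof -
    note t1[of i]
    moreover have "x [^]\<^bsub>L\<^esub> i = elt (a [^] i) 0"
      unfolding a(2) by (rule H.hom_pow[OF a(1), symmetric])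
    moreover have "elt (p i) 0 \<otimes>\<^bsub>L\<^esub> elt (a [^] i) 0 = elt (p i \<otimes> a [^] i) 0"
      using K_mult[OF pK nat_pow_closed[OF a(1)]] by simp
    ultimately show ?thesis by (simp only:)
  qed
  have "UnivPoly.eval base L (\<lambda>c. c \<odot>\<^bsub>L\<^esub> \<one>\<^bsub>L\<^esub>) x p =
      (\<Oplus>\<^bsub>L\<^esub>i\<in>{..deg base p}. (p i \<odot>\<^bsub>L\<^esub> \<one>\<^bsub>L\<^esub>) \<otimes>\<^bsub>L\<^esub> x [^]\<^bsub>L\<^esub> i)"
    unfolding UnivPoly.eval_def using p(1) by (simp add: UP_subfield_coeff[OF F p(1)])
  also have "\<dots> = (\<Oplus>\<^bsub>L\<^esub>i\<in>{..deg base p}. elt (p i \<otimes> a [^] i) 0)"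
    by (simp only: t)
  also have "\<dots> = elt (\<Oplus>i\<in>{..deg base p}. p i \<otimes> a [^] i) 0"
    using H.hom_finsum[of "\<lambda>i. p i \<otimes> a [^] i" "{..deg base p}"] pK a by (simp add: comp_def)
  also have "(\<Oplus>i\<in>{..deg base p}. p i \<otimes> a [^] i) = UnivPoly.eval K K id a p"
    using p(1) UP_subfield_carrier[OF F, of p]
    by (simp add: UnivPoly.eval_def UP_subfield_coeff[OF F p(1)] UP_subfield_deg[OF F p(1)])
  also have "elt \<dots> 0 = \<zero>\<^bsub>L\<^esub>" using p(3) by (simp add: elt_zero)
  finally show ?thesis unfolding separable_element_def using p by blast
qed

lemma L_etale: "etale_algebra base L"
  by (rule etale_algebra_of_field)
    (simp add: finite_separable_extension_def L_field L_algebra L_finite_dim L_separable)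

text \<open>On the component \<open>l\<close> the summation multiplies by
  \<open>\<Sum> \<tau>\<^sub>l\<^sub>-\<^sub>j(a\<^sub>m) b\<^sub>m\<close>, which is \<open>1\<close> for \<open>l = j\<close> and \<open>0\<close> otherwise. So the projection of \<open>A\<close> onto a
  component, followed by a right multiplication by \<open>v\<close>, comes from the action of \<open>K \<otimes> K\<close>.\<close>

lemma bimodule_projection:
  assumes dual: "dual_families M a b" and j: "j < n" and x: "x \<in> carrier A" and v: "v \<in> carrier K"
  shows "(\<Oplus>\<^bsub>A\<^esub>m\<in>{..<M}. (elt (\<tau> ((n - j) mod n) (a m)) 0 \<otimes>\<^bsub>A\<^esub> x) \<otimes>\<^bsub>A\<^esub> elt (b m \<otimes> v) 0) =
    elt (x j \<otimes> v) j"
proof -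
  note ab = dual_familiesD(1,2)[OF dual]
  let ?j = "(n - j) mod n"
  have j': "?j < n" using n_pos by simp
  have cl: "(elt (\<tau> ?j (a m)) 0 \<otimes>\<^bsub>A\<^esub> x) \<otimes>\<^bsub>A\<^esub> elt (b m \<otimes> v) 0 \<in> carrier A" for m
    using ab x v j' by (intro N.mult_closed) auto
  have xj: "x l \<in> carrier K" if "l < n" for l using x that by (rule coord_closed)
  show ?thesis
  proof (rule A_eqI)
    show "(\<Oplus>\<^bsub>A\<^esub>m\<in>{..<M}. (elt (\<tau> ?j (a m)) 0 \<otimes>\<^bsub>A\<^esub> x) \<otimes>\<^bsub>A\<^esub> elt (b m \<otimes> v) 0) \<in> carrier A"
      using cl by (intro N.M.finsum_closed) auto
    show "elt (x j \<otimes> v) j \<in> carrier A" using xj[OF j] v by simp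
    fix l assume l: "l < n"
    let ?i = "(l + ?j) mod n"
    have i: "?i < n" using n_pos by simp
    have i0: "?i = 0 \<longleftrightarrow> l = j"
    proof -
      have "?i = (n - j + l) mod n" by (simp add: mod_simps add.commute)
      moreover have "(n - j + l) mod n = 0 \<longleftrightarrow> l = j"
        using translate_inverse(2)[OF j l] j l by auto
      ultimately show ?thesis by simp
    qed
    have "(\<Oplus>\<^bsub>A\<^esub>m\<in>{..<M}. (elt (\<tau> ?j (a m)) 0 \<otimes>\<^bsub>A\<^esub> x) \<otimes>\<^bsub>A\<^esub> elt (b m \<otimes> v) 0) l =
        (\<Oplus>m\<in>{..<M}. ((elt (\<tau> ?j (a m)) 0 \<otimes>\<^bsub>A\<^esub> x) \<otimes>\<^bsub>A\<^esub> elt (b m \<otimes> v) 0) l)"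
      using cl l by (intro finsum_coord) auto
    also have "\<dots> = (\<Oplus>m\<in>{..<M}. (x l \<otimes> v) \<otimes> (\<tau> ?i (a m) \<otimes> \<tau> 0 (b m)))"
    proof (intro finsum_cong' refl)
      fix m
      have "((elt (\<tau> ?j (a m)) 0 \<otimes>\<^bsub>A\<^esub> x) \<otimes>\<^bsub>A\<^esub> elt (b m \<otimes> v) 0) l =
          \<tau> l (\<tau> ?j (a m)) \<otimes> x l \<otimes> (b m \<otimes> v)"
        using ab x v j' l by (simp add: mult_K_coord N.mult_closed)
      also have "\<tau> l (\<tau> ?j (a m)) = \<tau> ?i (a m)" using tau_comp[OF l j' ab(1)] by simp
      also have "\<tau> ?i (a m) \<otimes> x l \<otimes> (b m \<otimes> v) = (x l \<otimes> v) \<otimes> (\<tau> ?i (a m) \<otimes> \<tau> 0 (b m))"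
        using ab xj[OF l] v i by (simp add: m_ac)
      finally show "((elt (\<tau> ?j (a m)) 0 \<otimes>\<^bsub>A\<^esub> x) \<otimes>\<^bsub>A\<^esub> elt (b m \<otimes> v) 0) l =
        (x l \<otimes> v) \<otimes> (\<tau> ?i (a m) \<otimes> \<tau> 0 (b m))" .
    qed (use ab xj[OF l] v i n_pos in auto)
    also have "\<dots> = (x l \<otimes> v) \<otimes> (\<Oplus>m\<in>{..<M}. \<tau> ?i (a m) \<otimes> \<tau> 0 (b m))"
      using ab xj[OF l] v i n_pos by (intro finsum_rdistr[symmetric]) auto
    also have "\<dots> = elt (x j \<otimes> v) j l"
      unfolding dual_familiesD(3)[OF dual i n_pos] i0 using xj[OF l] xj[OF j] v l by (simp add: elt_coord)
    finally show "(\<Oplus>\<^bsub>A\<^esub>m\<in>{..<M}. (elt (\<tau> ?j (a m)) 0 \<otimes>\<^bsub>A\<^esub> x) \<otimes>\<^bsub>A\<^esub> elt (b m \<otimes> v) 0) l =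
      elt (x j \<otimes> v) j l" .
  qed
qed

abbreviation "E \<equiv> Men_K K n"

sublocale T: algebra_subspace base A E
  using commutative_subalgebra_K
  by unfold_locales (auto simp: commutative_subalgebra_def unital_subalgebra_def)

lemma E_elt [simp]: "a \<in> carrier K \<Longrightarrow> elt a 0 \<in> E"
  by (auto simp: Men_K_def)

text \<open>The element \<open>\<Sum> z\<^sub>l\<close>. Having no zero coordinate, it generates \<open>A\<close> over \<open>K \<otimes> K\<close>, and a tensor is
  determined by its action on it.\<close>

definition ones :: "nat \<Rightarrow> 'a" where
  "ones = (\<lambda>l\<in>{..<n}. \<one>)"

lemma ones: "ones \<in> carrier A" "l < n \<Longrightarrow> ones l = \<one>"
  by (auto simp: ones_def carrier_A)

lemma cyclic_E: "cyclic_tensor_module base A E"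
proof (rule T.cyclic_tensor_moduleI[OF ones(1)])
  obtain M a b where dual: "dual_families M a b" using dual_families_exist by blast
  note ab = dual_familiesD(1,2)[OF dual]
  fix y assume "y \<in> carrier A"
  then show "\<exists>t. Poly_Mapping.keys t \<subseteq> E \<times> E \<and> frag_action A t ones = y"
  proof (induction y rule: monomial_induct)
    case zero
    show ?case by (intro exI[of _ 0]) (simp add: T.frag_action_0)
  next
    case (add u v)
    then obtain s t where st: "Poly_Mapping.keys s \<subseteq> E \<times> E" "frag_action A s ones = u"
      "Poly_Mapping.keys t \<subseteq> E \<times> E" "frag_action A t ones = v" by blast
    then have "frag_action A (s + t) ones = u \<oplus>\<^bsub>A\<^esub> v"
      by (simp add: T.frag_action_add[OF st(1,3) ones(1)])
    moreover have "Poly_Mapping.keys (s + t) \<subseteq> E \<times> E"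
      using st Poly_Mapping.keys_add[of s t] by blast
    ultimately show ?case by blast
  next
    case (elt w j)
    let ?p = "\<lambda>m. (elt (\<tau> ((n - j) mod n) (a m)) 0, elt (b m \<otimes> w) 0)"
    have p: "?p m \<in> E \<times> E" for m using ab elt n_pos by simp
    have "frag_action A (\<Sum>m<M. frag_of (?p m)) ones = elt w j"
      using T.frag_action_sum[OF p ones(1), where M = M] bimodule_projection[OF dual elt(2) ones(1) elt(1)] elt
      by (simp add: ones)
    moreover have "Poly_Mapping.keys (\<Sum>m<M. frag_of (?p m)) \<subseteq> E \<times> E"
      using sum_closed_free_Abelian_group[of "{..<M}" "\<lambda>m. frag_of (?p m)" "E \<times> E"] p by simp
    ultimately show ?case by blast
  qed
qed

lemma H_zero_left: "z \<in> E \<Longrightarrow> frag_of (elt \<zero> 0, z) \<in> T.H"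
  using T.H_minus[OF T.H_add_left[of "elt \<zero> 0" "elt \<zero> 0" z]] by (simp flip: elt_add)

lemma H_zero_right: "z \<in> E \<Longrightarrow> frag_of (z, elt \<zero> 0) \<in> T.H"
  using T.H_minus[OF T.H_add_right[of "elt \<zero> 0" "elt \<zero> 0" z]] by (simp flip: elt_add)

lemma H_sum_left:
  fixes M :: nat
  assumes f: "\<And>m. f m \<in> carrier K" and z: "z \<in> E"
  shows "frag_of (elt (\<Oplus>m\<in>{..<M}. f m) 0, z) - (\<Sum>m<M. frag_of (elt (f m) 0, z)) \<in> T.H"
proof (induction M)
  case 0
  show ?case using H_zero_left[OF z] by simp
next
  case (Suc M)
  let ?s = "\<Oplus>m\<in>{..<M}. f m"
  have s: "?s \<in> carrier K" using f by (auto intro: finsum_closed)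
  have e: "elt (\<Oplus>m\<in>{..<Suc M}. f m) 0 = elt (f M) 0 \<oplus>\<^bsub>A\<^esub> elt ?s 0"
    using f s by (simp add: lessThan_Suc elt_add)
  have "frag_of (elt (f M) 0 \<oplus>\<^bsub>A\<^esub> elt ?s 0, z) - frag_of (elt (f M) 0, z) - frag_of (elt ?s 0, z) \<in> T.H"
    using f s z by (intro T.H_add_left) auto
  from T.H_add[OF this Suc] show ?case unfolding e by (simp add: algebra_simps)
qed

text \<open>By the dual basis formula every tensor \<open>t = \<Sum> x\<^sub>i \<otimes> y\<^sub>i\<close> equals \<open>\<Sum> b\<^sub>m \<otimes> Y\<^sub>m\<close> with
  \<open>Y\<^sub>m = \<Sum> Tr(x\<^sub>i a\<^sub>m) y\<^sub>i = \<Sum>\<^sub>l \<tau>\<^sub>l(a\<^sub>m) (\<Sum> \<tau>\<^sub>l(x\<^sub>i) y\<^sub>i)\<close>. The inner sums are the coordinates of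
  the result of \<open>t\<close> acting on \<open>\<Sum> z\<^sub>l\<close>, so \<open>t\<close> is recovered from this result.\<close>

lemma faithful_E: "faithful_tensor_module base A E"
proof (rule T.faithful_tensor_moduleI)
  obtain M a b where dual: "dual_families M a b" using dual_families_exist by blast
  note ab = dual_familiesD(1,2)[OF dual]
  \<comment> \<open>\<open>\<Psi>\<close> recovers a representative of a tensor from its action on \<open>\<Sum> z\<^sub>l\<close>. It is additive and
    inverts the action only modulo the relations of the tensor square.\<close>
  define Y where "Y m y = (\<Oplus>l\<in>{..<n}. \<tau> l (a m) \<otimes> y l)" for m y
  define \<Psi> where "\<Psi> y = (\<Sum>m<M. frag_of (elt (b m) 0, elt (Y m y) 0))" for y
  have Yc: "Y m y \<in> carrier K" if "y \<in> carrier A" for m y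
    unfolding Y_def using that ab coord_closed by (auto intro!: finsum_closed)
  have Yadd: "Y m (u \<oplus>\<^bsub>A\<^esub> v) = Y m u \<oplus> Y m v" if "u \<in> carrier A" "v \<in> carrier A" for m u v
  proof -
    have "Y m (u \<oplus>\<^bsub>A\<^esub> v) = (\<Oplus>l\<in>{..<n}. \<tau> l (a m) \<otimes> u l \<oplus> \<tau> l (a m) \<otimes> v l)"
      unfolding Y_def using that ab coord_closed by (intro finsum_cong') (auto simp: r_distr)
    also have "\<dots> = Y m u \<oplus> Y m v"
      unfolding Y_def using that ab coord_closed by (intro finsum_addf) auto
    finally show ?thesis .
  qed
  have \<Psi>add: "\<Psi> (u \<oplus>\<^bsub>A\<^esub> v) - \<Psi> u - \<Psi> v \<in> T.H" if uv: "u \<in> carrier A" "v \<in> carrier A" for u v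
  proof -
    have "(\<Sum>m<N. frag_of (elt (b m) 0, elt (Y m (u \<oplus>\<^bsub>A\<^esub> v)) 0)) -
        (\<Sum>m<N. frag_of (elt (b m) 0, elt (Y m u) 0)) -
        (\<Sum>m<N. frag_of (elt (b m) 0, elt (Y m v) 0)) \<in> T.H" for N
    proof (induction N)
      case (Suc N)
      have "frag_of (elt (b N) 0, elt (Y N u) 0 \<oplus>\<^bsub>A\<^esub> elt (Y N v) 0) -
          frag_of (elt (b N) 0, elt (Y N u) 0) - frag_of (elt (b N) 0, elt (Y N v) 0) \<in> T.H"
        using Yc uv ab by (intro T.H_add_right) auto
      from T.H_add[OF this Suc] show ?case
        using Yc uv by (simp add: Yadd elt_add algebra_simps)
    qed (simp add: T.H_zero)
    then show ?thesis unfolding \<Psi>_def .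
  qed
  have Y0: "Y m \<zero>\<^bsub>A\<^esub> = \<zero>" for m
    unfolding Y_def using ab by (subst finsum_cong'[of _ _ "\<lambda>_. \<zero>"]) auto
  have \<Psi>0: "\<Psi> \<zero>\<^bsub>A\<^esub> \<in> T.H"
  proof -
    have "(\<Sum>m<N. frag_of (elt (b m) 0, elt \<zero> 0)) \<in> T.H" for N
      by (induction N) (auto simp: T.H_zero ab intro!: T.H_add H_zero_right)
    then show ?thesis by (simp add: \<Psi>_def Y0)
  qed
  have gen: "frag_of p - \<Psi> (frag_action A (frag_of p) ones) \<in> T.H" if p: "p \<in> E \<times> E" for p
  proof -
    obtain x y where xy: "p = (elt x 0, elt y 0)" "x \<in> carrier K" "y \<in> carrier K"
      using p by (auto simp: Men_K_def)
    let ?z = "frag_action A (frag_of p) ones"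
    let ?t = "\<lambda>m. gtrace {..<n} (x \<otimes> a m)"
    have tF: "?t m \<in> F" for m using xy ab by (intro full_trace_base) auto
    then have tc: "?t m \<in> carrier K" for m using F_sub by blast
    have z: "?z = (elt x 0 \<otimes>\<^bsub>A\<^esub> ones) \<otimes>\<^bsub>A\<^esub> elt y 0"
      unfolding xy(1) using xy ones by (intro T.frag_action_of) auto
    have zl: "?z l = \<tau> l x \<otimes> y" if "l < n" for l
      unfolding z using that xy ones by (simp add: mult_K_coord N.mult_closed)
    have Yz: "Y m ?z = ?t m \<otimes> y" for m
    proof -
      have "Y m ?z = (\<Oplus>l\<in>{..<n}. \<tau> l (x \<otimes> a m) \<otimes> y)"
        unfolding Y_def using xy(2,3) ab by (intro finsum_cong') (auto simp: zl tau_mult m_ac)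
      also have "\<dots> = ?t m \<otimes> y"
        unfolding gtrace_def using xy ab by (intro finsum_ldistr[symmetric]) auto
      finally show ?thesis .
    qed
    have bal: "(\<Sum>m<N. frag_of (elt (?t m \<otimes> b m) 0, elt y 0)) -
        (\<Sum>m<N. frag_of (elt (b m) 0, elt (?t m \<otimes> y) 0)) \<in> T.H" for N
    proof (induction N)
      case (Suc N)
      have "frag_of (?t N \<odot>\<^bsub>A\<^esub> elt (b N) 0, elt y 0) - frag_of (elt (b N) 0, ?t N \<odot>\<^bsub>A\<^esub> elt y 0) \<in> T.H"
        using tF ab xy by (intro T.H_smult) auto
      from T.H_add[OF this Suc] show ?case
        using tc ab xy by (simp add: smult_elt algebra_simps)
    qed (simp add: T.H_zero)
    have "frag_of (elt (\<Oplus>m\<in>{..<M}. ?t m \<otimes> b m) 0, elt y 0) -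
        (\<Sum>m<M. frag_of (elt (?t m \<otimes> b m) 0, elt y 0)) \<in> T.H"
      using tc ab xy by (intro H_sum_left) auto
    from T.H_add[OF this bal[of M]]
    have "frag_of (elt x 0, elt y 0) - (\<Sum>m<M. frag_of (elt (b m) 0, elt (?t m \<otimes> y) 0)) \<in> T.H"
      unfolding base_expansion[OF dual xy(2), symmetric] by simp
    then show ?thesis unfolding \<Psi>_def Yz unfolding xy(1) .
  qed
  fix t assume t: "Poly_Mapping.keys t \<subseteq> E \<times> E"
    and zero: "\<And>x. x \<in> carrier A \<Longrightarrow> frag_action A t x = \<zero>\<^bsub>A\<^esub>"
  have "t - \<Psi> (frag_action A t ones) \<in> T.H"
  proof (rule free_Abelian_group_induct[where P = "\<lambda>t. t - \<Psi> (frag_action A t ones) \<in> T.H", OF t])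
    show "0 - \<Psi> (frag_action A 0 ones) \<in> T.H"
      using T.H_minus[OF \<Psi>0] by (simp add: T.frag_action_0)
    fix s t
    let ?s = "frag_action A s ones" and ?t = "frag_action A t ones"
    assume st: "Poly_Mapping.keys s \<subseteq> E \<times> E" "Poly_Mapping.keys t \<subseteq> E \<times> E"
      and IH: "s - \<Psi> ?s \<in> T.H" "t - \<Psi> ?t \<in> T.H"
    have c: "?s \<in> carrier A" "?t \<in> carrier A"
      using st ones by (auto intro: T.frag_action_closed)
    have d: "frag_action A (s - t) ones = ?s \<ominus>\<^bsub>A\<^esub> ?t"
      using st ones by (intro T.frag_action_diff) auto
    have dc: "?s \<ominus>\<^bsub>A\<^esub> ?t \<in> carrier A" using c by simp
    have "(?s \<ominus>\<^bsub>A\<^esub> ?t) \<oplus>\<^bsub>A\<^esub> ?t = ?s" using c by (simp add: N.M.minus_eq N.M.a_assoc N.M.l_neg)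
    then have "\<Psi> ?s - \<Psi> (?s \<ominus>\<^bsub>A\<^esub> ?t) - \<Psi> ?t \<in> T.H" using \<Psi>add[OF dc c(2)] by simp
    from T.H_add[OF T.H_diff[OF IH] this]
    show "s - t - \<Psi> (frag_action A (s - t) ones) \<in> T.H" unfolding d by (simp add: algebra_simps)
  qed (rule gen)
  then have "t - \<Psi> \<zero>\<^bsub>A\<^esub> \<in> T.H" using zero[OF ones(1)] by simp
  from T.H_add[OF this \<Psi>0] show "t \<in> T.H" by simp
qed

theorem semiassociative_A: "semiassociative base A"
  unfolding semiassociative_def
  using nonassoc_algebra_A finite_dim_A central_A commutative_subalgebra_K K_nucleus L_etale
    cyclic_E faithful_E
  by (auto simp: commutative_subalgebra_def)

end

section \<open>The atom of a Menichetti algebra\<close>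

context menichetti
begin

text \<open>The negative of \<open>j\<close> is \<open>(n - 1) j\<close>, a multiple of \<open>j\<close>.\<close>

lemma nuc_support_neg:
  assumes j: "j \<in> nuc_support"
  shows "(n - j) mod n \<in> nuc_support"
proof (cases j)
  case 0
  then show ?thesis using nuc_support_0 by simp
next
  case (Suc i)
  have jn: "j < n" using j nuc_support_sub by auto
  have mult: "(m * j) mod n \<in> nuc_support" for m
  proof (induction m)
    case 0
    show ?case using nuc_support_0 by simp
  next
    case (Suc m)
    have "(Suc m * j) mod n = (j + (m * j) mod n) mod n" by (simp add: mod_simps)
    then show ?case using nuc_support_add[OF j Suc] by simp
  qed
  obtain d where d: "n = d + Suc i" using jn Suc by (metis add.commute less_imp_add_positive)
  have "(n - 1) * j = (n - j) + n * i" using d Suc by (simp add: algebra_simps)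
  then have "((n - 1) * j) mod n = (n - j) mod n" by simp
  then show ?thesis using mult[of "n - 1"] by simp
qed

lemma elt_nucleus: "\<lbrakk>a \<in> carrier K; i \<in> nuc_support\<rbrakk> \<Longrightarrow> elt a i \<in> nucleus A"
  by (auto simp: nucleus_A elt_coord)

lemma monomial_right_inverse:
  assumes i: "i \<in> nuc_support" and a: "a \<in> carrier K" "a \<noteq> \<zero>"
  shows "\<exists>b\<in>carrier K. b \<noteq> \<zero> \<and> elt a i \<otimes>\<^bsub>A\<^esub> elt b ((n - i) mod n) = \<one>\<^bsub>A\<^esub>"
proof -
  let ?i = "(n - i) mod n"
  have lt: "i < n" "?i < n" using i nuc_support_sub n_pos by auto
  have i0: "(i + ?i) mod n = 0" using lt by (simp add: mod_simps)
  let ?u = "\<tau> ?i a \<otimes> c ?i i"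
  have ta: "\<tau> ?i a \<noteq> \<zero>" using tau_inj[OF lt(2) a(1) zero_closed] a(2) lt by auto
  have u: "?u \<in> carrier K" "?u \<noteq> \<zero>"
    using a lt ta c_closed[OF lt(2,1)] c_nonzero[OF lt(2,1)] by (auto simp: integral_iff)
  then have v: "inv ?u \<in> carrier K" "?u \<otimes> inv ?u = \<one>"
    using Units_r_inv[of ?u] Units_inv_closed[of ?u] by (auto simp: field_Units)
  then have "inv ?u \<noteq> \<zero>" using u by auto
  moreover have "\<tau> ?i a \<otimes> inv ?u \<otimes> c ?i i = \<one>"
    using v a lt c_closed[OF lt(2,1)] by (metis m_assoc m_comm tau_closed)
  ultimately show ?thesis
    using v(1) a lt by (intro bexI[of _ "inv ?u"]) (simp_all add: elt_mult i0 one_A)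
qed

text \<open>The right inverse of a monomial is again such a monomial and has a right inverse itself; as all of
  them lie in the associative nucleus, right inverses are two-sided.\<close>

lemma monomial_inverse:
  assumes i: "i \<in> nuc_support" and a: "a \<in> carrier K" "a \<noteq> \<zero>"
  shows "\<exists>v\<in>nucleus A. elt a i \<otimes>\<^bsub>A\<^esub> v = \<one>\<^bsub>A\<^esub> \<and> v \<otimes>\<^bsub>A\<^esub> elt a i = \<one>\<^bsub>A\<^esub>"
proof -
  let ?u = "elt a i"
  let ?i = "(n - i) mod n"
  obtain b where b: "b \<in> carrier K" "b \<noteq> \<zero>" "?u \<otimes>\<^bsub>A\<^esub> elt b ?i = \<one>\<^bsub>A\<^esub>"
    using monomial_right_inverse[OF assms] by blast
  let ?v = "elt b ?i"
  obtain w where w: "w \<in> carrier A" "?v \<otimes>\<^bsub>A\<^esub> w = \<one>\<^bsub>A\<^esub>"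
    using monomial_right_inverse[OF nuc_support_neg[OF i] b(1,2)] elt_closed by blast
  have u: "?u \<in> nucleus A" and v: "?v \<in> nucleus A"
    using elt_nucleus a b i nuc_support_neg[OF i] by auto
  have "?u = ?u \<otimes>\<^bsub>A\<^esub> (?v \<otimes>\<^bsub>A\<^esub> w)" using w a by (simp add: N.r_unit)
  also have "\<dots> = (?u \<otimes>\<^bsub>A\<^esub> ?v) \<otimes>\<^bsub>A\<^esub> w" using u v w(1) b(1) by (simp add: N.nucleus_iff)
  also have "\<dots> = w" using b w by (simp add: N.l_unit)
  finally show ?thesis using b w v by auto
qed

text \<open>Simplicity of the nucleus: an ideal is a \<open>K\<close>-bimodule, so with \<open>x\<close> it contains the monomials of
  \<open>x\<close>, and the nonzero monomials of the nucleus are units.\<close>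

lemma nucleus_ideal_contains_one:
  assumes sub: "I \<subseteq> nucleus A"
    and zero: "\<zero>\<^bsub>A\<^esub> \<in> I" and add: "\<And>x y. \<lbrakk>x \<in> I; y \<in> I\<rbrakk> \<Longrightarrow> x \<oplus>\<^bsub>A\<^esub> y \<in> I"
    and left: "\<And>x y. \<lbrakk>x \<in> I; y \<in> nucleus A\<rbrakk> \<Longrightarrow> y \<otimes>\<^bsub>A\<^esub> x \<in> I"
    and right: "\<And>x y. \<lbrakk>x \<in> I; y \<in> nucleus A\<rbrakk> \<Longrightarrow> x \<otimes>\<^bsub>A\<^esub> y \<in> I"
    and x: "x \<in> I" "x \<noteq> \<zero>\<^bsub>A\<^esub>"
  shows "\<one>\<^bsub>A\<^esub> \<in> I"
proof -
  obtain M a b where dual: "dual_families M a b" using dual_families_exist by blast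
  note ab = dual_familiesD(1,2)[OF dual]
  have xn: "x \<in> nucleus A" and xc: "x \<in> carrier A" using x sub N.nucleus_carrier by auto
  obtain j where j: "j < n" "x j \<noteq> \<zero>"
    using x(2) A_eqI[OF xc zero_A_closed] by auto
  have jS: "j \<in> nuc_support" using xn j by (simp add: nucleus_A)
  have xj: "x j \<in> carrier K" using xc j(1) by (rule coord_closed)
  have finsum: "(\<Oplus>\<^bsub>A\<^esub>m\<in>{..<N}. g m) \<in> I" if "\<And>m. g m \<in> I" for g and N :: nat
  proof (induction N)
    case (Suc N)
    have "g m \<in> carrier A" for m using that sub N.nucleus_carrier by blast
    then show ?case using Suc that add by (simp add: lessThan_Suc N.M.finsum_insert)
  qed (simp add: zero)
  let ?g = "\<lambda>m. (elt (\<tau> ((n - j) mod n) (a m)) 0 \<otimes>\<^bsub>A\<^esub> x) \<otimes>\<^bsub>A\<^esub> elt (b m \<otimes> \<one>) 0"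
  have "?g m \<in> I" for m
    using x(1) ab n_pos nuc_support_0 by (intro left right elt_nucleus) auto
  then have "(\<Oplus>\<^bsub>A\<^esub>m\<in>{..<M}. ?g m) \<in> I" by (rule finsum)
  then have e: "elt (x j) j \<in> I"
    unfolding bimodule_projection[OF dual j(1) xc one_closed] using xj by simp
  obtain v where "v \<in> nucleus A" "elt (x j) j \<otimes>\<^bsub>A\<^esub> v = \<one>\<^bsub>A\<^esub>"
    using monomial_inverse[OF jS xj j(2)] by blast
  with right[OF e] show ?thesis by metis
qed

abbreviation "NA \<equiv> A\<lparr>carrier := nucleus A\<rparr>"

lemma one_neq_zero_A: "\<one>\<^bsub>A\<^esub> \<noteq> \<zero>\<^bsub>A\<^esub>"
  using central_A by (simp add: central_algebra_def)

text \<open>The radical is a left ideal that is stable under right multiplication by units. As the nucleus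
  is generated by unit monomials additively, the radical is a proper two-sided ideal of a simple
  ring.\<close>

lemma jacobson_nucleus: "jacobson_radical NA = {\<zero>\<^bsub>A\<^esub>}"
proof -
  interpret NA: ring NA by (rule N.nucleus_ring)
  let ?J = "jacobson_radical NA"
  have lJ: "left_ideal ?J NA" by (rule NA.jacobson_radical_left_ideal)
  interpret J: additive_subgroup ?J NA using lJ by (simp add: left_ideal_def)
  have sub: "?J \<subseteq> nucleus A" by (auto simp: jacobson_radical_def)
  have zero: "\<zero>\<^bsub>A\<^esub> \<in> ?J" using J.zero_closed by simp
  have add: "x \<oplus>\<^bsub>A\<^esub> y \<in> ?J" if "x \<in> ?J" "y \<in> ?J" for x y
    using J.a_closed[OF that] by simp
  have left: "y \<otimes>\<^bsub>A\<^esub> x \<in> ?J" if "x \<in> ?J" "y \<in> nucleus A" for x y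
    using lJ that by (auto simp: left_ideal_def)
  have right: "x \<otimes>\<^bsub>A\<^esub> y \<in> ?J" if x: "x \<in> ?J" and y: "y \<in> nucleus A" for x y
  proof (rule supported_induct[of y nuc_support])
    have xc: "x \<in> carrier A" using x sub N.nucleus_carrier by blast
    show "y \<in> carrier A" using y by (rule N.nucleus_carrier)
    show "i \<in> nuc_support" if "i < n" "y i \<noteq> \<zero>" for i using y that by (simp add: nucleus_A)
    show z: "x \<otimes>\<^bsub>A\<^esub> \<zero>\<^bsub>A\<^esub> \<in> ?J" using zero xc by (simp add: N.r_zero_mult)
    show "x \<otimes>\<^bsub>A\<^esub> (u \<oplus>\<^bsub>A\<^esub> v) \<in> ?J"
      if "u \<in> carrier A" "v \<in> carrier A" "x \<otimes>\<^bsub>A\<^esub> u \<in> ?J" "x \<otimes>\<^bsub>A\<^esub> v \<in> ?J" for u v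
      using that xc add by (simp add: N.r_add_mult)
    fix a i assume ai: "a \<in> carrier K" "i < n" "i \<in> nuc_support"
    show "x \<otimes>\<^bsub>A\<^esub> elt a i \<in> ?J"
    proof (cases "a = \<zero>")
      case True
      then show ?thesis using z by (simp add: elt_zero)
    next
      case False
      then obtain v where v: "v \<in> nucleus A" "elt a i \<otimes>\<^bsub>A\<^esub> v = \<one>\<^bsub>A\<^esub>" "v \<otimes>\<^bsub>A\<^esub> elt a i = \<one>\<^bsub>A\<^esub>"
        using monomial_inverse[OF ai(3,1)] by blast
      then show ?thesis
        using NA.jacobson_radical_mult_unit[OF x, of "elt a i" v] elt_nucleus[OF ai(1,3)] by simp
    qed
  qed
  have "\<one>\<^bsub>A\<^esub> \<notin> ?J" using NA.jacobson_radical_proper one_neq_zero_A by simp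
  then have "x = \<zero>\<^bsub>A\<^esub>" if "x \<in> ?J" for x
    using nucleus_ideal_contains_one[OF sub zero add left right that] by blast
  with zero show ?thesis by blast
qed

text \<open>The quotient of the nucleus by its Jacobson radical, which is zero by the preceding lemma. The cosets
  are singletons, so this is a copy of the nucleus.\<close>

abbreviation "Q \<equiv> quotient_algebra NA {\<zero>\<^bsub>A\<^esub>}"

lemma coset_NA: "x \<in> nucleus A \<Longrightarrow> {\<zero>\<^bsub>A\<^esub>} +>\<^bsub>NA\<^esub> x = {x}"
  using N.nucleus_carrier by (simp add: a_r_coset_def')

lemma Q_carrier: "carrier Q = (\<lambda>x. {x}) ` nucleus A"
proof -
  have "carrier Q = (\<lambda>x. {\<zero>\<^bsub>A\<^esub>} +>\<^bsub>NA\<^esub> x) ` nucleus A"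
    by (auto simp: quotient_algebra_def FactRing_def A_RCOSETS_def' a_r_coset_def')
  also have "\<dots> = (\<lambda>x. {x}) ` nucleus A" by (rule image_cong) (simp_all add: coset_NA)
  finally show ?thesis .
qed

lemma Q_mult: "\<lbrakk>x \<in> nucleus A; y \<in> nucleus A\<rbrakk> \<Longrightarrow> {x} \<otimes>\<^bsub>Q\<^esub> {y} = {x \<otimes>\<^bsub>A\<^esub> y}"
  by (simp add: quotient_algebra_def FactRing_def rcoset_mult_def coset_NA N.nucleus_mult)

lemma Q_add: "{x} \<oplus>\<^bsub>Q\<^esub> {y} = {x \<oplus>\<^bsub>A\<^esub> y}"
  by (simp add: quotient_algebra_def FactRing_def set_add_def')

lemma Q_one: "\<one>\<^bsub>Q\<^esub> = {\<one>\<^bsub>A\<^esub>}"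
  by (simp add: quotient_algebra_def FactRing_def coset_NA N.nucleus_one)

lemma Q_zero: "\<zero>\<^bsub>Q\<^esub> = {\<zero>\<^bsub>A\<^esub>}"
  by (simp add: quotient_algebra_def FactRing_def)

lemma Q_smult: "\<lbrakk>a \<in> F; x \<in> nucleus A\<rbrakk> \<Longrightarrow> a \<odot>\<^bsub>Q\<^esub> {x} = {a \<odot>\<^bsub>A\<^esub> x}"
  using N.nucleus_smult[of a x] by (simp add: quotient_algebra_def coset_NA)

lemma Q_ring: "ring Q"
proof -
  interpret NA: ring NA by (rule N.nucleus_ring)
  have "(\<lambda>x. {x}) \<in> ring_iso NA Q"
    unfolding ring_iso_def
  proof (intro CollectI conjI)
    show "(\<lambda>x. {x}) \<in> ring_hom NA Q"
      by (rule ring_hom_memI) (auto simp: Q_carrier Q_mult Q_add Q_one)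
    show "bij_betw (\<lambda>x. {x}) (carrier NA) (carrier Q)"
      by (simp add: Q_carrier bij_betw_def)
  qed
  then have "ring (Q\<lparr>zero := {\<zero>\<^bsub>NA\<^esub>}\<rparr>)" by (rule NA.ring_iso_imp_img_ring)
  moreover have "Q\<lparr>zero := {\<zero>\<^bsub>NA\<^esub>}\<rparr> = Q" by (simp add: quotient_algebra_def FactRing_def)
  ultimately show ?thesis by simp
qed

lemma Q_minimal: "minimal_ideal (carrier Q) Q"
  unfolding minimal_ideal_def
proof (intro conjI allI impI)
  interpret Q: ring Q by (rule Q_ring)
  show "ideal (carrier Q) Q" by (rule Q.oneideal)
  have "{\<one>\<^bsub>A\<^esub>} \<in> carrier Q" by (simp add: Q_carrier N.nucleus_one)
  then show "carrier Q \<noteq> {\<zero>\<^bsub>Q\<^esub>}" using one_neq_zero_A by (auto simp: Q_zero)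
  fix J assume J: "ideal J Q \<and> J \<subseteq> carrier Q"
  interpret J: ideal J Q using J by blast
  let ?I = "{x \<in> nucleus A. {x} \<in> J}"
  have Qc: "{y} \<in> carrier Q" if "y \<in> nucleus A" for y using that by (simp add: Q_carrier)
  show "J = {\<zero>\<^bsub>Q\<^esub>} \<or> J = carrier Q"
  proof (cases "\<exists>x\<in>?I. x \<noteq> \<zero>\<^bsub>A\<^esub>")
    case True
    then obtain x where x: "x \<in> ?I" "x \<noteq> \<zero>\<^bsub>A\<^esub>" by blast
    have "\<one>\<^bsub>A\<^esub> \<in> ?I"
    proof (rule nucleus_ideal_contains_one[OF _ _ _ _ _ x])
      show "\<zero>\<^bsub>A\<^esub> \<in> ?I" using J.zero_closed by (simp add: Q_zero N.nucleus_zero)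
      show "u \<oplus>\<^bsub>A\<^esub> v \<in> ?I" if "u \<in> ?I" "v \<in> ?I" for u v
        using J.a_closed[of "{u}" "{v}"] that by (simp add: Q_add N.nucleus_add)
      show "v \<otimes>\<^bsub>A\<^esub> u \<in> ?I" if "u \<in> ?I" "v \<in> nucleus A" for u v
        using J.I_l_closed[of "{u}" "{v}"] that Qc by (simp add: Q_mult N.nucleus_mult)
      show "u \<otimes>\<^bsub>A\<^esub> v \<in> ?I" if "u \<in> ?I" "v \<in> nucleus A" for u v
        using J.I_r_closed[of "{u}" "{v}"] that Qc by (simp add: Q_mult N.nucleus_mult)
    qed auto
    then have "\<one>\<^bsub>Q\<^esub> \<in> J" by (simp add: Q_one)
    then show ?thesis using J.one_imp_carrier by blast
  next
    case False
    then have "J \<subseteq> {\<zero>\<^bsub>Q\<^esub>}" using J by (auto simp: Q_carrier Q_zero)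
    then show ?thesis using J.zero_closed by blast
  qed
qed

lemma Q_atom: "Q \<in> atoms A"
proof -
  interpret Q: ring Q by (rule Q_ring)
  have "(THE e. e \<in> carrier Q \<and> (\<forall>x\<in>carrier Q. e \<otimes>\<^bsub>Q\<^esub> x = x \<and> x \<otimes>\<^bsub>Q\<^esub> e = x)) = \<one>\<^bsub>Q\<^esub>"
  proof (rule the_equality)
    fix e assume e: "e \<in> carrier Q \<and> (\<forall>x\<in>carrier Q. e \<otimes>\<^bsub>Q\<^esub> x = x \<and> x \<otimes>\<^bsub>Q\<^esub> e = x)"
    then have "e \<otimes>\<^bsub>Q\<^esub> \<one>\<^bsub>Q\<^esub> = \<one>\<^bsub>Q\<^esub>" by blast
    then show "e = \<one>\<^bsub>Q\<^esub>" using e by simp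
  qed simp
  moreover have "Q\<lparr>carrier := carrier Q, one := \<one>\<^bsub>Q\<^esub>\<rparr> = Q" by (simp add: quotient_algebra_def)
  ultimately have "Q \<in> simple_components Q"
    unfolding simple_components_def using Q_minimal by (intro CollectI exI[of _ "carrier Q"]) simp
  then show ?thesis by (simp add: atoms_def jacobson_nucleus)
qed

text \<open>In the component \<open>l\<close>, commuting with \<open>x \<in> K\<close> means that \<open>\<tau>\<^sub>l\<close> fixes \<open>x\<close>, and elements of the nucleus only
  have components with index in \<open>nuc_support\<close>.\<close>

lemma Q_center:
  assumes x: "x \<in> carrier K" and fixed: "\<And>s. s \<in> nuc_support \<Longrightarrow> \<tau> s x = x"
  shows "{elt x 0} \<in> alg_center Q"
proof -
  interpret Q: ring Q by (rule Q_ring)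
  have xn: "elt x 0 \<in> nucleus A" using x nuc_support_0 by (rule elt_nucleus)
  have "elt x 0 \<otimes>\<^bsub>A\<^esub> y = y \<otimes>\<^bsub>A\<^esub> elt x 0" if y: "y \<in> nucleus A" for y
  proof (rule A_eqI)
    have yc: "y \<in> carrier A" using y by (rule N.nucleus_carrier)
    show "elt x 0 \<otimes>\<^bsub>A\<^esub> y \<in> carrier A" "y \<otimes>\<^bsub>A\<^esub> elt x 0 \<in> carrier A"
      using x yc by (auto intro: N.mult_closed)
    fix l assume l: "l < n"
    have yl: "y l \<in> carrier K" using yc l by (rule coord_closed)
    have "\<tau> l x \<otimes> y l = y l \<otimes> x"
    proof (cases "y l = \<zero>")
      case False
      then have "l \<in> nuc_support" using y l by (simp add: nucleus_A)
      then show ?thesis using fixed x yl by (simp add: m_comm)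
    qed (use x l in simp)
    then show "(elt x 0 \<otimes>\<^bsub>A\<^esub> y) l = (y \<otimes>\<^bsub>A\<^esub> elt x 0) l"
      using mult_K_coord[OF yc l x] by simp
  qed
  then have comm: "{elt x 0} \<otimes>\<^bsub>Q\<^esub> y = y \<otimes>\<^bsub>Q\<^esub> {elt x 0}" if "y \<in> carrier Q" for y
    using that xn by (auto simp: Q_carrier Q_mult)
  have "associator Q u v w = \<zero>\<^bsub>Q\<^esub>" if "u \<in> carrier Q" "v \<in> carrier Q" "w \<in> carrier Q" for u v w
    using that by (simp add: associator_def Q.m_assoc)
  moreover have "{elt x 0} \<in> carrier Q" using xn by (simp add: Q_carrier)
  ultimately have "{elt x 0} \<in> nucleus Q"
    by (simp add: nucleus_def left_nucleus_def middle_nucleus_def right_nucleus_def)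
  with comm show ?thesis by (simp add: alg_center_def)
qed

text \<open>Semicentrality forces the center of the only atom, hence the fixed field of \<open>nuc_support\<close>, down to
  \<open>F\<close>, so by the Galois correspondence the nucleus is all of \<open>A\<close>.\<close>

theorem semicentral_imp_associative:
  assumes "semicentral base A"
  shows "associative_mult A"
proof -
  have central: "alg_center Q = (\<lambda>f. f \<odot>\<^bsub>Q\<^esub> \<one>\<^bsub>Q\<^esub>) ` F"
    using assms Q_atom by (auto simp: semicentral_def central_algebra_def)
  have inF: "x \<in> F" if x: "x \<in> carrier K" "\<And>s. s \<in> nuc_support \<Longrightarrow> \<tau> s x = x" for x
  proof -
    obtain f where f: "f \<in> F" "{elt x 0} = f \<odot>\<^bsub>Q\<^esub> \<one>\<^bsub>Q\<^esub>"
      using Q_center[OF x] central by blast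
    moreover have "f \<odot>\<^bsub>Q\<^esub> \<one>\<^bsub>Q\<^esub> = {f \<odot>\<^bsub>A\<^esub> \<one>\<^bsub>A\<^esub>}"
      unfolding Q_one by (rule Q_smult[OF f(1) N.nucleus_one])
    moreover have "f \<odot>\<^bsub>A\<^esub> \<one>\<^bsub>A\<^esub> = elt f 0"
      using f(1) F_sub by (auto simp: one_A smult_elt)
    ultimately have "elt x 0 = elt f 0" by simp
    then show ?thesis using f(1) elt_eq_iff[OF n_pos] by simp
  qed
  have "nuc_support = {..<n}"
    by (rule submonoid_fixing_base_full[OF nuc_support_sub nuc_support_0 nuc_support_add inF])
  then show ?thesis by (rule associative_if_full_support)
qed

end

theorem proposition2p4:
  fixes K :: "('k, 'm) ring_scheme" and F :: "'k set"
    and n :: nat and \<tau> :: "nat \<Rightarrow> 'k \<Rightarrow> 'k" and k :: "nat \<Rightarrow> 'k"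
  assumes "galois_extension K F"
    and "ring.dimension K n F (carrier K)"
    and "comm_group (Gal K F)"
    and "bij_betw \<tau> {..<n} (carrier (Gal K F))"
    and "\<tau> 0 = \<one>\<^bsub>Gal K F\<^esub>"
    and "cyclic_enumeration K F n \<tau>"
    and "k \<in> {..<n} \<rightarrow> carrier K - {\<zero>\<^bsub>K\<^esub>}"
  shows "(Men_K K n \<subseteq> left_nucleus (Men K n \<tau> k) \<and>
          Men_K K n \<subseteq> middle_nucleus (Men K n \<tau> k) \<and>
          Men_K K n \<subseteq> right_nucleus (Men K n \<tau> k)) \<and>
         (semiassociative (K\<lparr>carrier := F\<rparr>) (Men K n \<tau> k) \<and>
          maximal_commutative_subalgebra (K\<lparr>carrier := F\<rparr>) (Men K n \<tau> k) (Men_K K n)) \<and>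
         (\<not> associative_mult (Men K n \<tau> k) \<longrightarrow>
          \<not> homogeneous (K\<lparr>carrier := F\<rparr>) (Men K n \<tau> k))"
proof -
  interpret menichetti K F n \<tau> k
    using assms by (intro menichetti.intro cyclic_galois.intro cyclic_galois_axioms.intro
        menichetti_axioms.intro) (simp_all add: galois_extension_def)
  show ?thesis
    using K_nucleus semiassociative_A maximal_commutative_K semicentral_imp_associative
    by (auto simp: nucleus_def homogeneous_def)
qed

end
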